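(* Assume Projective Determinacy. Let $n\ge1$ and let $\mathcal{S}=\{A_1,\dots,A_m\}$ be a finite family of $E^1_n$ sets which has no least element with respect to $\subseteq$. Then every element of the Rogers semilattice $\mathcal{R}^1_n(\mathcal{S})$ has a minimal cover. In particular, $\mathcal{R}^1_n(\mathcal{S})$ is upwards dense (every element has a strictly greater element).
   Context: Work in ZF+DC+PD. $E^1_n$ denotes $\Pi^1_n$ if $n$ is odd and $\Sigma^1_n$ if $n$ is even (lightface). A numbering of a countable $\mathcal{S}\subset P(\omega)$ is a surjection $\nu:\omega\to\mathcal{S}$; it is $E^1_n$-computable if $\{\langle k,x\rangle: x\in\nu(k)\}\in E^1_n$. $\nu\le\mu$ iff $\nu=\mu\circ f$ for some total computable $f$; $\nu\equiv\mu$ iff $\nu\le\mu\le\nu$. $\mathcal{R}^1_n(\mathcal{S})$ is the set of $\equiv$-classes of $E^1_n$-computable numberings of $\mathcal{S}$, ordered by $\le$, with join induced by $(\nu\oplus\mu)(2x)=\nu(x)$, $(\nu\oplus\mu)(2x+1)=\mu(x)$. In an upper semilattice, $b$ is a minimal cover of $a$ if $a<b$ and there is no $c$ with $a<c<b$. *)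

theory Defs
  imports "HOL-Analysis.Function_Topology" "HOL-Library.Nat_Bijection" "HOL-Algebra.Order"
begin

datatype recf = RZero | RSucc | RProj nat | RComp recf "recf list" | RPrim recf recf | RMu recf

text \<open>\<open>recf_eval r xs y\<close>: the partial recursive function with program \<open>r\<close> is defined at the
  argument list \<open>xs\<close> and has the value \<open>y\<close> there. In primitive recursion and minimisation the
  first argument is the running one.\<close>

inductive recf_eval :: "recf \<Rightarrow> nat list \<Rightarrow> nat \<Rightarrow> bool" where
  "recf_eval RZero xs 0"
| "recf_eval RSucc (x # xs) (Suc x)"
| "i < length xs \<Longrightarrow> recf_eval (RProj i) xs (xs ! i)"
| "list_all2 (\<lambda>g y. recf_eval g xs y) gs ys \<Longrightarrow> recf_eval f ys z \<Longrightarrow> recf_eval (RComp f gs) xs z"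
| "recf_eval f xs y \<Longrightarrow> recf_eval (RPrim f g) (0 # xs) y"
| "recf_eval (RPrim f g) (k # xs) y \<Longrightarrow> recf_eval g (k # y # xs) z \<Longrightarrow>
     recf_eval (RPrim f g) (Suc k # xs) z"
| "recf_eval f (k # xs) 0 \<Longrightarrow> (\<forall>i<k. \<exists>y. recf_eval f (i # xs) (Suc y)) \<Longrightarrow>
     recf_eval (RMu f) xs k"

definition computable :: "(nat \<Rightarrow> nat) \<Rightarrow> bool" where
  "computable f \<longleftrightarrow> (\<exists>r. \<forall>x. recf_eval r [x] (f x))"

text \<open>Second-order arithmetic with number variables and unary function variables, each sort
  indexed by the naturals and interpreted in the standard model; \<open>TApp i t\<close> applies the
  \<open>i\<close>-th function variable to \<open>t\<close>.\<close>

datatype tm = TVar nat | TZero | TSuc tm | TAdd tm tm | TMul tm tm | TApp nat tm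

datatype fm = Eq tm tm | Neg fm | Conj fm fm | ExN nat fm | ExF nat fm

abbreviation AllF :: "nat \<Rightarrow> fm \<Rightarrow> fm" where
  "AllF i \<phi> \<equiv> Neg (ExF i (Neg \<phi>))"

primrec tval :: "(nat \<Rightarrow> nat) \<Rightarrow> (nat \<Rightarrow> nat \<Rightarrow> nat) \<Rightarrow> tm \<Rightarrow> nat" where
  "tval e F (TVar i) = e i"
| "tval e F TZero = 0"
| "tval e F (TSuc t) = Suc (tval e F t)"
| "tval e F (TAdd t u) = tval e F t + tval e F u"
| "tval e F (TMul t u) = tval e F t * tval e F u"
| "tval e F (TApp i t) = F i (tval e F t)"

primrec sat :: "(nat \<Rightarrow> nat) \<Rightarrow> (nat \<Rightarrow> nat \<Rightarrow> nat) \<Rightarrow> fm \<Rightarrow> bool" where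
  "sat e F (Eq t u) \<longleftrightarrow> tval e F t = tval e F u"
| "sat e F (Neg \<phi>) \<longleftrightarrow> \<not> sat e F \<phi>"
| "sat e F (Conj \<phi> \<psi>) \<longleftrightarrow> sat e F \<phi> \<and> sat e F \<psi>"
| "sat e F (ExN i \<phi>) \<longleftrightarrow> (\<exists>k. sat (e(i := k)) F \<phi>)"
| "sat e F (ExF i \<phi>) \<longleftrightarrow> (\<exists>\<alpha>. sat e (F(i := \<alpha>)) \<phi>)"

primrec arithmetical :: "fm \<Rightarrow> bool" where
  "arithmetical (Eq t u) \<longleftrightarrow> True"
| "arithmetical (Neg \<phi>) \<longleftrightarrow> arithmetical \<phi>"
| "arithmetical (Conj \<phi> \<psi>) \<longleftrightarrow> arithmetical \<phi> \<and> arithmetical \<psi>"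
| "arithmetical (ExN i \<phi>) \<longleftrightarrow> arithmetical \<phi>"
| "arithmetical (ExF i \<phi>) \<longleftrightarrow> False"

fun Sigma1_fm :: "nat \<Rightarrow> fm \<Rightarrow> bool" and Pi1_fm :: "nat \<Rightarrow> fm \<Rightarrow> bool" where
  "Sigma1_fm 0 \<phi> \<longleftrightarrow> arithmetical \<phi>"
| "Sigma1_fm (Suc n) \<phi> \<longleftrightarrow> (\<exists>i \<psi>. \<phi> = ExF i \<psi> \<and> Pi1_fm n \<psi>)"
| "Pi1_fm 0 \<phi> \<longleftrightarrow> arithmetical \<phi>"
| "Pi1_fm (Suc n) \<phi> \<longleftrightarrow> (\<exists>i \<psi>. \<phi> = AllF i \<psi> \<and> Sigma1_fm n \<psi>)"

text \<open>The number variable \<open>0\<close> is the argument. A defining formula must define the set under every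
  assignment to the other variables, which rules out parameters: substituting zero for the other
  free number variables and the zero function for the free function variables gives a formula
  without parameters defining the same set.\<close>

definition Sigma1 :: "nat \<Rightarrow> nat set set" where
  "Sigma1 n = {A. \<exists>\<phi>. Sigma1_fm n \<phi> \<and> (\<forall>e F. sat e F \<phi> \<longleftrightarrow> e 0 \<in> A)}"

definition Pi1 :: "nat \<Rightarrow> nat set set" where
  "Pi1 n = {A. \<exists>\<phi>. Pi1_fm n \<phi> \<and> (\<forall>e F. sat e F \<phi> \<longleftrightarrow> e 0 \<in> A)}"

definition E1 :: "nat \<Rightarrow> nat set set" where
  "E1 n = (if odd n then Pi1 n else Sigma1 n)"

text \<open>The homeomorphism identifying the square of Baire space with Baire space.\<close>

definition interleave :: "(nat \<Rightarrow> nat) \<Rightarrow> (nat \<Rightarrow> nat) \<Rightarrow> nat \<Rightarrow> nat" where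
  "interleave \<alpha> \<beta> k = (if even k then \<alpha> (k div 2) else \<beta> (k div 2))"

text \<open>The boldface hierarchy on Baire space. With open sets at level \<open>0\<close>, level \<open>1\<close> consists of
  the projections of closed sets, and level \<open>n + 1\<close> of the projections of complements of sets
  of level \<open>n\<close>.\<close>

fun boldface_Sigma1 :: "nat \<Rightarrow> (nat \<Rightarrow> nat) set set" where
  "boldface_Sigma1 0 = {A. open A}"
| "boldface_Sigma1 (Suc n) = {{\<alpha>. \<exists>\<beta>. interleave \<alpha> \<beta> \<in> B} | B. - B \<in> boldface_Sigma1 n}"

definition projective :: "(nat \<Rightarrow> nat) set \<Rightarrow> bool" where
  "projective A \<longleftrightarrow> (\<exists>n\<ge>1. A \<in> boldface_Sigma1 n)"

text \<open>Player I chooses the values of the play \<open>x\<close> at even positions, player II those at odd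
  positions, and I wins iff \<open>x \<in> A\<close>. A strategy maps the list of all earlier moves to the next
  move.\<close>

definition wins_I :: "(nat list \<Rightarrow> nat) \<Rightarrow> (nat \<Rightarrow> nat) set \<Rightarrow> bool" where
  "wins_I \<sigma> A \<longleftrightarrow> (\<forall>x. (\<forall>k. even k \<longrightarrow> x k = \<sigma> (map x [0..<k])) \<longrightarrow> x \<in> A)"

definition wins_II :: "(nat list \<Rightarrow> nat) \<Rightarrow> (nat \<Rightarrow> nat) set \<Rightarrow> bool" where
  "wins_II \<tau> A \<longleftrightarrow> (\<forall>x. (\<forall>k. odd k \<longrightarrow> x k = \<tau> (map x [0..<k])) \<longrightarrow> x \<notin> A)"

definition determined :: "(nat \<Rightarrow> nat) set \<Rightarrow> bool" where
  "determined A \<longleftrightarrow> (\<exists>\<sigma>. wins_I \<sigma> A) \<or> (\<exists>\<tau>. wins_II \<tau> A)"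

definition projective_determinacy :: bool where
  "projective_determinacy \<longleftrightarrow> (\<forall>A. projective A \<longrightarrow> determined A)"

definition computable_numberings :: "nat \<Rightarrow> nat set set \<Rightarrow> (nat \<Rightarrow> nat set) set" where
  "computable_numberings n S =
     {\<nu>. range \<nu> = S \<and> {prod_encode (k, x) | k x. x \<in> \<nu> k} \<in> E1 n}"

definition reducible :: "(nat \<Rightarrow> nat set) \<Rightarrow> (nat \<Rightarrow> nat set) \<Rightarrow> bool" where
  "reducible \<nu> \<mu> \<longleftrightarrow> (\<exists>f. computable f \<and> \<nu> = \<mu> \<circ> f)"

definition numbering_equiv :: "nat \<Rightarrow> nat set set \<Rightarrow> ((nat \<Rightarrow> nat set) \<times> (nat \<Rightarrow> nat set)) set" where
  "numbering_equiv n S =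
     {(\<nu>, \<mu>). \<nu> \<in> computable_numberings n S \<and> \<mu> \<in> computable_numberings n S \<and>
              reducible \<nu> \<mu> \<and> reducible \<mu> \<nu>}"

text \<open>The join is not a component of the structure, since it is the least upper bound for the order.\<close>

definition Rogers :: "nat \<Rightarrow> nat set set \<Rightarrow> (nat \<Rightarrow> nat set) set gorder" where
  "Rogers n S =
     \<lparr>carrier = computable_numberings n S // numbering_equiv n S,
      eq = (=),
      le = (\<lambda>a b. \<exists>\<nu>\<in>a. \<exists>\<mu>\<in>b. reducible \<nu> \<mu>)\<rparr>"

definition minimal_cover :: "('a, 'b) gorder_scheme \<Rightarrow> 'a \<Rightarrow> 'a \<Rightarrow> bool" where
  "minimal_cover L a b \<longleftrightarrow>
     a \<in> carrier L \<and> b \<in> carrier L \<and> a \<sqsubset>\<^bsub>L\<^esub> b \<and>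
     \<not> (\<exists>c\<in>carrier L. a \<sqsubset>\<^bsub>L\<^esub> c \<and> c \<sqsubset>\<^bsub>L\<^esub> b)"

lemma computable_id: "computable (\<lambda>x. x)"
proof -
  have "recf_eval (RProj 0) [x] x" for x
    using recf_eval.intros(3)[of 0 "[x]"] by simp
  then show ?thesis unfolding computable_def by blast
qed

lemma computable_comp:
  assumes "computable f" "computable g"
  shows "computable (f \<circ> g)"
proof -
  from assms obtain r s where r: "\<And>x. recf_eval r [x] (f x)" and s: "\<And>x. recf_eval s [x] (g x)"
    unfolding computable_def by blast
  have "recf_eval (RComp r [s]) [x] ((f \<circ> g) x)" for x
    by (rule recf_eval.intros(4)[where ys = "[g x]"]) (simp_all add: r s)
  then show ?thesis unfolding computable_def by blast
qed

lemma reducible_refl: "reducible \<nu> \<nu>"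
  unfolding reducible_def using computable_id by (auto simp: comp_def)

lemma reducible_trans:
  assumes "reducible \<nu> \<mu>" "reducible \<mu> \<kappa>"
  shows "reducible \<nu> \<kappa>"
  using assms computable_comp unfolding reducible_def by (metis comp_assoc)

lemma equiv_numbering_equiv:
  "equiv (computable_numberings n S) (numbering_equiv n S)"
  by (rule equivI)
     (auto simp: numbering_equiv_def refl_on_def sym_def trans_def
           intro: reducible_refl reducible_trans)

lemma Rogers_le_class_iff:
  assumes "\<nu> \<in> computable_numberings n S" "\<mu> \<in> computable_numberings n S"
  shows "numbering_equiv n S `` {\<nu>} \<sqsubseteq>\<^bsub>Rogers n S\<^esub> numbering_equiv n S `` {\<mu>} \<longleftrightarrow> reducible \<nu> \<mu>"
proof -
  have "\<nu> \<in> numbering_equiv n S `` {\<nu>}" "\<mu> \<in> numbering_equiv n S `` {\<mu>}"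
    using assms by (auto simp: numbering_equiv_def intro: reducible_refl)
  then show ?thesis
    by (auto simp: Rogers_def numbering_equiv_def intro: reducible_trans)
qed

lemma partial_order_Rogers: "partial_order (Rogers n S)"
proof -
  let ?C = "computable_numberings n S" and ?R = "numbering_equiv n S"
  have car: "\<exists>\<nu>\<in>?C. a = ?R `` {\<nu>}" if "a \<in> carrier (Rogers n S)" for a
    using that by (auto simp: Rogers_def elim: quotientE)
  have eq: "eq (Rogers n S) = (=)" by (simp add: Rogers_def)
  show ?thesis
  proof
    show "x \<sqsubseteq>\<^bsub>Rogers n S\<^esub> x" if "x \<in> carrier (Rogers n S)" for x
      using car[OF that] by (auto simp: Rogers_le_class_iff intro: reducible_refl)
    show "x .=\<^bsub>Rogers n S\<^esub> y"
      if le: "x \<sqsubseteq>\<^bsub>Rogers n S\<^esub> y" "y \<sqsubseteq>\<^bsub>Rogers n S\<^esub> x"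
        and xs: "x \<in> carrier (Rogers n S)" "y \<in> carrier (Rogers n S)" for x y
    proof -
      obtain \<nu> \<mu> where *: "\<nu> \<in> ?C" "\<mu> \<in> ?C" "x = ?R `` {\<nu>}" "y = ?R `` {\<mu>}"
        using xs[THEN car] by blast
      have "reducible \<nu> \<mu>" "reducible \<mu> \<nu>"
        using le * by (simp_all add: Rogers_le_class_iff)
      then have "(\<nu>, \<mu>) \<in> ?R"
        using * by (simp add: numbering_equiv_def)
      then show ?thesis
        using * eq equiv_class_eq[OF equiv_numbering_equiv] by simp
    qed
    show "x \<sqsubseteq>\<^bsub>Rogers n S\<^esub> z"
      if le: "x \<sqsubseteq>\<^bsub>Rogers n S\<^esub> y" "y \<sqsubseteq>\<^bsub>Rogers n S\<^esub> z"
        and xs: "x \<in> carrier (Rogers n S)" "y \<in> carrier (Rogers n S)" "z \<in> carrier (Rogers n S)"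
      for x y z
    proof -
      obtain \<nu> \<mu> \<kappa> where "\<nu> \<in> ?C" "\<mu> \<in> ?C" "\<kappa> \<in> ?C"
          "x = ?R `` {\<nu>}" "y = ?R `` {\<mu>}" "z = ?R `` {\<kappa>}"
        using xs[THEN car] by blast
      then show ?thesis
        using le reducible_trans by (simp add: Rogers_le_class_iff)
    qed
  qed (auto simp: eq)
qed

end

theory Submission
  imports Defs
begin

text \<open>
  Given a numbering \<open>\<nu>\<close>, let \<open>B\<^sub>0\<close> and \<open>B\<^sub>1\<close> be two minimal members of the family. Every \<open>\<nu> k\<close> fails to be
  contained in one of them, which is an \<open>E\<^sup>1\<^sub>n\<close> condition because the family is finite. Projective
  determinacy gives \<open>E\<^sup>1\<^sub>n\<close> the prewellordering property (first periodicity theorem), hence the reduction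
  property, so some \<open>\<Delta>\<^sup>1\<^sub>n\<close> function picks \<open>b k \<in> {B\<^sub>0, B\<^sub>1}\<close> with \<open>b k \<noteq> \<nu> k\<close>.

  Thin out \<open>\<omega>\<close> through infinite computable sets \<open>R\<^sub>0 \<supseteq> R\<^sub>1 \<supseteq> \<dots>\<close>, choosing \<open>R\<^bsub>e+1\<^esub>\<close> inside the
  range \<open>W\<^sub>e\<close> of the \<open>e\<close>-th reduction whenever that range meets \<open>R\<^sub>e\<close> in an infinite set, and pick
  \<open>m\<^sub>0 < m\<^sub>1 < \<dots>\<close> with \<open>m\<^sub>e \<in> R\<^bsub>e+1\<^esub>\<close>. Let \<open>\<mu>\<close> be \<open>B\<^sub>0\<close> everywhere except that \<open>\<mu> m\<^sub>e\<close> is \<open>b\<close> at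
  \<open>\<phi>\<^sub>e m\<^sub>e\<close>, so that \<open>\<mu>\<close> does not reduce to \<open>\<nu>\<close>. A numbering between \<open>\<nu>\<close> and \<open>\<nu> \<oplus> \<mu>\<close> that uses only
  finitely many \<open>m\<^sub>e\<close> reduces to \<open>\<nu>\<close>; otherwise it uses all of a computable set that contains almost
  all \<open>m\<^sub>e\<close>, and then \<open>\<nu> \<oplus> \<mu>\<close> reduces to it. So \<open>\<nu> \<oplus> \<mu>\<close> is a minimal cover.
\<close>

section \<open>Lightface classes and formulas\<close>

text \<open>No member of the family lies below two different minimal members, so at each
  \<open>k\<close> at least one of the two non-inclusions holds, and each is a finite disjunction of
  memberships in \<open>\<nu> k\<close>. The choice between them has to be \<Delta>^1_n because the
  graph of \<open>\<mu>\<close> refers both to the set where \<open>\<mu>\<close> takes the value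
  \<open>B1\<close> and to its complement. The sets are thinned to computable ones so that the final
  reduction can decide where a search will succeed; this is possible because an infinite computably
  enumerable set has an infinite computable subset. The thinning itself asks whether programs are
  total and whether sets are infinite, so the diagonal points are not computable but only
  \<Delta>^1_1. Much of the development serves to show that such functions, including evaluation of
  programs, may be substituted into E^1_n conditions. The norms on \<Pi>^1_1 come from the same
  games as at higher odd levels: an existential number condition is normed by its least witness, and
  since its comparisons are open, quantifiers over plays collapse to number quantifiers.\<close>

type_synonym baire = "nat \<Rightarrow> nat"
type_synonym asg = "nat \<Rightarrow> baire"

section \<open>Substitution in quantifier-free formulas\<close>

primrec qf :: "fm \<Rightarrow> bool" where
  "qf (Eq t u) \<longleftrightarrow> True"
| "qf (Neg \<phi>) \<longleftrightarrow> qf \<phi>"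
| "qf (Conj \<phi> \<psi>) \<longleftrightarrow> qf \<phi> \<and> qf \<psi>"
| "qf (ExN i \<phi>) \<longleftrightarrow> False"
| "qf (ExF i \<phi>) \<longleftrightarrow> False"

primrec vsub :: "(nat \<Rightarrow> tm) \<Rightarrow> tm \<Rightarrow> tm" where
  "vsub w (TVar i) = w i"
| "vsub w TZero = TZero"
| "vsub w (TSuc t) = TSuc (vsub w t)"
| "vsub w (TAdd t u) = TAdd (vsub w t) (vsub w u)"
| "vsub w (TMul t u) = TMul (vsub w t) (vsub w u)"
| "vsub w (TApp i t) = TApp i (vsub w t)"

lemma tval_vsub: "tval e F (vsub w t) = tval (\<lambda>i. tval e F (w i)) F t"
  by (induction t) auto

primrec fren :: "baire \<Rightarrow> tm \<Rightarrow> tm" where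
  "fren \<rho> (TVar i) = TVar i"
| "fren \<rho> TZero = TZero"
| "fren \<rho> (TSuc t) = TSuc (fren \<rho> t)"
| "fren \<rho> (TAdd t u) = TAdd (fren \<rho> t) (fren \<rho> u)"
| "fren \<rho> (TMul t u) = TMul (fren \<rho> t) (fren \<rho> u)"
| "fren \<rho> (TApp i t) = TApp (\<rho> i) (fren \<rho> t)"

lemma tval_fren: "tval e F (fren \<rho> t) = tval e (\<lambda>i. F (\<rho> i)) t"
  by (induction t) auto

text \<open>In the body \<open>h i\<close> of the function replacing the \<open>i\<close>-th function variable, \<open>TVar 0\<close> is the
  argument and \<open>TVar (Suc j)\<close> the ambient number variable \<open>j\<close>.\<close>

definition fun_subst :: "(nat \<Rightarrow> tm) \<Rightarrow> baire \<Rightarrow> asg \<Rightarrow> asg" where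
  "fun_subst h e F = (\<lambda>i k. tval (case_nat k e) F (h i))"

text \<open>Number variables are replaced by terms and function variables by explicit definitions,
  all at once. The body \<open>h i\<close> only passes through \<open>vsub\<close>, which leaves its
  function variables alone, so that nothing is substituted twice.\<close>

primrec tsub :: "(nat \<Rightarrow> tm) \<Rightarrow> (nat \<Rightarrow> tm) \<Rightarrow> tm \<Rightarrow> tm" where
  "tsub v h (TVar i) = v i"
| "tsub v h TZero = TZero"
| "tsub v h (TSuc t) = TSuc (tsub v h t)"
| "tsub v h (TAdd t u) = TAdd (tsub v h t) (tsub v h u)"
| "tsub v h (TMul t u) = TMul (tsub v h t) (tsub v h u)"
| "tsub v h (TApp i t) = vsub (case_nat (tsub v h t) TVar) (h i)"

lemma tval_tsub: "tval e F (tsub v h t) = tval (\<lambda>i. tval e F (v i)) (fun_subst h e F) t"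
proof (induction t)
  case (TApp i t)
  have "(\<lambda>j. tval e F (case_nat u TVar j)) = case_nat (tval e F u) e" for u
    by (auto split: nat.splits)
  with TApp show ?case by (simp add: tval_vsub fun_subst_def)
qed auto

primrec fsub :: "(nat \<Rightarrow> tm) \<Rightarrow> (nat \<Rightarrow> tm) \<Rightarrow> fm \<Rightarrow> fm" where
  "fsub v h (Eq t u) = Eq (tsub v h t) (tsub v h u)"
| "fsub v h (Neg \<phi>) = Neg (fsub v h \<phi>)"
| "fsub v h (Conj \<phi> \<psi>) = Conj (fsub v h \<phi>) (fsub v h \<psi>)"
| "fsub v h (ExN i \<phi>) = ExN i \<phi>"
| "fsub v h (ExF i \<phi>) = ExF i \<phi>"

lemma sat_fsub: "qf \<phi> \<Longrightarrow> sat e F (fsub v h \<phi>) \<longleftrightarrow> sat (\<lambda>i. tval e F (v i)) (fun_subst h e F) \<phi>"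
  by (induction \<phi>) (auto simp: tval_tsub)

lemma qf_fsub: "qf \<phi> \<Longrightarrow> qf (fsub v h \<phi>)"
  by (induction \<phi>) auto

lemma qf_arithmetical: "qf \<phi> \<Longrightarrow> arithmetical \<phi>"
  by (induction \<phi>) auto

text \<open>The lightface classes \<open>\<Sigma>\<^sup>1\<^sub>n\<close> on assignments to the function variables, with existential
  closures of quantifier-free formulas at level \<open>0\<close>. A quantified function becomes variable \<open>0\<close>
  and shifts the others.\<close>

primrec Sig :: "nat \<Rightarrow> (asg \<Rightarrow> bool) \<Rightarrow> bool" where
  "Sig 0 P \<longleftrightarrow> (\<exists>\<phi>. qf \<phi> \<and> (\<forall>F. P F \<longleftrightarrow> (\<exists>e. sat e F \<phi>)))"
| "Sig (Suc n) P \<longleftrightarrow> (\<exists>Q. Sig n Q \<and> (\<forall>F. P F \<longleftrightarrow> (\<exists>\<beta>. \<not> Q (case_nat \<beta> F))))"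

lemma Sig_0I: "qf \<phi> \<Longrightarrow> (\<And>F. P F \<longleftrightarrow> (\<exists>e. sat e F \<phi>)) \<Longrightarrow> Sig 0 P"
  by auto

lemma Sig_SucI: "Sig n Q \<Longrightarrow> (\<And>F. P F \<longleftrightarrow> (\<exists>\<beta>. \<not> Q (case_nat \<beta> F))) \<Longrightarrow> Sig (Suc n) P"
  by auto

text \<open>These are the substitutions under which \<open>Sig\<close> is closed: every new function
  is defined by a term from its argument and the old functions. The number assignment is fixed to
  zero since predicates of \<open>Sig\<close> see functions only.\<close>

definition term_map :: "(asg \<Rightarrow> asg) \<Rightarrow> bool" where
  "term_map G \<longleftrightarrow> (\<exists>h. \<forall>F. G F = fun_subst h (\<lambda>_. 0) F)"

lemma term_mapI:
  assumes h: "\<And>F i k. G F i k = tval (\<lambda>_. k) F (h i)"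
  shows "term_map G"
proof -
  have "G F = fun_subst (\<lambda>i. vsub (\<lambda>_. TVar 0) (h i)) (\<lambda>_. 0) F" for F
    by (intro ext) (simp add: fun_subst_def tval_vsub h)
  then show ?thesis unfolding term_map_def by blast
qed

lemma term_map_permute: "term_map (\<lambda>F i. F (\<rho> i))"
  by (rule term_mapI[where h = "\<lambda>i. TApp (\<rho> i) (TVar 0)"]) simp

lemma Sig_subst_aux: "Sig n P \<Longrightarrow> Sig n (\<lambda>F. P (fun_subst h (\<lambda>_. 0) F))"
proof (induction n arbitrary: P h)
  case 0
  then obtain \<phi> where \<phi>: "qf \<phi>" "\<And>F. P F \<longleftrightarrow> (\<exists>e. sat e F \<phi>)" by auto
  \<comment> \<open>The number variables of \<open>\<phi>\<close> are quantified, whereas the bodies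
    \<open>h i\<close> expect all their ambient number variables to be zero; hence these are
    replaced by \<open>TZero\<close> and only the argument is kept.\<close>
  let ?h = "\<lambda>i. vsub (case_nat (TVar 0) (\<lambda>_. TZero)) (h i)"
  have *: "fun_subst ?h e F = fun_subst h (\<lambda>_. 0) F" for e F
  proof (intro ext)
    fix i k
    have "(\<lambda>i. tval (case_nat k e) F (case i of 0 \<Rightarrow> TVar 0 | Suc x \<Rightarrow> TZero)) = case_nat k (\<lambda>_. 0)"
      by (auto split: nat.splits)
    then show "fun_subst ?h e F i k = fun_subst h (\<lambda>_. 0) F i k"
      by (simp add: fun_subst_def tval_vsub)
  qed
  have "sat e F (fsub TVar ?h \<phi>) \<longleftrightarrow> sat e (fun_subst h (\<lambda>_. 0) F) \<phi>" for e F
    unfolding sat_fsub[OF \<phi>(1)] * by simp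
  then show ?case using \<phi> by (intro Sig_0I[of "fsub TVar ?h \<phi>"] qf_fsub) auto
next
  case (Suc n)
  then obtain Q where Q: "Sig n Q" "\<And>F. P F \<longleftrightarrow> (\<exists>\<beta>. \<not> Q (case_nat \<beta> F))" by auto
  \<comment> \<open>The quantified function stays in slot \<open>0\<close>, and the bodies look up
    the old functions one slot further.\<close>
  let ?h = "case_nat (TApp 0 (TVar 0)) (\<lambda>i. fren Suc (h i))"
  have "fun_subst ?h (\<lambda>_. 0) (case_nat \<beta> F) = case_nat \<beta> (fun_subst h (\<lambda>_. 0) F)" for \<beta> F
    by (auto simp: fun_subst_def tval_fren split: nat.splits)
  then have "P (fun_subst h (\<lambda>_. 0) F) \<longleftrightarrow> (\<exists>\<beta>. \<not> Q (fun_subst ?h (\<lambda>_. 0) (case_nat \<beta> F)))" for F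
    by (simp add: Q(2))
  then show ?case by (rule Sig_SucI[OF Suc.IH[OF Q(1), of ?h]])
qed

lemma Sig_subst: "Sig n P \<Longrightarrow> term_map G \<Longrightarrow> Sig n (\<lambda>F. P (G F))"
  unfolding term_map_def using Sig_subst_aux by auto

lemma Sig_dual_Suc:
  assumes "Sig n P"
  shows "Sig (Suc n) (\<lambda>F. \<not> P F)"
proof -
  have "Sig n (\<lambda>F. P (\<lambda>i. F (Suc i)))" by (rule Sig_subst[OF assms term_map_permute])
  then show ?thesis by (rule Sig_SucI) simp
qed

primrec num :: "nat \<Rightarrow> tm" where
  "num 0 = TZero" | "num (Suc n) = TSuc (num n)"

lemma tval_num [simp]: "tval e F (num n) = n"
  by (induction n) auto

text \<open>Only level \<open>0\<close> needs an idea: the quantified number assignment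
  \<open>e\<close> is itself a function and can be quantified as \<open>\<beta>\<close>, variable
  \<open>i\<close> being read as \<open>\<beta> i\<close>. The negated number quantifier that the
  form of level \<open>1\<close> demands is then vacuous.\<close>

lemma Sig_Suc: "Sig n P \<Longrightarrow> Sig (Suc n) P"
proof (induction n arbitrary: P)
  case 0
  then obtain \<phi> where \<phi>: "qf \<phi>" "\<And>F. P F \<longleftrightarrow> (\<exists>e. sat e F \<phi>)" by auto
  let ?\<psi> = "Neg (fsub (\<lambda>i. TApp 0 (num i)) (\<lambda>i. TApp (Suc i) (TVar 0)) \<phi>)"
  have "sat e (case_nat \<beta> F) ?\<psi> \<longleftrightarrow> \<not> sat \<beta> F \<phi>" for e \<beta> F
    using \<phi>(1) by (simp add: sat_fsub fun_subst_def)
  then have "P F \<longleftrightarrow> (\<exists>\<beta>. \<not> (\<exists>e. sat e (case_nat \<beta> F) ?\<psi>))" for F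
    using \<phi>(2) by simp
  moreover have "Sig 0 (\<lambda>F. \<exists>e. sat e F ?\<psi>)"
    by (rule Sig_0I[of ?\<psi>]) (simp_all add: \<phi>(1) qf_fsub)
  ultimately show ?case by (intro Sig_SucI)
next
  case (Suc n)
  then obtain Q where "Sig n Q" and Q: "\<And>F. P F \<longleftrightarrow> (\<exists>\<beta>. \<not> Q (case_nat \<beta> F))"
    unfolding Sig.simps(2)[of n] by blast
  then show ?case using Suc.IH Sig_SucI by blast
qed

lemma Sig_mono: "Sig m P \<Longrightarrow> m \<le> n \<Longrightarrow> Sig n P"
  by (induction n) (auto simp: le_Suc_eq intro: Sig_Suc simp del: Sig.simps)

definition split2 :: "(nat \<Rightarrow> 'a) \<Rightarrow> (nat \<Rightarrow> 'a) \<Rightarrow> nat \<Rightarrow> 'a" where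
  "split2 f g i = (if even i then f (i div 2) else g (i div 2))"

lemma split2_simps [simp]: "split2 f g (2 * i) = f i" "split2 f g (Suc (2 * i)) = g i"
  by (auto simp: split2_def)

lemma interleave_eq_split2: "interleave = split2"
  by (auto simp: fun_eq_iff interleave_def split2_def)

lemma ex_split2: "(\<exists>h. P (\<lambda>i. h (2 * i)) (\<lambda>i. h (Suc (2 * i)))) \<longleftrightarrow> (\<exists>f g. P f g)"
proof safe
  fix f g assume "P f g"
  then show "\<exists>h. P (\<lambda>i. h (2 * i)) (\<lambda>i. h (Suc (2 * i)))"
    by (intro exI[of _ "split2 f g"]) simp
qed blast

text \<open>Both closures are proved together because the negation between two levels turns a
  conjunction into a disjunction one level below. The two quantified objects become the even and the
  odd entries of one.\<close>

lemma Sig_conj_disj: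
  "Sig n P \<Longrightarrow> Sig n Q \<Longrightarrow> Sig n (\<lambda>F. P F \<and> Q F) \<and> Sig n (\<lambda>F. P F \<or> Q F)"
proof (induction n arbitrary: P Q)
  case 0
  then obtain \<phi> \<psi> where \<phi>: "qf \<phi>" "\<And>F. P F \<longleftrightarrow> (\<exists>e. sat e F \<phi>)"
    and \<psi>: "qf \<psi>" "\<And>F. Q F \<longleftrightarrow> (\<exists>e. sat e F \<psi>)" by auto
  let ?I = "\<lambda>i. TApp i (TVar 0)"
  let ?\<phi> = "fsub (\<lambda>i. TVar (2 * i)) ?I \<phi>" and ?\<psi> = "fsub (\<lambda>i. TVar (Suc (2 * i))) ?I \<psi>"
  have 1: "sat e F ?\<phi> \<longleftrightarrow> sat (\<lambda>i. e (2 * i)) F \<phi>" "sat e F ?\<psi> \<longleftrightarrow> sat (\<lambda>i. e (Suc (2 * i))) F \<psi>" for e F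
    using \<phi> \<psi> by (simp_all add: sat_fsub fun_subst_def)
  have c: "P F \<and> Q F \<longleftrightarrow> (\<exists>e. sat e F (Conj ?\<phi> ?\<psi>))" for F
    unfolding sat.simps 1 \<phi>(2) \<psi>(2)
    using ex_split2[of "\<lambda>e d. sat e F \<phi> \<and> sat d F \<psi>"] by blast
  have d: "P F \<or> Q F \<longleftrightarrow> (\<exists>e. sat e F (Neg (Conj (Neg ?\<phi>) (Neg ?\<psi>))))" for F
    unfolding sat.simps 1 \<phi>(2) \<psi>(2)
    using ex_split2[of "\<lambda>e d. sat e F \<phi> \<or> sat d F \<psi>"] by blast
  have "qf (Conj ?\<phi> ?\<psi>)" "qf (Neg (Conj (Neg ?\<phi>) (Neg ?\<psi>)))"
    using \<phi>(1) \<psi>(1) by (simp_all add: qf_fsub)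
  then show ?case using Sig_0I[OF _ c] Sig_0I[OF _ d] by (intro conjI)
next
  case (Suc n)
  then obtain A B where A: "Sig n A" "\<And>F. P F \<longleftrightarrow> (\<exists>\<beta>. \<not> A (case_nat \<beta> F))"
    and B: "Sig n B" "\<And>F. Q F \<longleftrightarrow> (\<exists>\<beta>. \<not> B (case_nat \<beta> F))" by auto
  let ?G = "\<lambda>(F::asg) i k. case i of 0 \<Rightarrow> F 0 (2 * k) | Suc i \<Rightarrow> F (Suc i) k"
  let ?H = "\<lambda>(F::asg) i k. case i of 0 \<Rightarrow> F 0 (Suc (2 * k)) | Suc i \<Rightarrow> F (Suc i) k"
  have G: "term_map ?G"
    by (rule term_mapI[where h = "case_nat (TApp 0 (TMul (num 2) (TVar 0))) (\<lambda>i. TApp (Suc i) (TVar 0))"])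
      (simp split: nat.splits)
  have H: "term_map ?H"
    by (rule term_mapI[where h = "case_nat (TApp 0 (TSuc (TMul (num 2) (TVar 0)))) (\<lambda>i. TApp (Suc i) (TVar 0))"])
      (simp split: nat.splits)
  have eq: "?G (case_nat \<beta> F) = case_nat (\<lambda>k. \<beta> (2 * k)) F"
    "?H (case_nat \<beta> F) = case_nat (\<lambda>k. \<beta> (Suc (2 * k))) F" for \<beta> F
    by (auto split: nat.splits)
  note IH = Suc.IH[OF Sig_subst[OF A(1) G] Sig_subst[OF B(1) H]]
  have c: "P F \<and> Q F \<longleftrightarrow> (\<exists>\<beta>. \<not> (A (?G (case_nat \<beta> F)) \<or> B (?H (case_nat \<beta> F))))" for F
    unfolding A(2) B(2) eq
    using ex_split2[of "\<lambda>\<beta> \<gamma>. \<not> (A (case_nat \<beta> F) \<or> B (case_nat \<gamma> F))"] by blast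
  have d: "P F \<or> Q F \<longleftrightarrow> (\<exists>\<beta>. \<not> (A (?G (case_nat \<beta> F)) \<and> B (?H (case_nat \<beta> F))))" for F
    unfolding A(2) B(2) eq
    using ex_split2[of "\<lambda>\<beta> \<gamma>. \<not> (A (case_nat \<beta> F) \<and> B (case_nat \<gamma> F))"] by blast
  show ?case
    by (intro conjI Sig_SucI[OF IH[THEN conjunct2] c] Sig_SucI[OF IH[THEN conjunct1] d])
qed

lemmas Sig_conj = Sig_conj_disj[THEN conjunct1] and Sig_disj = Sig_conj_disj[THEN conjunct2]

lemma Sig_exF:
  assumes "Sig (Suc n) P"
  shows "Sig (Suc n) (\<lambda>F. \<exists>\<beta>. P (case_nat \<beta> F))"
proof -
  obtain Q where Q: "Sig n Q" "\<And>F. P F \<longleftrightarrow> (\<exists>\<beta>. \<not> Q (case_nat \<beta> F))" using assms by auto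
  let ?G = "\<lambda>(F::asg) i k. case i of 0 \<Rightarrow> F 0 (2 * k) | Suc i \<Rightarrow>
     (case i of 0 \<Rightarrow> F 0 (Suc (2 * k)) | Suc i \<Rightarrow> F (Suc i) k)"
  have G: "term_map ?G"
    by (rule term_mapI[where h = "case_nat (TApp 0 (TMul (num 2) (TVar 0))) (case_nat (TApp 0 (TSuc (TMul (num 2) (TVar 0)))) (\<lambda>i. TApp (Suc i) (TVar 0)))"])
      (simp split: nat.splits)
  have eq: "?G (case_nat \<gamma> F) = case_nat (\<lambda>k. \<gamma> (2 * k)) (case_nat (\<lambda>k. \<gamma> (Suc (2 * k))) F)" for \<gamma> F
    by (auto simp: fun_eq_iff split: nat.splits)
  have "(\<exists>\<beta>. P (case_nat \<beta> F)) \<longleftrightarrow> (\<exists>\<gamma>. \<not> Q (?G (case_nat \<gamma> F)))" for F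
    unfolding eq Q(2) using ex_split2[of "\<lambda>\<gamma> \<beta>. \<not> Q (case_nat \<gamma> (case_nat \<beta> F))"] by blast
  then show ?thesis by (rule Sig_SucI[OF Sig_subst[OF Q(1) G]])
qed

lemma Sig_exN:
  assumes "Sig (Suc n) P"
  shows "Sig (Suc n) (\<lambda>F. \<exists>k. P (case_nat (\<lambda>_. k) F))"
proof -
  let ?G = "\<lambda>(F::asg) i k. case i of 0 \<Rightarrow> F 0 0 | Suc i \<Rightarrow> F (Suc i) k"
  have G: "term_map ?G"
    by (rule term_mapI[where h = "case_nat (TApp 0 TZero) (\<lambda>i. TApp (Suc i) (TVar 0))"])
      (simp split: nat.splits)
  have eq: "?G (case_nat \<beta> F) = case_nat (\<lambda>_. \<beta> 0) F" for \<beta> F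
    by (auto split: nat.splits)
  have "(\<exists>k. P (case_nat (\<lambda>_. k) F)) \<longleftrightarrow> (\<exists>\<beta>. P (?G (case_nat \<beta> F)))" for F
    unfolding eq by metis
  then show ?thesis using Sig_exF[OF Sig_subst[OF assms G]] by simp
qed

text \<open>The pairing must be a term of the language, hence a polynomial without division. It is
  injective because the values with \<open>a + b = s\<close> lie from \<open>s * s\<close> up to,
  but excluding, the next square.\<close>

definition quad_pair :: "nat \<Rightarrow> nat \<Rightarrow> nat" where
  "quad_pair a b = (a + b) * (a + b) + a"

lemma quad_pair_inject [simp]: "quad_pair a b = quad_pair c d \<longleftrightarrow> a = c \<and> b = d"
proof -
  have lt: "quad_pair a b < quad_pair c d" if "a + b < c + d" for a b c d
  proof -
    have "(a + b) * (a + b) + a < (a + b + 1) * (a + b + 1)" by simp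
    also have "\<dots> \<le> (c + d) * (c + d)" by (rule mult_le_mono) (use that in auto)
    finally show ?thesis by (simp add: quad_pair_def)
  qed
  show ?thesis
  proof
    assume eq: "quad_pair a b = quad_pair c d"
    then have "a + b = c + d" by (metis lt linorder_neqE_nat less_irrefl)
    with eq show "a = c \<and> b = d" by (simp add: quad_pair_def)
  qed simp
qed

text \<open>This is countable choice: the sections of one function along an injective pairing can be
  prescribed independently.\<close>

lemma ex_quad_pair: "(\<exists>h. \<forall>a. P a (\<lambda>b. h (quad_pair a b))) \<longleftrightarrow> (\<forall>a. \<exists>g. P a g)"
proof safe
  assume "\<forall>a. \<exists>g. P a g"
  then obtain g where g: "\<And>a. P a (g a)" by metis
  let ?h = "\<lambda>m. case inv (\<lambda>(a, b). quad_pair a b) m of (a, b) \<Rightarrow> g a b"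
  have "inv (\<lambda>(a, b). quad_pair a b) (quad_pair a b) = (a, b)" for a b
    using inv_f_f[of "\<lambda>(a, b). quad_pair a b" "(a, b)"] by (auto simp: inj_on_def)
  then have "(\<lambda>b. ?h (quad_pair a b)) = g a" for a by simp
  with g show "\<exists>h. \<forall>a. P a (\<lambda>b. h (quad_pair a b))" by (intro exI[of _ ?h]) simp
qed blast

text \<open>The number quantifier is exchanged with the function quantifier by
  \<open>ex_quad_pair\<close>, one \<open>\<beta>\<close> coding the witnesses for all
  \<open>k\<close>. It then stands next to the negated existential number quantifier of level
  \<open>0\<close> and joins it.\<close>

lemma Sig_1_allN:
  assumes "Sig (Suc 0) P"
  shows "Sig (Suc 0) (\<lambda>F. \<forall>k. P (case_nat (\<lambda>_. k) F))"
proof -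
  from assms obtain \<phi> where \<phi>: "qf \<phi>" "\<And>F. P F \<longleftrightarrow> (\<exists>\<beta>. \<not> (\<exists>e. sat e (case_nat \<beta> F) \<phi>))"
    by auto
  \<comment> \<open>\<open>?t\<close> spells out \<open>quad_pair\<close>, with the number variable
    that holds \<open>k\<close> as first component and the argument \<open>TVar 0\<close> as
    second.\<close>
  let ?t = "TAdd (TMul (TAdd (TVar 1) (TVar 0)) (TAdd (TVar 1) (TVar 0))) (TVar 1)"
  let ?h = "\<lambda>i. case i of 0 \<Rightarrow> TApp 0 ?t | Suc i \<Rightarrow> (case i of 0 \<Rightarrow> TVar 1 | Suc i \<Rightarrow> TApp (Suc i) (TVar 0))"
  let ?\<psi> = "fsub (\<lambda>i. TVar (Suc i)) ?h \<phi>"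
  have "fun_subst ?h e (case_nat \<beta> F) =
     case_nat (\<lambda>k. \<beta> (quad_pair (e 0) k)) (case_nat (\<lambda>_. e 0) F)" for e \<beta> F
    by (auto simp: fun_subst_def quad_pair_def fun_eq_iff split: nat.splits)
  then have "sat e (case_nat \<beta> F) ?\<psi> \<longleftrightarrow> sat (\<lambda>i. e (Suc i))
     (case_nat (\<lambda>k. \<beta> (quad_pair (e 0) k)) (case_nat (\<lambda>_. e 0) F)) \<phi>" for e \<beta> F
    using \<phi>(1) by (simp add: sat_fsub)
  then have "(\<exists>e. sat e (case_nat \<beta> F) ?\<psi>) \<longleftrightarrow> (\<exists>k e. sat e
     (case_nat (\<lambda>j. \<beta> (quad_pair k j)) (case_nat (\<lambda>_. k) F)) \<phi>)" for \<beta> F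
    by (auto intro: exI[of _ "case_nat _ _"])
  then have "(\<forall>k. P (case_nat (\<lambda>_. k) F)) \<longleftrightarrow> (\<exists>\<beta>. \<not> (\<exists>e. sat e (case_nat \<beta> F) ?\<psi>))" for F
    unfolding \<phi>(2) using ex_quad_pair[of "\<lambda>k \<beta>. \<not> (\<exists>e. sat e (case_nat \<beta> (case_nat (\<lambda>_. k) F)) \<phi>)"]
    by auto
  moreover have "Sig 0 (\<lambda>F. \<exists>e. sat e F ?\<psi>)"
    by (rule Sig_0I[of ?\<psi>]) (simp_all add: \<phi>(1) qf_fsub)
  ultimately show ?thesis by (intro Sig_SucI)
qed


section \<open>Comparison with the given classes of formulas\<close>

definition num_env :: "asg \<Rightarrow> nat \<Rightarrow> nat" where
  "num_env F i = F (2 * i) 0"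

text \<open>Both sorts of variables of a formula live in one assignment, numbers in the even slots
  as values at \<open>0\<close> and functions in the odd slots. Either kind of quantifier is then a
  change of a single slot.\<close>

definition fun_env :: "asg \<Rightarrow> asg" where
  "fun_env F i = F (Suc (2 * i))"

lemma Sig_atom: "Sig 0 (\<lambda>F. tval (\<lambda>_. 0) F t = tval (\<lambda>_. 0) F u)" "Sig 0 (\<lambda>F. tval (\<lambda>_. 0) F t \<noteq> tval (\<lambda>_. 0) F u)"
proof -
  let ?s = "vsub (\<lambda>_. TZero)"
  show "Sig 0 (\<lambda>F. tval (\<lambda>_. 0) F t = tval (\<lambda>_. 0) F u)"
    by (rule Sig_0I[of "Eq (?s t) (?s u)"]) (simp_all add: tval_vsub)
  show "Sig 0 (\<lambda>F. tval (\<lambda>_. 0) F t \<noteq> tval (\<lambda>_. 0) F u)"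
    by (rule Sig_0I[of "Neg (Eq (?s t) (?s u))"]) (simp_all add: tval_vsub)
qed

lemma tval_env: "\<exists>u. \<forall>F. tval (num_env F) (fun_env F) t = tval (\<lambda>_. 0) F u"
proof -
  let ?u = "tsub (\<lambda>i. TApp (2 * i) TZero) (\<lambda>i. TApp (Suc (2 * i)) (TVar 0)) t"
  have "(\<lambda>i. tval (\<lambda>_. 0) F (TApp (2 * i) TZero)) = num_env F"
    "fun_subst (\<lambda>i. TApp (Suc (2 * i)) (TVar 0)) e F = fun_env F" for e F
    by (auto simp: num_env_def fun_subst_def fun_env_def)
  then have "tval (num_env F) (fun_env F) t = tval (\<lambda>_. 0) F ?u" for F
    unfolding tval_tsub by simp
  then show ?thesis by blast
qed

lemma env_case_nat:
  "num_env (\<lambda>j. case_nat \<beta> F (if j = m then 0 else Suc j)) =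
     (if even m then (num_env F)(m div 2 := \<beta> 0) else num_env F)"
  "fun_env (\<lambda>j. case_nat \<beta> F (if j = m then 0 else Suc j)) =
     (if odd m then (fun_env F)(m div 2 := \<beta>) else fun_env F)"
  by (auto simp: num_env_def fun_env_def fun_eq_iff elim!: oddE evenE) presburger+

text \<open>A formula is treated together with its negation so that \<open>Neg\<close> passes
  through the induction; a number quantifier uses \<open>Sig_exN\<close> on one side and
  \<open>Sig_1_allN\<close> on the other.\<close>

lemma Sig_arithmetical:
  "arithmetical \<phi> \<Longrightarrow> Sig (Suc 0) (\<lambda>F. sat (num_env F) (fun_env F) \<phi>) \<and>
     Sig (Suc 0) (\<lambda>F. \<not> sat (num_env F) (fun_env F) \<phi>)"
proof (induction \<phi>)
  case (Eq t u)
  obtain t' u' where "\<And>F. tval (num_env F) (fun_env F) t = tval (\<lambda>_. 0) F t'"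
    "\<And>F. tval (num_env F) (fun_env F) u = tval (\<lambda>_. 0) F u'" using tval_env by blast
  then show ?case using Sig_atom[of t' u', THEN Sig_Suc] by simp
next
  case (Neg \<phi>)
  then show ?case by (auto simp del: Sig.simps)
next
  case (Conj \<phi> \<psi>)
  then show ?case unfolding sat.simps de_Morgan_conj by (intro conjI Sig_conj Sig_disj) simp_all
next
  case (ExN i \<phi>)
  let ?G = "\<lambda>(F::asg) j. F (if j = 2 * i then 0 else Suc j)"
  let ?P = "\<lambda>F. sat (num_env F) (fun_env F) \<phi>"
  have "Sig (Suc 0) (\<lambda>F. ?P (?G F))" "Sig (Suc 0) (\<lambda>F. \<not> ?P (?G F))"
    using ExN by (auto intro: Sig_subst[OF _ term_map_permute] simp del: Sig.simps)
  then have *: "Sig (Suc 0) (\<lambda>F. \<exists>k. ?P (?G (case_nat (\<lambda>_. k) F)))"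
    "Sig (Suc 0) (\<lambda>F. \<forall>k. \<not> ?P (?G (case_nat (\<lambda>_. k) F)))"
    using Sig_exN[of 0 "\<lambda>F. ?P (?G F)"] Sig_1_allN[of "\<lambda>F. \<not> ?P (?G F)"] by (simp_all del: Sig.simps)
  then show ?case by (simp add: env_case_nat del: Sig.simps)
qed simp

text \<open>The bound variable of a formula is moved to slot \<open>0\<close>, where
  \<open>Sig\<close> expects the function that it quantifies.\<close>

lemma Sig_env_update:
  assumes "Sig n (\<lambda>F. P (num_env F) (fun_env F))"
  shows "\<exists>Q. Sig n Q \<and> (\<forall>\<beta> F. Q (case_nat \<beta> F) \<longleftrightarrow> P (num_env F) ((fun_env F)(i := \<beta>)))"
proof -
  let ?G = "\<lambda>(F::asg) j. F (if j = Suc (2 * i) then 0 else Suc j)"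
  have "Sig n (\<lambda>F. P (num_env (?G F)) (fun_env (?G F)))"
    by (rule Sig_subst[OF assms term_map_permute])
  then show ?thesis
    by (intro exI[of _ "\<lambda>F. P (num_env (?G F)) (fun_env (?G F))"]) (simp add: env_case_nat)
qed

lemma Sig_fm:
  "Sigma1_fm (Suc n) \<phi> \<Longrightarrow> Sig (Suc n) (\<lambda>F. sat (num_env F) (fun_env F) \<phi>)"
  "Pi1_fm (Suc n) \<phi> \<Longrightarrow> Sig (Suc n) (\<lambda>F. \<not> sat (num_env F) (fun_env F) \<phi>)"
proof (induction n arbitrary: \<phi>)
  case 0
  {
    case 1
    then obtain i \<psi> where \<phi>: "\<phi> = ExF i \<psi>" "arithmetical \<psi>" by auto
    obtain Q where "Sig (Suc 0) Q" "\<forall>\<beta> F. Q (case_nat \<beta> F) \<longleftrightarrow> sat (num_env F) ((fun_env F)(i := \<beta>)) \<psi>"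
      using Sig_env_update[OF Sig_arithmetical[OF \<phi>(2), THEN conjunct1]] by blast
    with Sig_exF[of 0 Q] show ?case by (simp add: \<phi>(1) del: Sig.simps)
  next
    case 2
    then obtain i \<psi> where \<phi>: "\<phi> = AllF i \<psi>" "arithmetical \<psi>" by auto
    obtain Q where "Sig (Suc 0) Q" "\<forall>\<beta> F. Q (case_nat \<beta> F) \<longleftrightarrow> \<not> sat (num_env F) ((fun_env F)(i := \<beta>)) \<psi>"
      using Sig_env_update[OF Sig_arithmetical[OF \<phi>(2), THEN conjunct2]] by blast
    with Sig_exF[of 0 Q] show ?case by (simp add: \<phi>(1) del: Sig.simps)
  }
next
  case (Suc n)
  {
    case 1
    then obtain i \<psi> where \<phi>: "\<phi> = ExF i \<psi>" "Pi1_fm (Suc n) \<psi>" by auto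
    obtain Q where Q: "Sig (Suc n) Q" "\<forall>\<beta> F. Q (case_nat \<beta> F) \<longleftrightarrow> \<not> sat (num_env F) ((fun_env F)(i := \<beta>)) \<psi>"
      using Sig_env_update[OF Suc(2)[OF \<phi>(2)]] by blast
    then show ?case by (intro Sig_SucI[OF Q(1)]) (simp add: \<phi>(1))
  next
    case 2
    then obtain i \<psi> where \<phi>: "\<phi> = AllF i \<psi>" "Sigma1_fm (Suc n) \<psi>" by auto
    obtain Q where Q: "Sig (Suc n) Q" "\<forall>\<beta> F. Q (case_nat \<beta> F) \<longleftrightarrow> sat (num_env F) ((fun_env F)(i := \<beta>)) \<psi>"
      using Sig_env_update[OF Suc(1)[OF \<phi>(2)]] by blast
    then show ?case by (intro Sig_SucI[OF Q(1)]) (simp add: \<phi>(1))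
  }
qed

text \<open>Variable \<open>0\<close> stays free, being reserved for the argument of the defined
  set.\<close>

primrec ex_closure :: "nat \<Rightarrow> fm \<Rightarrow> fm" where
  "ex_closure 0 \<phi> = \<phi>"
| "ex_closure (Suc N) \<phi> = ExN (Suc N) (ex_closure N \<phi>)"

lemma sat_ex_closure:
  "sat e F (ex_closure N \<phi>) \<longleftrightarrow> (\<exists>d. d 0 = e 0 \<and> (\<forall>i>N. d i = e i) \<and> sat d F \<phi>)"
proof (induction N arbitrary: e)
  case 0
  have "d = e" if "d 0 = e 0" "\<forall>i>0. d i = e i" for d
    using that by (metis ext gr0I)
  then show ?case by auto
next
  case (Suc N)
  have "(\<exists>k d. d 0 = e 0 \<and> (\<forall>i>N. d i = (e(Suc N := k)) i) \<and> sat d F \<phi>) \<longleftrightarrow>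
        (\<exists>d. d 0 = e 0 \<and> (\<forall>i>Suc N. d i = e i) \<and> sat d F \<phi>)" (is "?L \<longleftrightarrow> ?R")
  proof
    assume ?L
    then obtain k d where "d 0 = e 0" "\<And>i. i > N \<Longrightarrow> d i = (e(Suc N := k)) i" "sat d F \<phi>" by blast
    then show ?R by (intro exI[of _ d]) auto
  next
    assume ?R
    then obtain d where "d 0 = e 0" "\<And>i. i > Suc N \<Longrightarrow> d i = e i" "sat d F \<phi>" by blast
    then show ?L by (intro exI[of _ "d (Suc N)"] exI[of _ d]) (auto simp: Suc_lessI)
  qed
  with Suc show ?case by simp
qed

lemma arithmetical_ex_closure [simp]: "arithmetical (ex_closure N \<phi>) \<longleftrightarrow> arithmetical \<phi>"
  by (induction N) auto

primrec tm_bound :: "tm \<Rightarrow> nat" where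
  "tm_bound (TVar i) = Suc i"
| "tm_bound TZero = 0"
| "tm_bound (TSuc t) = tm_bound t"
| "tm_bound (TAdd t u) = max (tm_bound t) (tm_bound u)"
| "tm_bound (TMul t u) = max (tm_bound t) (tm_bound u)"
| "tm_bound (TApp i t) = tm_bound t"

lemma tval_bound: "(\<And>i. i < tm_bound t \<Longrightarrow> e i = d i) \<Longrightarrow> tval e F t = tval d F t"
  by (induction t) (auto simp: less_max_iff_disj)

primrec fm_bound :: "fm \<Rightarrow> nat" where
  "fm_bound (Eq t u) = max (tm_bound t) (tm_bound u)"
| "fm_bound (Neg \<phi>) = fm_bound \<phi>"
| "fm_bound (Conj \<phi> \<psi>) = max (fm_bound \<phi>) (fm_bound \<psi>)"
| "fm_bound (ExN i \<phi>) = 0"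
| "fm_bound (ExF i \<phi>) = 0"

lemma sat_bound:
  "qf \<phi> \<Longrightarrow> (\<And>i. i < fm_bound \<phi> \<Longrightarrow> e i = d i) \<Longrightarrow> sat e F \<phi> \<longleftrightarrow> sat d F \<phi>"
proof (induction \<phi>)
  case (Eq t u)
  then have "tval e F t = tval d F t" "tval e F u = tval d F u"
    by (auto intro!: tval_bound)
  then show ?case by simp
qed auto

text \<open>The conditions on \<open>h\<close> say that the substituted functions depend only on
  number variable \<open>0\<close> and on function variables from \<open>n\<close> on. The smaller
  indices are thus free for binding: the quantifier of level \<open>Suc n\<close> binds function
  variable \<open>n\<close>, and the number variables other than \<open>0\<close> can be quantified
  in the matrix.\<close>

lemma fm_of_Sig:
  assumes "Sig n P"
    and "\<And>e d F. e 0 = d 0 \<Longrightarrow> fun_subst h e F = fun_subst h d F"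
    and "\<And>e F G. (\<And>i. i \<ge> n \<Longrightarrow> F i = G i) \<Longrightarrow> fun_subst h e F = fun_subst h e G"
  shows "(\<exists>\<phi>. Sigma1_fm n \<phi> \<and> (\<forall>e F. sat e F \<phi> \<longleftrightarrow> P (fun_subst h e F))) \<and>
         (\<exists>\<phi>. Pi1_fm n \<phi> \<and> (\<forall>e F. sat e F \<phi> \<longleftrightarrow> \<not> P (fun_subst h e F)))"
  using assms
proof (induction n arbitrary: P h)
  case 0
  from 0(1) obtain \<phi> where \<phi>: "qf \<phi>" "\<And>F. P F \<longleftrightarrow> (\<exists>e. sat e F \<phi>)" by auto
  \<comment> \<open>The number variables of \<open>\<phi>\<close> move up by one to keep variable
    \<open>0\<close> for the argument.\<close>
  let ?\<psi> = "fsub (\<lambda>i. TVar (Suc i)) h \<phi>"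
  let ?N = "fm_bound \<phi>"
  let ?\<chi> = "ex_closure ?N ?\<psi>"
  have "sat e F ?\<chi> \<longleftrightarrow> P (fun_subst h e F)" for e F
  proof -
    have eq: "fun_subst h d F = fun_subst h e F" if "d 0 = e 0" for d
      using that by (rule 0(2))
    have "sat e F ?\<chi> \<longleftrightarrow> (\<exists>d. d 0 = e 0 \<and> (\<forall>i>?N. d i = e i) \<and> sat (\<lambda>i. d (Suc i)) (fun_subst h e F) \<phi>)"
      unfolding sat_ex_closure sat_fsub[OF \<phi>(1)] tval.simps
      by (rule iff_exI, rule conj_cong, rule refl, drule eq, simp only:)
    also have "\<dots> \<longleftrightarrow> (\<exists>d. sat d (fun_subst h e F) \<phi>)" (is "?L \<longleftrightarrow> ?R")
    proof
      assume ?R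
      then obtain d where d: "sat d (fun_subst h e F) \<phi>" by blast
      \<comment> \<open>\<open>d\<close> is shifted into the closed variables; beyond them
        \<open>e\<close> is copied, and by \<open>sat_bound\<close> the formula
        \<open>\<phi>\<close> does not look there.\<close>
      let ?d = "\<lambda>i. if i = 0 \<or> i > ?N then e i else d (i - 1)"
      have "sat (\<lambda>i. ?d (Suc i)) (fun_subst h e F) \<phi>"
        using d by (subst sat_bound[OF \<phi>(1), of _ d]) auto
      then show ?L by (intro exI[of _ ?d]) auto
    qed blast
    finally show ?thesis by (simp add: \<phi>(2))
  qed
  moreover have "arithmetical ?\<chi>" by (simp add: \<phi>(1) qf_fsub qf_arithmetical)
  ultimately show ?case
    by (intro conjI exI[of _ ?\<chi>] exI[of _ "Neg ?\<chi>"]) auto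
next
  case (Suc n)
  from Suc.prems(1) obtain Q where Q: "Sig n Q" "\<And>F. P F \<longleftrightarrow> (\<exists>\<beta>. \<not> Q (case_nat \<beta> F))" by auto
  let ?h = "case_nat (TApp n (TVar 0)) h"
  have h: "fun_subst ?h e F = case_nat (F n) (fun_subst h e F)" for e F
    by (auto simp: fun_subst_def fun_eq_iff split: nat.splits)
  have "fun_subst h e (F(n := \<beta>)) = fun_subst h e F" for e F \<beta>
    by (rule Suc.prems(3)) simp
  then have hu: "fun_subst ?h e (F(n := \<beta>)) = case_nat \<beta> (fun_subst h e F)" for e F \<beta>
    by (simp add: h)
  have "fun_subst ?h e F = fun_subst ?h d F" if "e 0 = d 0" for e d F
    unfolding h using Suc.prems(2)[of e d F] that by simp
  moreover have "fun_subst ?h e F = fun_subst ?h e G" if "\<And>i. i \<ge> n \<Longrightarrow> F i = G i" for e F G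
    unfolding h using Suc.prems(3)[of F G e] that by simp
  ultimately obtain \<phi> \<psi> where
    \<phi>: "Sigma1_fm n \<phi>" "\<And>e F. sat e F \<phi> \<longleftrightarrow> Q (fun_subst ?h e F)" and
    \<psi>: "Pi1_fm n \<psi>" "\<And>e F. sat e F \<psi> \<longleftrightarrow> \<not> Q (fun_subst ?h e F)"
    using Suc.IH[OF Q(1), of ?h] by blast
  have "sat e F (ExF n \<psi>) \<longleftrightarrow> P (fun_subst h e F)" for e F
    by (simp add: \<psi>(2) Q(2) hu)
  moreover have "sat e F (AllF n \<phi>) \<longleftrightarrow> \<not> P (fun_subst h e F)" for e F
    by (simp add: \<phi>(2) Q(2) hu)
  ultimately show ?case
    using \<phi>(1) \<psi>(1) by (intro conjI exI[of _ "ExF n \<psi>"] exI[of _ "AllF n \<phi>"]) auto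
qed

text \<open>Every function variable is replaced by the constant function whose value is number
  variable \<open>0\<close>. The classes are compared from level \<open>1\<close> on, because level
  \<open>0\<close> consists of arithmetical formulas on one side and of existential ones on the
  other.\<close>

lemma Sigma1_iff_Sig: "A \<in> Sigma1 (Suc n) \<longleftrightarrow> Sig (Suc n) (\<lambda>F. F 0 0 \<in> A)"
  and Pi1_iff_Sig: "A \<in> Pi1 (Suc n) \<longleftrightarrow> Sig (Suc n) (\<lambda>F. F 0 0 \<notin> A)"
proof -
  let ?h = "\<lambda>i::nat. TVar (Suc 0)"
  have h: "fun_subst ?h e F i k = e 0" for e F i k by (simp add: fun_subst_def)
  then have hh: "fun_subst ?h e F = fun_subst ?h d G" if "e 0 = d 0" for e d F G
    using that by (simp add: fun_eq_iff)
  show "A \<in> Sigma1 (Suc n) \<longleftrightarrow> Sig (Suc n) (\<lambda>F. F 0 0 \<in> A)"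
  proof
    assume "A \<in> Sigma1 (Suc n)"
    then obtain \<phi> where "Sigma1_fm (Suc n) \<phi>" "\<And>e F. sat e F \<phi> \<longleftrightarrow> e 0 \<in> A"
      unfolding Sigma1_def by blast
    with Sig_fm(1)[of n \<phi>] show "Sig (Suc n) (\<lambda>F. F 0 0 \<in> A)"
      by (simp add: num_env_def del: Sig.simps Sigma1_fm.simps)
  next
    assume "Sig (Suc n) (\<lambda>F. F 0 0 \<in> A)"
    from fm_of_Sig[OF this, of ?h, OF hh hh] show "A \<in> Sigma1 (Suc n)"
      unfolding Sigma1_def by (simp add: h del: Sigma1_fm.simps Pi1_fm.simps)
  qed
  show "A \<in> Pi1 (Suc n) \<longleftrightarrow> Sig (Suc n) (\<lambda>F. F 0 0 \<notin> A)"
  proof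
    assume "A \<in> Pi1 (Suc n)"
    then obtain \<phi> where "Pi1_fm (Suc n) \<phi>" "\<And>e F. sat e F \<phi> \<longleftrightarrow> e 0 \<in> A"
      unfolding Pi1_def by blast
    with Sig_fm(2)[of n \<phi>] show "Sig (Suc n) (\<lambda>F. F 0 0 \<notin> A)"
      by (simp add: num_env_def del: Sig.simps Pi1_fm.simps)
  next
    assume "Sig (Suc n) (\<lambda>F. F 0 0 \<notin> A)"
    from fm_of_Sig[OF this, of ?h, OF hh hh] show "A \<in> Pi1 (Suc n)"
      unfolding Pi1_def by (simp add: h del: Sigma1_fm.simps Pi1_fm.simps)
  qed
qed

declare Sig.simps [simp del]

section \<open>Definability over coded types\<close>

text \<open>A point of a coded type is presented as an assignment. Elements of an \<open>ncoded\<close> type are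
  numbers in disguise: their codes are all constant assignments, so quantifiers over them are
  number quantifiers.\<close>

class coded =
  fixes code :: "'a \<Rightarrow> nat \<Rightarrow> nat \<Rightarrow> nat"

class ncoded = coded +
  fixes enc :: "'a \<Rightarrow> nat"
  assumes bij_enc: "bij enc" and code_ncoded: "code x = (\<lambda>_ _. enc x)"

lemma enc_eq_iff [simp]: "enc (x :: 'a :: ncoded) = enc y \<longleftrightarrow> x = y"
  using bij_enc by (metis bij_is_inj inj_eq)

lemma enc_inv [simp]: "enc (inv enc k :: 'a :: ncoded) = k"
  using bij_enc by (meson bij_inv_eq_iff)

lemma ex_enc: "(\<exists>k. P k) \<longleftrightarrow> (\<exists>x :: 'a :: ncoded. P (enc x))"
  by (metis enc_inv)

lemma all_enc: "(\<forall>k. P k) \<longleftrightarrow> (\<forall>x :: 'a :: ncoded. P (enc x))"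
  by (metis enc_inv)

instantiation nat :: ncoded
begin
definition code_nat :: "nat \<Rightarrow> nat \<Rightarrow> nat \<Rightarrow> nat" where "code_nat x = (\<lambda>_ _. x)"
definition enc_nat :: "nat \<Rightarrow> nat" where "enc_nat x = x"
instance by standard (auto simp: code_nat_def enc_nat_def bij_def inj_def surj_def)
end

lemma enc_nat_eq [simp]: "enc (k :: nat) = k"
  by (simp add: enc_nat_def)

instantiation list :: (ncoded) ncoded
begin
definition enc_list :: "'a list \<Rightarrow> nat" where "enc_list l = list_encode (map enc l)"
definition code_list :: "'a list \<Rightarrow> nat \<Rightarrow> nat \<Rightarrow> nat" where "code_list x = (\<lambda>_ _. enc x)"
instance
proof
  have "bij (list_encode \<circ> (map enc :: 'a list \<Rightarrow> nat list))"
  proof (rule bij_comp)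
    show "bij (map enc :: 'a list \<Rightarrow> nat list)"
    proof (rule bijI)
      show "inj (map enc :: 'a list \<Rightarrow> nat list)" using bij_enc bij_is_inj inj_mapI by blast
      show "surj (map enc :: 'a list \<Rightarrow> nat list)"
        by (rule surjI[of _ "map (inv enc)"]) (simp add: comp_def)
    qed
  qed (rule bij_list_encode)
  then show "bij (enc :: 'a list \<Rightarrow> nat)" by (simp add: enc_list_def[abs_def] comp_def)
qed (simp add: code_list_def)
end

instantiation "fun" :: (ncoded, ncoded) coded
begin
definition code_fun :: "('a \<Rightarrow> 'b) \<Rightarrow> nat \<Rightarrow> nat \<Rightarrow> nat" where "code_fun f = (\<lambda>_ k. enc (f (inv enc k)))"
instance ..
end

lemma code_real: "code (\<beta> :: nat \<Rightarrow> nat) = (\<lambda>_. \<beta>)"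
proof -
  have "inv enc k = k" for k :: nat using enc_inv[of k, where ?'a = nat] by simp
  then show ?thesis by (simp add: code_fun_def)
qed

instantiation prod :: (coded, coded) coded
begin
definition code_prod :: "'a \<times> 'b \<Rightarrow> nat \<Rightarrow> nat \<Rightarrow> nat" where
  "code_prod z = split2 (code (fst z)) (code (snd z))"
instance ..
end

text \<open>\<open>asg\<close> is no instance of \<open>coded\<close>, its values being functions
  rather than numbers. The wrapper makes arbitrary assignments available as points, in particular as
  the space on which norms are constructed.\<close>

datatype point = Pt (unPt: asg)

instantiation point :: coded
begin
definition code_point :: "point \<Rightarrow> nat \<Rightarrow> nat \<Rightarrow> nat" where "code_point z = unPt z"
instance ..
end

definition SigP :: "nat \<Rightarrow> ('a :: coded \<Rightarrow> bool) \<Rightarrow> bool" where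
  "SigP n P \<longleftrightarrow> (\<exists>Q. Sig n Q \<and> (\<forall>x. P x \<longleftrightarrow> Q (code x)))"

lemma LsI: "Sig n Q \<Longrightarrow> (\<And>x. P x \<longleftrightarrow> Q (code x)) \<Longrightarrow> SigP n P"
  unfolding SigP_def by blast

lemma LsE:
  assumes "SigP n P" obtains Q where "Sig n Q" "\<And>x. P x \<longleftrightarrow> Q (code x)"
  using assms unfolding SigP_def by blast

lemma Sig_permute: "Sig n P \<Longrightarrow> Sig n (\<lambda>F. P (\<lambda>i. F (\<rho> i)))"
  by (rule Sig_subst[OF _ term_map_permute])

lemma SigP_conj: "SigP n P \<Longrightarrow> SigP n Q \<Longrightarrow> SigP n (\<lambda>x. P x \<and> Q x)"
  by (elim LsE, rule LsI, erule (1) Sig_conj) simp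

lemma SigP_disj: "SigP n P \<Longrightarrow> SigP n Q \<Longrightarrow> SigP n (\<lambda>x. P x \<or> Q x)"
  by (elim LsE, rule LsI, erule (1) Sig_disj) simp

lemma SigP_not: "SigP n P \<Longrightarrow> SigP (Suc n) (\<lambda>x. \<not> P x)"
  by (elim LsE, rule LsI, erule Sig_dual_Suc) simp

lemma SigP_mono: "SigP m P \<Longrightarrow> m \<le> n \<Longrightarrow> SigP n P"
  by (elim LsE, rule LsI, erule (1) Sig_mono) simp

lemma SigP_exF:
  fixes P :: "'a :: coded \<Rightarrow> baire \<Rightarrow> bool"
  assumes "SigP (Suc n) (\<lambda>z. P (fst z) (snd z))"
  shows "SigP (Suc n) (\<lambda>x. \<exists>\<beta>. P x \<beta>)"
proof -
  obtain Q where Q: "Sig (Suc n) Q" "\<And>z. P (fst z) (snd z) \<longleftrightarrow> Q (code z)" using assms unfolding SigP_def by blast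
  \<comment> \<open>Assignments carry a quantified function in slot \<open>0\<close>, whereas the
    code of a pair keeps its second component in the odd slots; \<open>?G\<close> turns the first
    layout into the second.\<close>
  let ?G = "\<lambda>(F::asg) i. F (if even i then Suc (i div 2) else 0)"
  have *: "?G (case_nat \<beta> (code x)) = code (x, \<beta>)" for \<beta> and x :: 'a
    by (auto simp: code_prod_def code_real split2_def fun_eq_iff)
  show ?thesis
    by (rule LsI[OF Sig_exF[OF Sig_permute[OF Q(1), of "\<lambda>i. if even i then Suc (i div 2) else 0"]]])
      (simp only: * Q(2)[symmetric] fst_conv snd_conv)
qed

lemma SigP_exN:
  fixes P :: "'a :: coded \<Rightarrow> 'b :: ncoded \<Rightarrow> bool"
  assumes "SigP (Suc n) (\<lambda>z. P (fst z) (snd z))"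
  shows "SigP (Suc n) (\<lambda>x. \<exists>k. P x k)"
proof -
  obtain Q where Q: "Sig (Suc n) Q" "\<And>z. P (fst z) (snd z) \<longleftrightarrow> Q (code z)" using assms unfolding SigP_def by blast
  let ?G = "\<lambda>(F::asg) i. F (if even i then Suc (i div 2) else 0)"
  have *: "?G (case_nat (\<lambda>_. enc k) (code x)) = code (x, k)" for k :: 'b and x :: 'a
    by (auto simp: code_prod_def code_ncoded split2_def fun_eq_iff)
  show ?thesis
    by (rule LsI[OF Sig_exN[OF Sig_permute[OF Q(1), of "\<lambda>i. if even i then Suc (i div 2) else 0"]]],
        subst ex_enc[where ?'a = 'b])
      (simp only: * Q(2)[symmetric] fst_conv snd_conv)
qed

lemma SigP_1_allN:
  fixes P :: "'a :: coded \<Rightarrow> 'b :: ncoded \<Rightarrow> bool"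
  assumes "SigP (Suc 0) (\<lambda>z. P (fst z) (snd z))"
  shows "SigP (Suc 0) (\<lambda>x. \<forall>k. P x k)"
proof -
  obtain Q where Q: "Sig (Suc 0) Q" "\<And>z. P (fst z) (snd z) \<longleftrightarrow> Q (code z)" using assms unfolding SigP_def by blast
  let ?G = "\<lambda>(F::asg) i. F (if even i then Suc (i div 2) else 0)"
  have *: "?G (case_nat (\<lambda>_. enc k) (code x)) = code (x, k)" for k :: 'b and x :: 'a
    by (auto simp: code_prod_def code_ncoded split2_def fun_eq_iff)
  show ?thesis
    by (rule LsI[OF Sig_1_allN[OF Sig_permute[OF Q(1), of "\<lambda>i. if even i then Suc (i div 2) else 0"]]],
        subst all_enc[where ?'a = 'b])
      (simp only: * Q(2)[symmetric] fst_conv snd_conv)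
qed

text \<open>\<open>D11f f\<close>: substituting \<open>f\<close> preserves every class \<open>SigP (Suc n)\<close>, also in the presence of a
  side argument. Functions with \<open>\<Delta>\<^sup>1\<^sub>1\<close> graph have this property.\<close>

definition D11f :: "('a :: coded \<Rightarrow> 'b :: coded) \<Rightarrow> bool" where
  "D11f f \<longleftrightarrow> (\<forall>n Q. Sig (Suc n) Q \<longrightarrow> (\<exists>Q'. Sig (Suc n) Q' \<and>
     (\<forall>x G. Q (split2 (code (f x)) G) \<longleftrightarrow> Q' (split2 (code x) G))))"

lemma dfE:
  assumes "D11f f" "Sig (Suc n) Q"
  obtains Q' where "Sig (Suc n) Q'" "\<And>x G. Q (split2 (code (f x)) G) \<longleftrightarrow> Q' (split2 (code x) G)"
  using assms unfolding D11f_def by meson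

lemma SigP_subst:
  assumes "SigP (Suc n) P" "D11f f"
  shows "SigP (Suc n) (\<lambda>x. P (f x))"
proof -
  obtain Q where Q: "Sig (Suc n) Q" "\<And>y. P y \<longleftrightarrow> Q (code y)" using assms(1) unfolding SigP_def by blast
  have "Sig (Suc n) (\<lambda>F. Q (\<lambda>i. F (2 * i)))" by (rule Sig_permute[OF Q(1)])
  from dfE[OF assms(2) this] obtain Q' where Q': "Sig (Suc n) Q'"
    "\<And>x G. Q (\<lambda>i. split2 (code (f x)) G (2 * i)) \<longleftrightarrow> Q' (split2 (code x) G)" by blast
  have "Q (code (f x)) \<longleftrightarrow> Q' (\<lambda>i. code x (i div 2))" for x
  proof -
    have "split2 (code x) (code x) = (\<lambda>i. code x (i div 2))" by (auto simp: split2_def fun_eq_iff)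
    with Q'(2)[of x "code x"] show ?thesis by simp
  qed
  then show ?thesis by (intro LsI[OF Sig_permute[OF Q'(1), of "\<lambda>i. i div 2"]]) (simp add: Q(2))
qed

lemma D11f_comp:
  assumes "D11f f" "D11f g"
  shows "D11f (\<lambda>x. f (g x))"
  unfolding D11f_def
proof (intro allI impI)
  fix n Q assume "Sig (Suc n) Q"
  from dfE[OF assms(1) this] obtain Q' where Q': "Sig (Suc n) Q'"
    "\<And>x G. Q (split2 (code (f x)) G) \<longleftrightarrow> Q' (split2 (code x) G)" by blast
  from dfE[OF assms(2) Q'(1)] obtain Q'' where "Sig (Suc n) Q''"
    "\<And>x G. Q' (split2 (code (g x)) G) \<longleftrightarrow> Q'' (split2 (code x) G)" by blast
  with Q'(2) show "\<exists>Q'. Sig (Suc n) Q' \<and>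
      (\<forall>x G. Q (split2 (code (f (g x))) G) \<longleftrightarrow> Q' (split2 (code x) G))" by blast
qed

lemma D11f_permute:
  assumes "\<And>x i. code (f x) i = code x (\<rho> i)"
  shows "D11f f"
  unfolding D11f_def
proof (intro allI impI)
  fix n Q assume Q: "Sig (Suc n) Q"
  let ?r = "\<lambda>i. if even i then 2 * \<rho> (i div 2) else i"
  have "split2 (code (f x)) G = (\<lambda>i. split2 (code x) G (?r i))" for x G
    by (auto simp: split2_def fun_eq_iff assms)
  then have *: "\<forall>x G. Q (split2 (code (f x)) G) \<longleftrightarrow> Q (\<lambda>i. split2 (code x) G (?r i))" by simp
  show "\<exists>Q'. Sig (Suc n) Q' \<and> (\<forall>x G. Q (split2 (code (f x)) G) \<longleftrightarrow> Q' (split2 (code x) G))"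
    by (rule exI[of _ "\<lambda>F. Q (\<lambda>i. F (?r i))"], rule conjI[OF Sig_permute[OF Q] *])
qed

lemma D11f_id: "D11f (\<lambda>x. x)"
  by (rule D11f_permute[of _ "\<lambda>i. i"]) simp

lemma D11f_fst: "D11f f \<Longrightarrow> D11f (\<lambda>x. fst (f x))"
  by (rule D11f_comp[of fst], rule D11f_permute[of _ "\<lambda>i. 2 * i"]) (simp_all add: code_prod_def)

lemma D11f_snd: "D11f f \<Longrightarrow> D11f (\<lambda>x. snd (f x))"
  by (rule D11f_comp[of snd], rule D11f_permute[of _ "\<lambda>i. Suc (2 * i)"]) (simp_all add: code_prod_def)

text \<open>The substitutions are carried out one after the other with everything else in the side
  argument: first \<open>f\<close> with the code of \<open>g x\<close> aside, then \<open>g\<close>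
  with the code of \<open>x\<close> aside. The maps \<open>?r1\<close> and \<open>?r2\<close>
  rebracket and swap the nested codes, and \<open>?r5\<close> duplicates the code of
  \<open>x\<close>.\<close>

lemma D11f_pair:
  assumes "D11f f" "D11f g"
  shows "D11f (\<lambda>x. (f x, g x))"
  unfolding D11f_def
proof (intro allI impI)
  fix n Q assume Q: "Sig (Suc n) Q"
  let ?r1 = "\<lambda>i. if even i then (if even (i div 2) then 2 * (i div 2 div 2) else Suc (2 * (2 * (i div 2 div 2))))
     else Suc (Suc (Suc (2 * (2 * (i div 2)))))"
  let ?Q1 = "\<lambda>F. Q (\<lambda>i. F (?r1 i))"
  have 1: "(\<lambda>i. split2 A (split2 B C) (?r1 i)) = split2 (split2 A B) C" for A B C :: asg
    by (auto simp: split2_def fun_eq_iff elim!: evenE oddE)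
  have "Sig (Suc n) ?Q1" by (rule Sig_permute[OF Q])
  from dfE[OF assms(1) this] obtain Q2 where Q2: "Sig (Suc n) Q2"
    "\<And>x G. ?Q1 (split2 (code (f x)) G) \<longleftrightarrow> Q2 (split2 (code x) G)" by blast
  let ?r2 = "\<lambda>i. if even i then Suc (2 * i) else (if even (i div 2) then 2 * (i div 2 div 2)
     else Suc (Suc (Suc (2 * (2 * (i div 2 div 2))))))"
  have 2: "(\<lambda>i. split2 B (split2 A C) (?r2 i)) = split2 A (split2 B C)" for A B C :: asg
    by (auto simp: split2_def fun_eq_iff elim!: evenE oddE)
  have "Sig (Suc n) (\<lambda>F. Q2 (\<lambda>i. F (?r2 i)))" by (rule Sig_permute[OF Q2(1)])
  from dfE[OF assms(2) this] obtain Q4 where Q4: "Sig (Suc n) Q4"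
    "\<And>x G. Q2 (\<lambda>i. split2 (code (g x)) G (?r2 i)) \<longleftrightarrow> Q4 (split2 (code x) G)" by blast
  let ?r5 = "\<lambda>i. if even i then i else i div 2"
  have 3: "(\<lambda>i. split2 A C (?r5 i)) = split2 A (split2 A C)" for A C :: asg
    by (auto simp: split2_def fun_eq_iff elim!: evenE oddE)
  have "Q (split2 (code (f x, g x)) G) \<longleftrightarrow> Q4 (\<lambda>i. split2 (code x) G (?r5 i))" for x G
  proof -
    have "Q (split2 (code (f x, g x)) G) \<longleftrightarrow> ?Q1 (split2 (code (f x)) (split2 (code (g x)) G))"
      unfolding 1 by (simp add: code_prod_def)
    also have "\<dots> \<longleftrightarrow> Q2 (split2 (code x) (split2 (code (g x)) G))" by (rule Q2(2))
    also have "\<dots> \<longleftrightarrow> Q4 (split2 (code x) (split2 (code x) G))"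
      unfolding Q4(2)[symmetric] 2 ..
    finally show ?thesis unfolding 3 .
  qed
  then show "\<exists>Q'. Sig (Suc n) Q' \<and> (\<forall>x G. Q (split2 (code (f x, g x)) G) \<longleftrightarrow> Q' (split2 (code x) G))"
    by (intro exI[of _ "\<lambda>F. Q4 (\<lambda>i. F (?r5 i))"] conjI allI Sig_permute[OF Q4(1)])
qed


section \<open>\<Delta>^1_1 predicates and functions\<close>

definition D11 :: "('a :: coded \<Rightarrow> bool) \<Rightarrow> bool" where
  "D11 P \<longleftrightarrow> SigP (Suc 0) P \<and> SigP (Suc 0) (\<lambda>x. \<not> P x)"

lemma D11_subst: "D11 P \<Longrightarrow> D11f f \<Longrightarrow> D11 (\<lambda>x. P (f x))"
  unfolding D11_def using SigP_subst[of 0 P f] SigP_subst[of 0 "\<lambda>x. \<not> P x" f] by blast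

lemma D11_not: "D11 P \<Longrightarrow> D11 (\<lambda>x. \<not> P x)"
  unfolding D11_def by simp

lemma D11_conj: "D11 P \<Longrightarrow> D11 Q \<Longrightarrow> D11 (\<lambda>x. P x \<and> Q x)"
  unfolding D11_def de_Morgan_conj by (elim conjE) (intro conjI SigP_conj SigP_disj)

lemma D11_disj: "D11 P \<Longrightarrow> D11 Q \<Longrightarrow> D11 (\<lambda>x. P x \<or> Q x)"
  unfolding D11_def de_Morgan_disj by (elim conjE) (intro conjI SigP_conj SigP_disj)

lemma D11_imp: "D11 P \<Longrightarrow> D11 Q \<Longrightarrow> D11 (\<lambda>x. P x \<longrightarrow> Q x)"
  unfolding imp_conv_disj by (intro D11_disj D11_not)

lemma D11_iff: "D11 P \<Longrightarrow> D11 Q \<Longrightarrow> D11 (\<lambda>x. P x \<longleftrightarrow> Q x)"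
  unfolding iff_conv_conj_imp by (intro D11_conj D11_imp)

lemma D11_ex:
  fixes P :: "'a :: coded \<Rightarrow> 'b :: ncoded \<Rightarrow> bool"
  shows "D11 (\<lambda>z. P (fst z) (snd z)) \<Longrightarrow> D11 (\<lambda>x. \<exists>k. P x k)"
  unfolding D11_def not_ex
  using SigP_exN[of 0 P] SigP_1_allN[of "\<lambda>x k. \<not> P x k"] by simp

lemma D11_all:
  fixes P :: "'a :: coded \<Rightarrow> 'b :: ncoded \<Rightarrow> bool"
  shows "D11 (\<lambda>z. P (fst z) (snd z)) \<Longrightarrow> D11 (\<lambda>x. \<forall>k. P x k)"
  unfolding D11_def not_all
  using SigP_exN[of 0 "\<lambda>x k. \<not> P x k"] SigP_1_allN[of P] by simp

lemma D11_atom: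
  assumes "\<And>x. P x \<longleftrightarrow> tval (\<lambda>_. 0) (code x) t = tval (\<lambda>_. 0) (code x) u"
  shows "D11 P"
  unfolding D11_def using assms Sig_atom[of t u, THEN Sig_Suc] by (auto intro: LsI)

lemma D11_cong: "D11 P \<Longrightarrow> (\<And>x. P x \<longleftrightarrow> Q x) \<Longrightarrow> D11 Q"
  unfolding D11_def SigP_def by simp

lemma D11_Ls: "D11 P \<Longrightarrow> SigP (Suc n) P" "D11 P \<Longrightarrow> SigP (Suc n) (\<lambda>x. \<not> P x)"
  unfolding D11_def by (auto elim: SigP_mono)

lemma D11_eq_basic: "D11 (\<lambda>z :: 'b :: ncoded \<times> 'b. fst z = snd z)"
  by (rule D11_atom[of _ "TApp 0 TZero" "TApp 1 TZero"])
    (simp add: code_prod_def code_ncoded split2_def)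

lemma D11_eq:
  fixes f g :: "'a :: coded \<Rightarrow> 'b :: ncoded"
  assumes "D11f f" "D11f g"
  shows "D11 (\<lambda>x. f x = g x)"
  using D11_subst[OF D11_eq_basic D11f_pair[OF assms]] by simp

text \<open>\<open>Q\<close> at \<open>f x\<close> is rewritten as the existence of \<open>k\<close>
  with \<open>f x = k\<close> and \<open>Q\<close> at \<open>k\<close>. Elements of an
  \<open>ncoded\<close> type are numbers, so this is a number quantifier, which every level from
  \<open>1\<close> on absorbs.\<close>

lemma D11f_graph:
  fixes f :: "'a :: coded \<Rightarrow> 'b :: ncoded"
  assumes "D11 (\<lambda>z. f (fst z) = snd z)"
  shows "D11f f"
  unfolding D11f_def
proof (intro allI impI)
  fix n Q assume Q: "Sig (Suc n) Q"
  have "SigP (Suc n) (\<lambda>z. f (fst z) = snd z)" using assms by (rule D11_Ls)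
  then obtain R where R: "Sig (Suc n) R" "\<And>x k. f x = k \<longleftrightarrow> R (code (x, k))"
    unfolding SigP_def by auto
  let ?r = "\<lambda>i. if even i then Suc (2 * (i div 2)) else 0"
  let ?q = "\<lambda>i. if even i then 0 else Suc (Suc (2 * (i div 2)))"
  let ?A = "\<lambda>F. R (\<lambda>i. F (?r i)) \<and> Q (\<lambda>i. F (?q i))"
  have A: "Sig (Suc n) ?A" by (rule Sig_conj[OF Sig_permute[OF R(1)] Sig_permute[OF Q]])
  have "Q (split2 (code (f x)) G) \<longleftrightarrow> (\<exists>k. ?A (case_nat (\<lambda>_. k) (split2 (code x) G)))" for x G
  proof -
    have 1: "(\<lambda>i. case_nat (\<lambda>_. enc k) (split2 (code x) G) (?r i)) = code (x, k)" for k :: 'b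
      by (auto simp: code_prod_def code_ncoded split2_def fun_eq_iff)
    have 2: "(\<lambda>i. case_nat (\<lambda>_. enc k) (split2 (code x) G) (?q i)) = split2 (code k) G" for k :: 'b
      by (auto simp: code_ncoded split2_def fun_eq_iff)
    show ?thesis unfolding ex_enc[where ?'a = 'b] 1 2 R(2)[symmetric] by auto
  qed
  with Sig_exN[OF A] show "\<exists>Q'. Sig (Suc n) Q' \<and>
      (\<forall>x G. Q (split2 (code (f x)) G) \<longleftrightarrow> Q' (split2 (code x) G))"
    by (intro exI[of _ "\<lambda>F. \<exists>k. ?A (case_nat (\<lambda>_. k) F)"]) simp
qed

lemma D11f_enc:
  fixes f :: "'a :: coded \<Rightarrow> 'b :: ncoded"
  assumes "D11f f" shows "D11f (\<lambda>x. enc (f x))"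
  by (rule D11f_comp[OF _ assms], rule D11f_permute[of _ "\<lambda>i. i"]) (simp add: code_ncoded)

lemma D11f_of_enc:
  fixes f :: "'a :: coded \<Rightarrow> 'b :: ncoded"
  assumes "D11f (\<lambda>x. enc (f x))" shows "D11f f"
  using assms unfolding D11f_def by (simp add: code_ncoded)

lemma D11f_const: "D11f (\<lambda>x :: 'a :: coded. c :: 'b :: ncoded)"
proof (rule D11f_graph)
  show "D11 (\<lambda>z :: 'a \<times> 'b. c = snd z)"
    by (rule D11_atom[of _ "num (enc c)" "TApp 1 TZero"]) (simp add: code_prod_def code_ncoded split2_def)
qed

lemma D11f_app:
  fixes r :: "'a :: coded \<Rightarrow> nat \<Rightarrow> nat"
  assumes "D11f r" "D11f f"
  shows "D11f (\<lambda>x. r x (f x))"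
proof -
  have "D11f (\<lambda>z :: baire \<times> nat. fst z (snd z))"
  proof (rule D11f_graph)
    show "D11 (\<lambda>z :: (baire \<times> nat) \<times> nat. fst (fst z) (snd (fst z)) = snd z)"
      by (rule D11_atom[of _ "TApp 0 (TApp 2 TZero)" "TApp 1 TZero"])
        (simp add: code_prod_def code_ncoded code_real split2_def)
  qed
  from D11f_comp[OF this D11f_pair[OF assms]] show ?thesis by simp
qed

lemma D11f_app_fst:
  fixes g :: "'a :: coded \<Rightarrow> baire \<times> 'b :: coded"
  shows "D11f g \<Longrightarrow> D11f f \<Longrightarrow> D11f (\<lambda>x. fst (g x) (f x))"
  by (rule D11f_app[OF D11f_fst])

lemma D11f_app_snd:
  fixes g :: "'a :: coded \<Rightarrow> 'b :: coded \<times> baire"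
  shows "D11f g \<Longrightarrow> D11f f \<Longrightarrow> D11f (\<lambda>x. snd (g x) (f x))"
  by (rule D11f_app[OF D11f_snd])

lemma D11f_plus:
  fixes f g :: "'a :: coded \<Rightarrow> nat"
  assumes "D11f f" "D11f g"
  shows "D11f (\<lambda>x. f x + g x)"
proof -
  have "D11f (\<lambda>z :: nat \<times> nat. fst z + snd z)"
  proof (rule D11f_graph)
    show "D11 (\<lambda>z :: (nat \<times> nat) \<times> nat. fst (fst z) + snd (fst z) = snd z)"
      by (rule D11_atom[of _ "TAdd (TApp 0 TZero) (TApp 2 TZero)" "TApp 1 TZero"])
        (simp add: code_prod_def code_ncoded code_real split2_def)
  qed
  from D11f_comp[OF this D11f_pair[OF assms]] show ?thesis by simp
qed

lemma D11f_times:
  fixes f g :: "'a :: coded \<Rightarrow> nat"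
  assumes "D11f f" "D11f g"
  shows "D11f (\<lambda>x. f x * g x)"
proof -
  have "D11f (\<lambda>z :: nat \<times> nat. fst z * snd z)"
  proof (rule D11f_graph)
    show "D11 (\<lambda>z :: (nat \<times> nat) \<times> nat. fst (fst z) * snd (fst z) = snd z)"
      by (rule D11_atom[of _ "TMul (TApp 0 TZero) (TApp 2 TZero)" "TApp 1 TZero"])
        (simp add: code_prod_def code_ncoded code_real split2_def)
  qed
  from D11f_comp[OF this D11f_pair[OF assms]] show ?thesis by simp
qed

lemma D11f_Suc: "D11f f \<Longrightarrow> D11f (\<lambda>x. Suc (f x))"
  using D11f_plus[of f "\<lambda>_. 1", OF _ D11f_const] by simp

lemma D11_less:
  fixes f g :: "'a :: coded \<Rightarrow> nat"
  assumes "D11f f" "D11f g"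
  shows "D11 (\<lambda>x. f x < g x)"
proof -
  have "D11 (\<lambda>x. \<exists>k. g x = Suc (f x + k))"
    by (intro D11_ex D11_eq D11f_Suc D11f_plus D11f_snd D11f_id D11f_comp[OF assms(1)] D11f_comp[OF assms(2)] D11f_fst)
  then show ?thesis by (rule D11_cong) (simp add: less_iff_Suc_add)
qed

lemma D11_le:
  fixes f g :: "'a :: coded \<Rightarrow> nat"
  assumes "D11f f" "D11f g"
  shows "D11 (\<lambda>x. f x \<le> g x)"
  unfolding not_less[symmetric] by (intro D11_not D11_less assms)

lemma D11_const: "D11 (\<lambda>x :: 'a :: coded. c)"
proof (cases c)
  case True
  have "D11 (\<lambda>x :: 'a. (0 :: nat) = 0)" by (intro D11_eq D11f_const)
  with True show ?thesis by simp
next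
  case False
  have "D11 (\<lambda>x :: 'a. (0 :: nat) = 1)" by (intro D11_eq D11f_const)
  with False show ?thesis by simp
qed

lemma D11f_if:
  fixes f g :: "'a :: coded \<Rightarrow> 'b :: ncoded"
  assumes "D11 P" "D11f f" "D11f g"
  shows "D11f (\<lambda>x. if P x then f x else g x)"
proof (rule D11f_graph)
  have "D11 (\<lambda>z. P (fst z) \<and> f (fst z) = snd z \<or> \<not> P (fst z) \<and> g (fst z) = snd z)"
    by (intro D11_disj D11_conj D11_not D11_eq D11f_snd D11f_id D11f_comp[OF assms(2)] D11f_comp[OF assms(3)]
        D11_subst[OF assms(1)] D11f_fst)
  then show "D11 (\<lambda>z. (if P (fst z) then f (fst z) else g (fst z)) = snd z)" by (rule D11_cong) auto
qed

lemma D11f_Least: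
  fixes P :: "'a :: coded \<Rightarrow> nat \<Rightarrow> bool"
  assumes "D11 (\<lambda>z. P (fst z) (snd z))"
  shows "D11f (\<lambda>x. LEAST k. P x k)"
proof (rule D11f_graph)
  have P: "D11 (\<lambda>x. P (f x) (g x))" if "D11f f" "D11f g" for f and g :: "'b :: coded \<Rightarrow> nat"
    using D11_subst[OF assms D11f_pair[OF that]] by simp
  \<comment> \<open>Without a witness \<open>LEAST\<close> returns one fixed number, here written
    \<open>LEAST k. False\<close>; the second disjunct accounts for it.\<close>
  have "D11 (\<lambda>z. P (fst z) (snd z) \<and> (\<forall>j. j < snd z \<longrightarrow> \<not> P (fst z) j) \<or>
     (\<forall>k. \<not> P (fst z) k) \<and> snd z = (LEAST k. False))"
    by (intro D11_disj D11_conj P D11_all D11_imp D11_not D11_eq D11_less D11f_const D11f_fst D11f_snd D11f_id)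
  then show "D11 (\<lambda>z. (LEAST k. P (fst z) k) = snd z)"
  proof (rule D11_cong)
    fix z :: "'a \<times> nat"
    let ?P = "P (fst z)"
    show "?P (snd z) \<and> (\<forall>j. j < snd z \<longrightarrow> \<not> ?P j) \<or> (\<forall>k. \<not> ?P k) \<and> snd z = (LEAST k. False) \<longleftrightarrow>
       (LEAST k. ?P k) = snd z"
    proof (cases "\<exists>k. ?P k")
      case True
      then have "?P (LEAST k. ?P k)" by (metis LeastI)
      with True show ?thesis by (metis Least_equality not_less not_less_Least)
    next
      case False
      then have "?P = (\<lambda>_. False)" by blast
      then show ?thesis by auto
    qed
  qed
qed

text \<open>Now the value is named by an existential function quantifier, which \<Sigma>^1 classes
  absorb, and pointwise comparison makes equality with the value \<Delta>^1_1. The side argument of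
  \<open>D11f\<close> travels as a \<open>point\<close>.\<close>

lemma D11f_lam:
  fixes f :: "'a :: coded \<Rightarrow> nat \<Rightarrow> nat"
  assumes "D11f (\<lambda>z. f (fst z) (snd z))"
  shows "D11f (\<lambda>x. f x)"
proof -
  have f: "D11f (\<lambda>x. f (g x) (h x))" if "D11f g" "D11f h" for g and h :: "'b :: coded \<Rightarrow> nat"
    using D11f_comp[OF assms D11f_pair[OF that]] by simp
  show ?thesis unfolding D11f_def
  proof (intro allI impI)
    fix n Q assume Q: "Sig (Suc n) Q"
    have Q': "SigP (Suc n) (\<lambda>z :: baire \<times> point. Q (code z))" by (rule LsI[OF Q]) simp
    have "SigP (Suc n) (\<lambda>z :: 'a \<times> point. \<exists>\<beta>. (\<forall>k. f (fst z) k = \<beta> k) \<and> Q (code (\<beta>, snd z)))"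
      by (intro SigP_exF SigP_conj SigP_subst[OF Q'] D11_Ls D11_all D11_eq f D11f_app_fst D11f_app_snd D11f_fst D11f_snd D11f_pair D11f_id)
    then obtain Q' where "Sig (Suc n) Q'" and Q': "\<And>x G. (\<exists>\<beta>. (\<forall>k. f x k = \<beta> k) \<and> Q (code (\<beta>, G))) \<longleftrightarrow> Q' (code (x, G :: point))"
      unfolding SigP_def by auto
    moreover have "Q (split2 (code (f x)) G) \<longleftrightarrow> Q' (split2 (code x) G)" for x G
    proof -
      have "(\<forall>k. f x k = \<beta> k) \<longleftrightarrow> \<beta> = f x" for \<beta> by auto
      then show ?thesis using Q'[of x "Pt G"] by (simp add: code_prod_def code_point_def)
    qed
    ultimately show "\<exists>Q'. Sig (Suc n) Q' \<and> (\<forall>x G. Q (split2 (code (f x)) G) \<longleftrightarrow> Q' (split2 (code x) G))"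
      by blast
  qed
qed

text \<open>\<open>P\<close> and its negation both receive an existential form, because an auxiliary
  \<open>\<beta>\<close> always exists and all of them give the same answer. Typically
  \<open>\<beta>\<close> tabulates a recursion or the stages of an inductive definition.\<close>

lemma D11_via:
  fixes R T :: "'a :: coded \<Rightarrow> baire \<Rightarrow> bool"
  assumes "D11 (\<lambda>z. R (fst z) (snd z))" "D11 (\<lambda>z. T (fst z) (snd z))"
    and ex: "\<And>x. \<exists>\<beta>. R x \<beta>" and eq: "\<And>x \<beta>. R x \<beta> \<Longrightarrow> T x \<beta> \<longleftrightarrow> P x"
  shows "D11 P"
proof -
  have "SigP (Suc 0) (\<lambda>x. \<exists>\<beta>. R x \<beta> \<and> T x \<beta>)" "SigP (Suc 0) (\<lambda>x. \<exists>\<beta>. R x \<beta> \<and> \<not> T x \<beta>)"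
    by (intro SigP_exF SigP_conj D11_Ls assms)+
  moreover have "(\<exists>\<beta>. R x \<beta> \<and> T x \<beta>) \<longleftrightarrow> P x" "(\<exists>\<beta>. R x \<beta> \<and> \<not> T x \<beta>) \<longleftrightarrow> \<not> P x" for x
    using ex[of x] eq[of x] by blast+
  ultimately show ?thesis unfolding D11_def by simp
qed

text \<open>The auxiliary function is the table of the encoded values, which the recursion equations
  determine.\<close>

lemma D11f_rec_nat:
  fixes a :: "'a :: coded \<Rightarrow> 'b :: ncoded" and g :: "'a \<Rightarrow> nat \<Rightarrow> 'b \<Rightarrow> 'b"
  assumes a: "D11f a" and g: "D11f (\<lambda>z. g (fst z) (fst (snd z)) (snd (snd z)))" and h: "D11f h"
  shows "D11f (\<lambda>x. rec_nat (a x) (g x) (h x))"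
proof (rule D11f_graph)
  have g': "D11f (\<lambda>x. g (p x) (q x) (r x))" if "D11f p" "D11f q" "D11f r" for p q and r :: "'c :: coded \<Rightarrow> 'b"
    using D11f_comp[OF g D11f_pair[OF that(1) D11f_pair[OF that(2,3)]]] by simp
  let ?R = "\<lambda>(z :: 'a \<times> 'b) \<beta>. \<beta> (0::nat) = enc (a (fst z)) \<and>
    (\<forall>k w. enc w = \<beta> k \<longrightarrow> \<beta> (Suc k) = enc (g (fst z) k w))"
  let ?T = "\<lambda>(z :: 'a \<times> 'b) \<beta>. \<beta> (h (fst z)) = enc (snd z)"
  show "D11 (\<lambda>z. rec_nat (a (fst z)) (g (fst z)) (h (fst z)) = snd z)"
  proof (rule D11_via)
    show "D11 (\<lambda>z. ?R (fst z) (snd z))"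
      by (intro D11_conj D11_all D11_imp D11_eq D11f_enc D11f_app_fst D11f_app_snd g' D11f_comp[OF a] D11f_Suc D11f_fst D11f_snd D11f_id D11f_const)
    show "D11 (\<lambda>z. ?T (fst z) (snd z))"
      by (intro D11_eq D11f_enc D11f_app_fst D11f_app_snd D11f_comp[OF h] D11f_fst D11f_snd D11f_id)
    show "\<exists>\<beta>. ?R z \<beta>" for z
      by (rule exI[of _ "\<lambda>k. enc (rec_nat (a (fst z)) (g (fst z)) k)"]) auto
    fix z \<beta> assume R: "?R z \<beta>"
    have "\<beta> k = enc (rec_nat (a (fst z)) (g (fst z)) k)" for k
      using R by (induction k) auto
    then show "?T z \<beta> \<longleftrightarrow> rec_nat (a (fst z)) (g (fst z)) (h (fst z)) = snd z" by simp
  qed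
qed

lemma D11f_prod_encode:
  fixes f g :: "'a :: coded \<Rightarrow> nat"
  assumes "D11f f" "D11f g"
  shows "D11f (\<lambda>x. prod_encode (f x, g x))"
proof (rule D11f_graph)
  \<comment> \<open>Twice the Cantor pairing is a polynomial, which avoids the division in
    \<open>triangle\<close>.\<close>
  have "D11 (\<lambda>z. (f (fst z) + g (fst z)) * Suc (f (fst z) + g (fst z)) + 2 * f (fst z) = 2 * snd z)"
    by (intro D11_eq D11f_plus D11f_times D11f_Suc D11f_const D11f_comp[OF assms(1)] D11f_comp[OF assms(2)] D11f_fst D11f_snd D11f_id)
  then show "D11 (\<lambda>z. prod_encode (f (fst z), g (fst z)) = snd z)"
  proof (rule D11_cong)
    fix z :: "'a \<times> nat"
    have "2 * triangle m = m * Suc m" for m by (simp add: triangle_def)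
    from this[of "f (fst z) + g (fst z)"]
    show "(f (fst z) + g (fst z)) * Suc (f (fst z) + g (fst z)) + 2 * f (fst z) = 2 * snd z \<longleftrightarrow>
        prod_encode (f (fst z), g (fst z)) = snd z"
      unfolding prod_encode_def by simp linarith
  qed
qed

lemma enc_Cons: "enc (x # l) = Suc (prod_encode (enc x, enc l))"
  by (simp add: enc_list_def)

lemma D11f_Cons:
  fixes f :: "'a :: coded \<Rightarrow> 'b :: ncoded"
  assumes "D11f f" "D11f g"
  shows "D11f (\<lambda>x. f x # g x)"
  by (rule D11f_of_enc, unfold enc_Cons, intro D11f_Suc D11f_prod_encode D11f_enc assms)

text \<open>The newest value comes first: extending a history is then \<open>Cons\<close>, for which
  definability is available.\<close>

primrec hist :: "(nat \<Rightarrow> 'a) \<Rightarrow> nat \<Rightarrow> 'a list" where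
  "hist z 0 = []"
| "hist z (Suc k) = z k # hist z k"

lemma D11f_hist:
  assumes "D11f \<alpha>" "D11f k"
  shows "D11f (\<lambda>x. hist (\<alpha> x :: nat \<Rightarrow> nat) (k x))"
proof -
  have *: "hist z k = rec_nat [] (\<lambda>k v. z k # v) k" for z :: "nat \<Rightarrow> nat" and k
    by (induction k) auto
  show ?thesis unfolding *
    by (intro D11f_rec_nat D11f_const D11f_Cons D11f_app[OF D11f_comp[OF assms(1)]] assms(2) D11f_fst D11f_snd D11f_id)
qed

lemmas D11f_intros = D11f_app_fst D11f_app_snd D11f_id D11f_fst D11f_snd D11f_pair D11f_const D11f_Suc D11f_plus D11f_times D11f_enc D11f_Cons D11f_prod_encode
lemmas D11_intros = D11_conj D11_disj D11_not D11_imp D11_ex D11_all D11_less D11_le D11_eq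

section \<open>Games and prewellorderings\<close>

lemma open_nat_relation:
  fixes f g :: "'a :: topological_space \<Rightarrow> nat"
  assumes "\<And>v. open {x. f x = v}" "\<And>v. open {x. g x = v}"
  shows "open {x. R (f x) (g x)}"
proof -
  have "{x. R (f x) (g x)} = (\<Union>(v, w) \<in> {(v, w). R v w}. {x. f x = v} \<inter> {x. g x = w})" by auto
  moreover have "open (\<Union>(v, w) \<in> {(v, w). R v w}. {x. f x = v} \<inter> {x. g x = w})"
    using assms by (intro open_UN) auto
  ultimately show ?thesis by simp
qed

lemma continuous_evaluation: "continuous_on UNIV (\<lambda>F :: asg. F i w)"
  by (rule continuous_on_product_then_coordinatewise[of UNIV "\<lambda>F :: asg. F i"])
     (rule continuous_on_product_coordinates)

lemma open_tval: "open {F. tval e F t = v}"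
proof (induction t arbitrary: v)
  case (TVar i) then show ?case by (cases "e i = v") auto
next
  case TZero then show ?case by (cases "v = 0") auto
next
  case (TSuc t)
  from open_nat_relation[OF this this, of "\<lambda>a _. Suc a = v"] show ?case by simp
next
  case (TAdd t u)
  from open_nat_relation[OF this, of "\<lambda>a b. a + b = v"] show ?case by simp
next
  case (TMul t u)
  from open_nat_relation[OF this, of "\<lambda>a b. a * b = v"] show ?case by simp
next
  case (TApp i t)
  have "open ((\<lambda>F :: asg. F i w) -` {v})" for w v
    using continuous_on_open_vimage[OF open_UNIV, of "\<lambda>F :: asg. F i w"] continuous_evaluation
    by (auto simp: open_discrete)
  then have "open (\<Union>w. {F. tval e F t = w} \<inter> ((\<lambda>F :: asg. F i w) -` {v}))"
    using TApp by (intro open_UN ballI open_Int) auto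
  moreover have "{F. tval e F (TApp i t) = v} = (\<Union>w. {F. tval e F t = w} \<inter> ((\<lambda>F :: asg. F i w) -` {v}))"
    by auto
  ultimately show ?case by simp
qed

lemma open_sat: "qf \<phi> \<Longrightarrow> open {F. sat e F \<phi>} \<and> open {F. \<not> sat e F \<phi>}"
proof (induction \<phi>)
  case (Eq t u)
  from open_nat_relation[OF open_tval open_tval, of "(=)" e t e u]
    open_nat_relation[OF open_tval open_tval, of "(\<noteq>)" e t e u] show ?case by simp
next
  case (Conj \<phi> \<psi>)
  have "{F. sat e F (Conj \<phi> \<psi>)} = {F. sat e F \<phi>} \<inter> {F. sat e F \<psi>}"
    "{F. \<not> sat e F (Conj \<phi> \<psi>)} = {F. \<not> sat e F \<phi>} \<union> {F. \<not> sat e F \<psi>}" by auto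
  with Conj show ?case by auto
qed auto

text \<open>Preimages under continuous maps admit arbitrary parameters, and they let the induction
  step read the quantified function off the odd half of an interleaved point. The complement between
  two levels of \<open>boldface_Sigma1\<close> matches the negation in \<open>Sig\<close>.\<close>

lemma boldface_Sig:
  assumes "Sig n P" "continuous_on UNIV h"
  shows "h -` Collect P \<in> boldface_Sigma1 n"
  using assms
proof (induction n arbitrary: P h)
  case 0
  then obtain \<phi> where \<phi>: "qf \<phi>" "\<And>F. P F \<longleftrightarrow> (\<exists>e. sat e F \<phi>)" by (auto simp: Sig.simps)
  have "Collect P = (\<Union>e. {F. sat e F \<phi>})" by (auto simp: \<phi>(2))
  moreover have "open (h -` (\<Union>e. {F. sat e F \<phi>}))"
  proof (rule open_vimage[OF _ 0(2)])
    show "open (\<Union>e. {F. sat e F \<phi>})" using open_sat[OF \<phi>(1)] by (intro open_UN) auto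
  qed
  ultimately show ?case by simp
next
  case (Suc n)
  then obtain Q where Q: "Sig n Q" "\<And>F. P F \<longleftrightarrow> (\<exists>\<beta>. \<not> Q (case_nat \<beta> F))" by (auto simp: Sig.simps)
  let ?h = "\<lambda>\<delta> :: nat \<Rightarrow> nat. case_nat (\<lambda>k. \<delta> (Suc (2 * k))) (h (\<lambda>k. \<delta> (2 * k)))"
  have "continuous_on UNIV (\<lambda>\<delta> :: nat \<Rightarrow> nat. \<lambda>k. \<delta> (2 * k))"
    by (intro continuous_on_coordinatewise_then_product continuous_on_product_coordinates)
  then have "continuous_on UNIV (\<lambda>\<delta> :: nat \<Rightarrow> nat. h (\<lambda>k. \<delta> (2 * k)))"
    using continuous_on_compose2[OF Suc.prems(2)] by auto
  then have "continuous_on UNIV ?h"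
  proof (intro continuous_on_coordinatewise_then_product[of UNIV ?h])
    fix i
    assume *: "continuous_on UNIV (\<lambda>\<delta> :: nat \<Rightarrow> nat. h (\<lambda>k. \<delta> (2 * k)))"
    show "continuous_on UNIV (\<lambda>\<delta>. ?h \<delta> i)"
    proof (cases i)
      case 0
      have "continuous_on UNIV (\<lambda>\<delta> :: nat \<Rightarrow> nat. \<lambda>k. \<delta> (Suc (2 * k)))"
        by (intro continuous_on_coordinatewise_then_product continuous_on_product_coordinates)
      with 0 show ?thesis by simp
    next
      case (Suc j)
      then show ?thesis using continuous_on_product_then_coordinatewise[OF *, of j] by simp
    qed
  qed
  from Suc.IH[OF Q(1) this] have "?h -` Collect Q \<in> boldface_Sigma1 n" .
  moreover have "- {\<delta>. \<not> Q (?h \<delta>)} = ?h -` Collect Q" by auto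
  moreover have "h -` Collect P = {\<alpha>. \<exists>\<beta>. interleave \<alpha> \<beta> \<in> {\<delta>. \<not> Q (?h \<delta>)}}"
    by (auto simp: Q(2) interleave_eq_split2)
  ultimately show ?case unfolding boldface_Sigma1.simps mem_Collect_eq
    by (intro exI[of _ "{\<delta>. \<not> Q (?h \<delta>)}"] conjI) (simp_all only: mem_Collect_eq)
qed

lemma boldface_SigP:
  assumes "SigP n P" "continuous_on UNIV (\<lambda>x. code (h x))"
  shows "{x. P (h x)} \<in> boldface_Sigma1 n"
proof -
  obtain Q where Q: "Sig n Q" "\<And>y. P y \<longleftrightarrow> Q (code y)" using assms(1) unfolding SigP_def by blast
  have "{x. P (h x)} = (\<lambda>x. code (h x)) -` Collect Q" by (auto simp: Q(2))
  then show ?thesis using boldface_Sig[OF Q(1) assms(2)] by simp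
qed

text \<open>Strategies are coded as reals acting on the codes of the two players' histories.\<close>

definition play_I :: "baire \<Rightarrow> baire \<Rightarrow> baire \<Rightarrow> bool" where
  "play_I \<sigma> \<alpha> \<beta> \<longleftrightarrow> (\<forall>k. \<alpha> k = \<sigma> (prod_encode (enc (hist \<alpha> k), enc (hist \<beta> k))))"

definition play_II :: "baire \<Rightarrow> baire \<Rightarrow> baire \<Rightarrow> bool" where
  "play_II \<tau> \<alpha> \<beta> \<longleftrightarrow> (\<forall>k. \<beta> k = \<tau> (prod_encode (enc (hist \<alpha> (Suc k)), enc (hist \<beta> k))))"

lemma rev_hist: "rev (hist z k) = map z [0..<k]"
  by (induction k) auto

lemma length_hist [simp]: "length (hist z k) = k"
  by (induction k) auto

lemma hist_map: "hist (\<lambda>k. f (z k)) k = map f (hist z k)"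
  by (induction k) auto

lemma ex_hist_recursion: "\<exists>z. \<forall>k. z k = step (hist z k)"
proof -
  define L where "L = rec_nat [] (\<lambda>_ l. step l # l)"
  have "hist (\<lambda>k. step (L k)) k = L k" for k by (induction k) (auto simp: L_def)
  then show ?thesis by (intro exI[of _ "\<lambda>k. step (L k)"]) simp
qed

definition I_wins :: "baire \<Rightarrow> (baire \<Rightarrow> baire \<Rightarrow> bool) \<Rightarrow> bool" where
  "I_wins \<sigma> D \<longleftrightarrow> (\<forall>\<alpha> \<beta>. play_I \<sigma> \<alpha> \<beta> \<longrightarrow> \<not> D \<alpha> \<beta>)"

definition II_wins :: "baire \<Rightarrow> (baire \<Rightarrow> baire \<Rightarrow> bool) \<Rightarrow> bool" where
  "II_wins \<tau> D \<longleftrightarrow> (\<forall>\<alpha> \<beta>. play_II \<tau> \<alpha> \<beta> \<longrightarrow> D \<alpha> \<beta>)"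

definition merge_hist :: "nat list \<Rightarrow> nat list \<Rightarrow> nat list" where
  "merge_hist a b = map (\<lambda>i. if even i then rev a ! (i div 2) else rev b ! (i div 2)) [0..<length a + length b]"

text \<open>The two histories have equal length when I is to move, and that of I is longer by one
  when II is to move; the bounds describe exactly these positions.\<close>

lemma merge_hist:
  assumes "q \<le> p" "p \<le> Suc q"
  shows "merge_hist (hist \<alpha> p) (hist \<beta> q) = map (interleave \<alpha> \<beta>) [0..<p + q]"
  unfolding merge_hist_def length_hist rev_hist
proof (rule map_cong[OF refl])
  fix i assume "i \<in> set [0..<p + q]"
  then have "even i \<Longrightarrow> i div 2 < p" "odd i \<Longrightarrow> i div 2 < q"
    using assms by (auto elim!: evenE oddE)
  then show "(if even i then map \<alpha> [0..<p] ! (i div 2) else map \<beta> [0..<q] ! (i div 2)) = interleave \<alpha> \<beta> i"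
    by (auto simp: interleave_def)
qed

lemma inv_enc [simp]: "inv enc (enc (x :: 'a :: ncoded)) = x"
  by (metis enc_eq_iff enc_inv)

lemma strategy_real:
  fixes \<sigma> :: "nat list \<Rightarrow> nat list \<Rightarrow> nat"
  obtains s where "\<And>a b. s (prod_encode (enc a, enc b)) = \<sigma> a b"
proof
  show "(\<lambda>m. \<sigma> (inv enc (fst (prod_decode m))) (inv enc (snd (prod_decode m)))) (prod_encode (enc a, enc b)) = \<sigma> a b" for a b
    by simp
qed

lemma determined_wins:
  assumes "determined {x. \<not> D (\<lambda>k. x (2 * k)) (\<lambda>k. x (Suc (2 * k)))}"
  shows "(\<exists>\<sigma>. I_wins \<sigma> D) \<or> (\<exists>\<tau>. II_wins \<tau> D)"
  using assms unfolding determined_def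
proof (elim disjE exE)
  fix \<sigma> assume \<sigma>: "wins_I \<sigma> {x. \<not> D (\<lambda>k. x (2 * k)) (\<lambda>k. x (Suc (2 * k)))}"
  obtain s where s: "\<And>a b. s (prod_encode (enc a, enc b)) = \<sigma> (merge_hist a b)"
    using strategy_real[of "\<lambda>a b. \<sigma> (merge_hist a b)"] by blast
  have "I_wins s D" unfolding I_wins_def
  proof (intro allI impI)
    fix \<alpha> \<beta> assume p: "play_I s \<alpha> \<beta>"
    have "interleave \<alpha> \<beta> k = \<sigma> (map (interleave \<alpha> \<beta>) [0..<k])" if "even k" for k
    proof -
      have "interleave \<alpha> \<beta> k = \<alpha> (k div 2)" using that by (simp add: interleave_def)
      also have "\<dots> = \<sigma> (merge_hist (hist \<alpha> (k div 2)) (hist \<beta> (k div 2)))"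
        using p unfolding play_I_def s by blast
      also have "\<dots> = \<sigma> (map (interleave \<alpha> \<beta>) [0..<k div 2 + k div 2])"
        by (subst merge_hist) auto
      also have "k div 2 + k div 2 = k" using that by auto
      finally show ?thesis .
    qed
    with \<sigma> have "\<not> D (\<lambda>k. interleave \<alpha> \<beta> (2 * k)) (\<lambda>k. interleave \<alpha> \<beta> (Suc (2 * k)))"
      unfolding wins_I_def by blast
    then show "\<not> D \<alpha> \<beta>" by (simp add: interleave_eq_split2)
  qed
  then show ?thesis by blast
next
  fix \<tau> assume \<tau>: "wins_II \<tau> {x. \<not> D (\<lambda>k. x (2 * k)) (\<lambda>k. x (Suc (2 * k)))}"
  obtain s where s: "\<And>a b. s (prod_encode (enc a, enc b)) = \<tau> (merge_hist a b)"
    using strategy_real[of "\<lambda>a b. \<tau> (merge_hist a b)"] by blast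
  have "II_wins s D" unfolding II_wins_def
  proof (intro allI impI)
    fix \<alpha> \<beta> assume p: "play_II s \<alpha> \<beta>"
    have "interleave \<alpha> \<beta> k = \<tau> (map (interleave \<alpha> \<beta>) [0..<k])" if "odd k" for k
    proof -
      have "interleave \<alpha> \<beta> k = \<beta> (k div 2)" using that by (simp add: interleave_def)
      also have "\<dots> = \<tau> (merge_hist (hist \<alpha> (Suc (k div 2))) (hist \<beta> (k div 2)))"
        using p unfolding play_II_def s by blast
      also have "\<dots> = \<tau> (map (interleave \<alpha> \<beta>) [0..<Suc (k div 2) + k div 2])"
        by (subst merge_hist) auto
      also have "Suc (k div 2) + k div 2 = k" using that by presburger
      finally show ?thesis .
    qed
    with \<tau> have "D (\<lambda>k. interleave \<alpha> \<beta> (2 * k)) (\<lambda>k. interleave \<alpha> \<beta> (Suc (2 * k)))"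
      unfolding wins_II_def by blast
    then show "D \<alpha> \<beta>" by (simp add: interleave_eq_split2)
  qed
  then show ?thesis by blast
qed

section \<open>Simultaneous plays of several strategies\<close>

lemma ex_play_I: "\<exists>\<alpha>. play_I \<sigma> \<alpha> \<beta>"
proof -
  obtain \<alpha> where "\<And>k. \<alpha> k = \<sigma> (prod_encode (enc (hist \<alpha> k), enc (hist \<beta> (length (hist \<alpha> k)))))"
    using ex_hist_recursion[of "\<lambda>h. \<sigma> (prod_encode (enc h, enc (hist \<beta> (length h))))"] by blast
  then show ?thesis unfolding play_I_def by auto
qed

lemma ex_play_II: "\<exists>\<beta>. play_II \<tau> \<alpha> \<beta>"
proof -
  obtain \<beta> where "\<And>k. \<beta> k = \<tau> (prod_encode (enc (hist \<alpha> (Suc (length (hist \<beta> k)))), enc (hist \<beta> k)))"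
    using ex_hist_recursion[of "\<lambda>h. \<tau> (prod_encode (enc (hist \<alpha> (Suc (length h))), enc h))"] by blast
  then show ?thesis unfolding play_II_def by auto
qed

lemma ex_play_both: "\<exists>\<alpha> \<beta>. play_I \<sigma> \<alpha> \<beta> \<and> play_II \<tau> \<alpha> \<beta>"
proof -
  define a where "a h = \<sigma> (prod_encode (enc (map fst h), enc (map snd h)))" for h :: "(nat \<times> nat) list"
  define b where "b h = \<tau> (prod_encode (enc (a h # map fst h), enc (map snd h)))" for h
  obtain z where z: "\<And>k. z k = (a (hist z k), b (hist z k))"
    using ex_hist_recursion[of "\<lambda>h. (a h, b h)"] by blast
  have 1: "hist (\<lambda>k. fst (z k)) k = map fst (hist z k)" "hist (\<lambda>k. snd (z k)) k = map snd (hist z k)" for k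
    by (rule hist_map)+
  have "fst (z k) = a (hist z k)" "snd (z k) = b (hist z k)" for k
    using z[of k] by (metis fst_conv, metis snd_conv)
  then have "play_I \<sigma> (\<lambda>k. fst (z k)) (\<lambda>k. snd (z k))" "play_II \<tau> (\<lambda>k. fst (z k)) (\<lambda>k. snd (z k))"
    unfolding play_I_def play_II_def hist.simps 1 by (simp_all add: a_def b_def)
  then show ?thesis by blast
qed

text \<open>Three boards serve the transitivity argument. In round \<open>k\<close> the strategy
  \<open>\<sigma>\<close> moves on \<open>\<alpha>\<close> knowing only earlier digits, then
  \<open>\<tau>\<close> answers on \<open>\<beta>\<close>, and \<open>\<rho>\<close> answers this on
  \<open>\<gamma>\<close>, so the digits are determined in this order.\<close>

lemma ex_play_triangle:
  "\<exists>\<alpha> \<beta> \<gamma>. play_I \<sigma> \<alpha> \<gamma> \<and> play_II \<tau> \<alpha> \<beta> \<and> play_II \<rho> \<beta> \<gamma>"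
proof -
  let ?p = "fst" and ?q = "\<lambda>v. fst (snd v)" and ?r = "\<lambda>v. snd (snd v)"
  define a where "a h = \<sigma> (prod_encode (enc (map ?p h), enc (map ?r h)))" for h :: "(nat \<times> nat \<times> nat) list"
  define b where "b h = \<tau> (prod_encode (enc (a h # map ?p h), enc (map ?q h)))" for h
  define c where "c h = \<rho> (prod_encode (enc (b h # map ?q h), enc (map ?r h)))" for h
  obtain z where z: "\<And>k. z k = (a (hist z k), b (hist z k), c (hist z k))"
    using ex_hist_recursion[of "\<lambda>h. (a h, b h, c h)"] by blast
  have 1: "hist (\<lambda>k. ?p (z k)) k = map ?p (hist z k)" "hist (\<lambda>k. ?q (z k)) k = map ?q (hist z k)"
    "hist (\<lambda>k. ?r (z k)) k = map ?r (hist z k)" for k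
    by (rule hist_map)+
  have "?p (z k) = a (hist z k)" "?q (z k) = b (hist z k)" "?r (z k) = c (hist z k)" for k
    using z[of k] by (metis fst_conv, metis fst_conv snd_conv, metis snd_conv)
  then have "play_I \<sigma> (\<lambda>k. ?p (z k)) (\<lambda>k. ?r (z k))" "play_II \<tau> (\<lambda>k. ?p (z k)) (\<lambda>k. ?q (z k))"
    "play_II \<rho> (\<lambda>k. ?q (z k)) (\<lambda>k. ?r (z k))"
    unfolding play_I_def play_II_def hist.simps 1 by (simp_all add: a_def b_def c_def)
  then show ?thesis by blast
qed

text \<open>Player I moves first on every board, so digit \<open>k\<close> of all \<open>z i\<close>
  depends on earlier digits only. The moves of I on board \<open>Suc i\<close> serve as the moves of
  II on board \<open>i\<close>.\<close>

lemma ex_play_chain: "\<exists>z. \<forall>i. play_I (\<sigma> i) (z i) (z (Suc i))"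
proof -
  define step where "step h i = \<sigma> i (prod_encode (enc (map (\<lambda>v. v i) h), enc (map (\<lambda>v. v (Suc i)) h)))"
    for h :: "baire list" and i
  obtain w where w: "\<And>k. w k = step (hist w k)"
    using ex_hist_recursion[of step] by blast
  have 1: "hist (\<lambda>k. w k i) k = map (\<lambda>v. v i) (hist w k)" for i k by (rule hist_map)
  have "w k i = step (hist w k) i" for k i using w[of k] by (rule fun_cong)
  then have "play_I (\<sigma> i) (\<lambda>k. w k i) (\<lambda>k. w k (Suc i))" for i
    unfolding play_I_def 1 by (simp add: step_def)
  then show ?thesis by (intro exI[of _ "\<lambda>i k. w k i"]) simp
qed

text \<open>\<open>W\<close> is constrained only on \<open>P\<close>. Given totality, failure of
  \<open>W x y\<close> means that \<open>y\<close> is strictly below \<open>x\<close>, so the last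
  clause is well-foundedness, phrased without ranks.\<close>

definition prewellorder :: "('a \<Rightarrow> bool) \<Rightarrow> ('a \<Rightarrow> 'a \<Rightarrow> bool) \<Rightarrow> bool" where
  "prewellorder P W \<longleftrightarrow> (\<forall>x y. P x \<longrightarrow> P y \<longrightarrow> W x y \<or> W y x) \<and>
     (\<forall>x y z. P x \<longrightarrow> P y \<longrightarrow> P z \<longrightarrow> W x y \<longrightarrow> W y z \<longrightarrow> W x z) \<and>
     (\<nexists>f. \<forall>i::nat. P (f i) \<and> \<not> W (f i) (f (Suc i)))"

text \<open>This and \<open>norm_less\<close> are the star relations of a norm, in which points
  outside \<open>P\<close> count as lying above all points of \<open>P\<close>. The prewellordering
  property asks that both belong to the class of \<open>P\<close>.\<close>

definition norm_le :: "('a \<Rightarrow> bool) \<Rightarrow> ('a \<Rightarrow> 'a \<Rightarrow> bool) \<Rightarrow> 'a \<Rightarrow> 'a \<Rightarrow> bool" where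
  "norm_le P W x y \<longleftrightarrow> P x \<and> (P y \<longrightarrow> W x y)"

definition norm_less :: "('a \<Rightarrow> bool) \<Rightarrow> ('a \<Rightarrow> 'a \<Rightarrow> bool) \<Rightarrow> 'a \<Rightarrow> 'a \<Rightarrow> bool" where
  "norm_less P W x y \<longleftrightarrow> P x \<and> (P y \<longrightarrow> \<not> W y x)"

lemma prewellorder_min:
  assumes "prewellorder P W" "P a"  "Q a"
  obtains m where "P m" "Q m" "\<And>b. P b \<Longrightarrow> Q b \<Longrightarrow> W m b"
proof (rule ccontr)
  assume "\<not> thesis"
  with that have *: "\<And>m. P m \<and> Q m \<Longrightarrow> \<exists>b. P b \<and> Q b \<and> \<not> W m b" by blast
  have "\<exists>f. \<forall>i::nat. (P (f i) \<and> Q (f i)) \<and> \<not> W (f i) (f (Suc i))"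
    by (rule dependent_nat_choice) (use assms * in blast)+
  with assms(1) show False unfolding prewellorder_def by blast
qed

text \<open>The norm of \<open>x\<close> is the least norm of a pair \<open>(\<alpha>, x)\<close>,
  and \<open>m x\<close> picks a witness attaining it. One such witness serves against all
  \<open>\<beta>\<close>, which explains the form of the comparisons.\<close>

theorem prewellorder_Ex:
  fixes P :: "'r \<Rightarrow> 'p \<Rightarrow> bool"
  assumes pw: "prewellorder (\<lambda>z. P (fst z) (snd z)) W"
  defines "R \<equiv> \<lambda>x. \<exists>\<alpha>. P \<alpha> x"
  shows "\<exists>W'. prewellorder R W' \<and>
    (\<forall>x y. norm_le R W' x y \<longleftrightarrow> (\<exists>\<alpha>. \<forall>\<beta>. norm_le (\<lambda>z. P (fst z) (snd z)) W (\<alpha>, x) (\<beta>, y))) \<and>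
    (\<forall>x y. norm_less R W' x y \<longleftrightarrow> (\<exists>\<alpha>. \<forall>\<beta>. norm_less (\<lambda>z. P (fst z) (snd z)) W (\<alpha>, x) (\<beta>, y)))"
proof -
  let ?P = "\<lambda>z. P (fst z) (snd z)"
  have total: "\<And>a b. ?P a \<Longrightarrow> ?P b \<Longrightarrow> W a b \<or> W b a"
    and trans: "\<And>a b c. ?P a \<Longrightarrow> ?P b \<Longrightarrow> ?P c \<Longrightarrow> W a b \<Longrightarrow> W b c \<Longrightarrow> W a c"
    and wf: "\<nexists>f. \<forall>i::nat. ?P (f i) \<and> \<not> W (f i) (f (Suc i))"
    using pw unfolding prewellorder_def by blast+
  have "\<exists>m. P m x \<and> (\<forall>\<beta>. P \<beta> x \<longrightarrow> W (m, x) (\<beta>, x))" if "R x" for x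
  proof -
    from that obtain \<alpha> where "P \<alpha> x" unfolding R_def by blast
    then obtain z where "?P z" "snd z = x" "\<And>b. ?P b \<Longrightarrow> snd b = x \<Longrightarrow> W z b"
      using prewellorder_min[OF pw, of "(\<alpha>, x)" "\<lambda>z. snd z = x"] by auto
    then show ?thesis by (intro exI[of _ "fst z"]) (metis fst_conv prod.collapse snd_conv)
  qed
  then obtain m where m: "\<And>x. R x \<Longrightarrow> P (m x) x" "\<And>x \<beta>. R x \<Longrightarrow> P \<beta> x \<Longrightarrow> W (m x, x) (\<beta>, x)"
    by metis
  let ?W = "\<lambda>x y. W (m x, x) (m y, y)"
  have "prewellorder R ?W"
    unfolding prewellorder_def
  proof (intro conjI allI impI notI)
    fix x y assume "R x" "R y" then show "?W x y \<or> ?W y x" using total m(1) by simp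
  next
    fix x y z assume "R x" "R y" "R z" "?W x y" "?W y z"
    then show "?W x z" using trans[of "(m x, x)" "(m y, y)" "(m z, z)"] m(1) by simp
  next
    assume "\<exists>f. \<forall>i::nat. R (f i) \<and> \<not> ?W (f i) (f (Suc i))"
    then obtain f where "\<And>i::nat. R (f i) \<and> \<not> ?W (f i) (f (Suc i))" by blast
    then have "\<forall>i. ?P (m (f i), f i) \<and> \<not> W (m (f i), f i) (m (f (Suc i)), f (Suc i))" using m(1) by simp
    then have "\<exists>g. \<forall>i::nat. ?P (g i) \<and> \<not> W (g i) (g (Suc i))"
      by (rule exI[of _ "\<lambda>i. (m (f i), f i)"])
    with wf show False by (rule notE)
  qed
  moreover have "norm_le R ?W x y \<longleftrightarrow> (\<exists>\<alpha>. \<forall>\<beta>. norm_le ?P W (\<alpha>, x) (\<beta>, y))" for x y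
  proof (cases "R x")
    case x: True
    show ?thesis
    proof
      assume *: "norm_le R ?W x y"
      have "norm_le ?P W (m x, x) (\<beta>, y)" for \<beta>
        unfolding norm_le_def
      proof (intro conjI impI)
        show "P (fst (m x, x)) (snd (m x, x))" using m(1)[OF x] by simp
        assume "P (fst (\<beta>, y)) (snd (\<beta>, y))"
        then have b: "P \<beta> y" "R y" unfolding R_def by auto
        then have "?W x y" using * by (simp add: norm_le_def)
        then show "W (m x, x) (\<beta>, y)"
          using trans[of "(m x, x)" "(m y, y)" "(\<beta>, y)"] m b x by simp
      qed
      then show "\<exists>\<alpha>. \<forall>\<beta>. norm_le ?P W (\<alpha>, x) (\<beta>, y)" by blast
    next
      assume "\<exists>\<alpha>. \<forall>\<beta>. norm_le ?P W (\<alpha>, x) (\<beta>, y)"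
      then obtain \<alpha> where \<alpha>: "P \<alpha> x" "\<And>\<beta>. P \<beta> y \<Longrightarrow> W (\<alpha>, x) (\<beta>, y)" by (auto simp: norm_le_def)
      have "?W x y" if y: "R y"
        using trans[of "(m x, x)" "(\<alpha>, x)" "(m y, y)"] m x y \<alpha> by simp
      then show "norm_le R ?W x y" using x by (simp add: norm_le_def)
    qed
  next
    case False
    then show ?thesis by (auto simp: norm_le_def R_def)
  qed
  moreover have "norm_less R ?W x y \<longleftrightarrow> (\<exists>\<alpha>. \<forall>\<beta>. norm_less ?P W (\<alpha>, x) (\<beta>, y))" for x y
  proof (cases "R x")
    case x: True
    show ?thesis
    proof
      assume *: "norm_less R ?W x y"
      have "norm_less ?P W (m x, x) (\<beta>, y)" for \<beta>
        unfolding norm_less_def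
      proof (intro conjI impI notI)
        show "P (fst (m x, x)) (snd (m x, x))" using m(1)[OF x] by simp
        assume "P (fst (\<beta>, y)) (snd (\<beta>, y))" and W: "W (\<beta>, y) (m x, x)"
        then have b: "P \<beta> y" "R y" unfolding R_def by auto
        then have "\<not> ?W y x" using * by (simp add: norm_less_def)
        then show False
          using trans[of "(m y, y)" "(\<beta>, y)" "(m x, x)"] m b x W by simp
      qed
      then show "\<exists>\<alpha>. \<forall>\<beta>. norm_less ?P W (\<alpha>, x) (\<beta>, y)" by blast
    next
      assume "\<exists>\<alpha>. \<forall>\<beta>. norm_less ?P W (\<alpha>, x) (\<beta>, y)"
      then obtain \<alpha> where \<alpha>: "P \<alpha> x" "\<And>\<beta>. P \<beta> y \<Longrightarrow> \<not> W (\<beta>, y) (\<alpha>, x)" by (auto simp: norm_less_def)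
      have "\<not> ?W y x" if y: "R y"
        using trans[of "(m y, y)" "(m x, x)" "(\<alpha>, x)"] m x y \<alpha> by auto
      then show "norm_less R ?W x y" using x by (simp add: norm_less_def)
    qed
  next
    case False
    then show ?thesis by (auto simp: norm_less_def R_def)
  qed
  ultimately show ?thesis by (intro exI[of _ ?W]) simp
qed

text \<open>The first periodicity theorem of Martin and Moschovakis, without its definability part:
  \<open>x\<close> is below \<open>y\<close> when player II can answer every \<open>\<alpha>\<close> of player I by a \<open>\<beta>\<close> such that
  \<open>(\<alpha>, x)\<close> is below \<open>(\<beta>, y)\<close>, both being played digit by digit.\<close>

theorem prewellorder_All:
  fixes B :: "baire \<Rightarrow> 'p \<Rightarrow> bool"
  assumes pw: "prewellorder (\<lambda>z. B (fst z) (snd z)) W"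
    and det: "\<And>x y. (\<exists>\<sigma>. I_wins \<sigma> (\<lambda>\<alpha> \<beta>. norm_le (\<lambda>z. B (fst z) (snd z)) W (\<alpha>, x) (\<beta>, y))) \<or>
                 (\<exists>\<tau>. II_wins \<tau> (\<lambda>\<alpha> \<beta>. norm_le (\<lambda>z. B (fst z) (snd z)) W (\<alpha>, x) (\<beta>, y)))"
  defines "P \<equiv> \<lambda>x. \<forall>\<alpha>. B \<alpha> x"
  shows "\<exists>W'. prewellorder P W' \<and>
    (\<forall>x y. norm_le P W' x y \<longleftrightarrow> P x \<and>
      (\<forall>\<sigma>. \<exists>\<alpha> \<beta>. play_I \<sigma> \<alpha> \<beta> \<and> norm_le (\<lambda>z. B (fst z) (snd z)) W (\<alpha>, x) (\<beta>, y))) \<and>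
    (\<forall>x y. norm_less P W' x y \<longleftrightarrow> P x \<and>
      (\<forall>\<tau>. \<exists>\<alpha> \<beta>. play_II \<tau> \<alpha> \<beta> \<and> norm_less (\<lambda>z. B (fst z) (snd z)) W (\<beta>, x) (\<alpha>, y)))"
proof -
  let ?B = "\<lambda>z. B (fst z) (snd z)"
  let ?G = "\<lambda>x y \<alpha> \<beta>. norm_le ?B W (\<alpha>, x) (\<beta>, y)"
  have total: "\<And>a b. ?B a \<Longrightarrow> ?B b \<Longrightarrow> W a b \<or> W b a"
    and trans: "\<And>a b c. ?B a \<Longrightarrow> ?B b \<Longrightarrow> ?B c \<Longrightarrow> W a b \<Longrightarrow> W b c \<Longrightarrow> W a c"
    and wf: "\<nexists>f. \<forall>i::nat. ?B (f i) \<and> \<not> W (f i) (f (Suc i))"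
    using pw unfolding prewellorder_def by blast+
  have less: "\<not> ?G y x \<alpha> \<beta> \<longleftrightarrow> norm_less ?B W (\<beta>, x) (\<alpha>, y)" if "P x" for x y \<alpha> \<beta>
    using that by (auto simp: norm_le_def norm_less_def P_def)
  \<comment> \<open>Being below means that I has no winning strategy; determinacy turns this into a
    strategy for II where one is needed.\<close>
  define W' where "W' x y \<longleftrightarrow> (\<nexists>\<sigma>. I_wins \<sigma> (?G x y))" for x y
  \<comment> \<open>A descending sequence would give I a winning strategy on every board; played
    together, these yield points \<open>(z i, f i)\<close> that descend strictly in
    \<open>W\<close>.\<close>
  have descent: False if f: "\<And>i::nat. P (f i)" "\<And>i. \<not> W' (f i) (f (Suc i))" for f
  proof -
    have "\<forall>i. \<exists>\<sigma>. I_wins \<sigma> (?G (f i) (f (Suc i)))" using f(2) unfolding W'_def by blast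
    from choice[OF this] obtain \<sigma> where \<sigma>: "\<And>i. I_wins (\<sigma> i) (?G (f i) (f (Suc i)))" by blast
    obtain z where z: "\<And>i. play_I (\<sigma> i) (z i) (z (Suc i))" using ex_play_chain by blast
    have "\<not> ?G (f i) (f (Suc i)) (z i) (z (Suc i))" for i
      using \<sigma>[of i] z[of i] unfolding I_wins_def by blast
    then have "\<forall>i. ?B (z i, f i) \<and> \<not> W (z i, f i) (z (Suc i), f (Suc i))"
      using f(1) by (auto simp: norm_le_def P_def)
    then have "\<exists>g. \<forall>i::nat. ?B (g i) \<and> \<not> W (g i) (g (Suc i))"
      by (rule exI[of _ "\<lambda>i. (z i, f i)"])
    with wf show False by (rule notE)
  qed
  have "prewellorder P W'"
    unfolding prewellorder_def
  proof (intro conjI allI impI notI)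
    fix x y assume xy: "P x" "P y"
    show "W' x y \<or> W' y x"
    proof (rule ccontr)
      assume "\<not> ?thesis"
      \<comment> \<open>If neither point is below the other, alternating between them is a
        descending sequence, so totality follows from well-foundedness.\<close>
      then show False
        by (intro descent[of "\<lambda>i. if even i then x else y"]) (use xy in auto)
    qed
  next
    fix x y z assume P: "P x" "P y" "P z" and W: "W' x y" "W' y z"
    obtain \<tau> \<rho> where t: "II_wins \<tau> (?G x y)" "II_wins \<rho> (?G y z)"
      using W det[of x y] det[of y z] unfolding W'_def by blast
    show "W' x z" unfolding W'_def
    proof
      assume "\<exists>\<sigma>. I_wins \<sigma> (?G x z)"
      then obtain \<sigma> where \<sigma>: "I_wins \<sigma> (?G x z)" by blast
      \<comment> \<open>The strategies of II for the two given comparisons are composed and played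
        against \<open>\<sigma>\<close>.\<close>
      obtain \<alpha> \<beta> \<gamma> where p: "play_I \<sigma> \<alpha> \<gamma>" "play_II \<tau> \<alpha> \<beta>" "play_II \<rho> \<beta> \<gamma>"
        using ex_play_triangle by blast
      have "\<not> ?G x z \<alpha> \<gamma>" "?G x y \<alpha> \<beta>" "?G y z \<beta> \<gamma>"
        using \<sigma> t p unfolding I_wins_def II_wins_def by blast+
      then show False
        using P trans[of "(\<alpha>, x)" "(\<beta>, y)" "(\<gamma>, z)"] by (auto simp: norm_le_def P_def)
    qed
  next
    assume "\<exists>f. \<forall>i::nat. P (f i) \<and> \<not> W' (f i) (f (Suc i))"
    then show False using descent by blast
  qed
  moreover have "norm_le P W' x y \<longleftrightarrow> P x \<and> (\<forall>\<sigma>. \<exists>\<alpha> \<beta>. play_I \<sigma> \<alpha> \<beta> \<and> ?G x y \<alpha> \<beta>)" for x y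
  proof (cases "P x \<and> \<not> P y")
    case True
    then obtain \<beta> where \<beta>: "\<not> B \<beta> y" unfolding P_def by blast
    \<comment> \<open>This fixed \<open>\<beta>\<close> wins for II against every
      \<open>\<sigma>\<close>, since \<open>(\<beta>, y)\<close> lies outside the normed set while
      \<open>(\<alpha>, x)\<close> lies inside.\<close>
    have "\<exists>\<alpha> \<beta>. play_I \<sigma> \<alpha> \<beta> \<and> ?G x y \<alpha> \<beta>" for \<sigma>
    proof -
      obtain \<alpha> where "play_I \<sigma> \<alpha> \<beta>" using ex_play_I by blast
      moreover have "?G x y \<alpha> \<beta>" using True \<beta> by (auto simp: norm_le_def P_def)
      ultimately show ?thesis by blast
    qed
    with True show ?thesis by (auto simp: norm_le_def)
  next
    case False
    then show ?thesis by (auto simp: norm_le_def[of P] W'_def I_wins_def)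
  qed
  moreover have "norm_less P W' x y \<longleftrightarrow> P x \<and>
      (\<forall>\<tau>. \<exists>\<alpha> \<beta>. play_II \<tau> \<alpha> \<beta> \<and> norm_less ?B W (\<beta>, x) (\<alpha>, y))" for x y
  proof (cases "P x")
    case x: True
    show ?thesis
    proof (cases "P y")
      case True
      \<comment> \<open>Exactly one player wins, so strict comparison can be expressed by the
        failure of all strategies of II. This gives it the same quantifier shape as the weak
        comparison.\<close>
      have "(\<exists>\<sigma>. I_wins \<sigma> (?G y x)) \<longleftrightarrow> (\<nexists>\<tau>. II_wins \<tau> (?G y x))"
      proof
        assume "\<exists>\<sigma>. I_wins \<sigma> (?G y x)"
        then obtain \<sigma> where \<sigma>: "I_wins \<sigma> (?G y x)" by blast
        show "\<nexists>\<tau>. II_wins \<tau> (?G y x)"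
        proof
          assume "\<exists>\<tau>. II_wins \<tau> (?G y x)"
          then obtain \<tau> where \<tau>: "II_wins \<tau> (?G y x)" by blast
          obtain \<alpha> \<beta> where "play_I \<sigma> \<alpha> \<beta>" "play_II \<tau> \<alpha> \<beta>" using ex_play_both by blast
          with \<sigma> \<tau> show False unfolding I_wins_def II_wins_def by blast
        qed
      qed (use det[of y x] in blast)
      also have "\<dots> \<longleftrightarrow> (\<forall>\<tau>. \<exists>\<alpha> \<beta>. play_II \<tau> \<alpha> \<beta> \<and> norm_less ?B W (\<beta>, x) (\<alpha>, y))"
        unfolding II_wins_def using less[OF x] by auto
      finally show ?thesis using x True by (simp add: norm_less_def[of P] W'_def)
    next
      case False
      then obtain \<alpha> where \<alpha>: "\<not> B \<alpha> y" unfolding P_def by blast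
      have "\<exists>\<alpha> \<beta>. play_II \<tau> \<alpha> \<beta> \<and> norm_less ?B W (\<beta>, x) (\<alpha>, y)" for \<tau>
      proof -
        obtain \<beta> where "play_II \<tau> \<alpha> \<beta>" using ex_play_II by blast
        moreover have "norm_less ?B W (\<beta>, x) (\<alpha>, y)" using x \<alpha> by (auto simp: norm_less_def P_def)
        ultimately show ?thesis by blast
      qed
      with x False show ?thesis by (auto simp: norm_less_def)
    qed
  next
    case False
    then show ?thesis by (auto simp: norm_less_def)
  qed
  ultimately show ?thesis by (intro exI[of _ W']) simp
qed

section \<open>Eventually zero sequences and open conditions\<close>

definition zero_ext :: "nat list \<Rightarrow> nat \<Rightarrow> nat" where
  "zero_ext l k = (if k < length l then rev l ! k else 0)"

lemma zero_ext_hist: "k < m \<Longrightarrow> zero_ext (hist e m) k = e k"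
  by (simp add: zero_ext_def rev_hist)

lemma hist_cong: "(\<And>j. j < k \<Longrightarrow> a j = b j) \<Longrightarrow> hist a k = hist b k"
  by (induction k) auto

lemma hist_zero_ext: "hist (zero_ext l) (length l) = l"
proof -
  have "rev (hist (zero_ext l) (length l)) = rev l"
    unfolding rev_hist by (rule nth_equalityI) (auto simp: zero_ext_def)
  then show ?thesis by simp
qed

lemma zero_ext_unique: "hist e m = l \<Longrightarrow> (\<And>k. m \<le> k \<Longrightarrow> e k = 0) \<Longrightarrow> e = zero_ext l"
proof (rule ext)
  fix k assume "hist e m = l" "\<And>k. m \<le> k \<Longrightarrow> e k = 0"
  then show "e k = zero_ext l k"
    using zero_ext_hist[of k m e] length_hist[of e m] by (cases "k < m") (auto simp: zero_ext_def)
qed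

lemma D11f_zero_ext:
  assumes "D11f f"
  shows "D11f (\<lambda>x. zero_ext (f x))"
proof -
  let ?R = "\<lambda>(z :: (nat list \<times> nat) \<times> nat) \<beta>. \<exists>m. hist \<beta> m = fst (fst z) \<and> (\<forall>k. m \<le> k \<longrightarrow> \<beta> k = (0::nat))"
  let ?T = "\<lambda>(z :: (nat list \<times> nat) \<times> nat) \<beta>. \<beta> (snd (fst z)) = snd z"
  have "D11 (\<lambda>z. zero_ext (fst (fst z)) (snd (fst z)) = snd z)"
  proof (rule D11_via)
    show "D11 (\<lambda>z. ?R (fst z) (snd z))" by (intro D11_intros D11f_hist D11f_intros)
    show "D11 (\<lambda>z. ?T (fst z) (snd z))" by (intro D11_intros D11f_intros)
    show "\<exists>\<beta>. ?R z \<beta>" for z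
      by (rule exI[of _ "zero_ext (fst (fst z))"], rule exI[of _ "length (fst (fst z))"])
        (auto simp: hist_zero_ext, simp add: zero_ext_def)
    show "?T z \<beta> \<longleftrightarrow> zero_ext (fst (fst z)) (snd (fst z)) = snd z" if "?R z \<beta>" for z \<beta>
    proof -
      have "\<beta> = zero_ext (fst (fst z))" using that zero_ext_unique by blast
      then show ?thesis by simp
    qed
  qed
  then have "D11f (\<lambda>z. zero_ext (fst z) (snd z))" by (rule D11f_graph)
  then have "D11f zero_ext" by (rule D11f_lam)
  then show ?thesis using assms by (rule D11f_comp)
qed

lemma D11_play_I:
  assumes "D11f s" "D11f a" "D11f b"
  shows "D11 (\<lambda>x. play_I (s x) (a x) (b x))"
proof -
  have "D11 (\<lambda>z :: baire \<times> baire \<times> baire. play_I (fst z) (fst (snd z)) (snd (snd z)))"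
    unfolding play_I_def by (intro D11_intros D11f_hist D11f_intros)
  from D11_subst[OF this D11f_pair[OF assms(1) D11f_pair[OF assms(2,3)]]] show ?thesis by simp
qed

lemma D11_play_II:
  assumes "D11f s" "D11f a" "D11f b"
  shows "D11 (\<lambda>x. play_II (s x) (a x) (b x))"
proof -
  have "D11 (\<lambda>z :: baire \<times> baire \<times> baire. play_II (fst z) (fst (snd z)) (snd (snd z)))"
    unfolding play_II_def by (intro D11_intros D11f_hist D11f_intros)
  from D11_subst[OF this D11f_pair[OF assms(1) D11f_pair[OF assms(2,3)]]] show ?thesis by simp
qed

definition pcons :: "baire \<Rightarrow> point \<Rightarrow> point" where
  "pcons \<beta> p = Pt (case_nat \<beta> (unPt p))"

lemma D11f_pcons:
  assumes "D11f a" "D11f p"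
  shows "D11f (\<lambda>x. pcons (a x) (p x))"
proof -
  have "D11f (\<lambda>z. pcons (fst z) (snd z))"
  proof (rule D11f_permute)
    show "code (pcons (fst z) (snd z)) i = code z (case i of 0 \<Rightarrow> 0 | Suc j \<Rightarrow> Suc (2 * j))" for z i
      by (cases i) (auto simp: pcons_def code_point_def code_prod_def code_real split2_def)
  qed
  from D11f_comp[OF this D11f_pair[OF assms]] show ?thesis by simp
qed

lemma play_I_agree:
  assumes "play_I \<sigma> \<alpha> \<beta>" "play_I \<sigma> \<alpha>' \<beta>'" "\<And>k. k < N \<Longrightarrow> \<beta>' k = \<beta> k"
  shows "k < N \<Longrightarrow> \<alpha>' k = \<alpha> k"
proof (induction k rule: less_induct)
  case (less k)
  have "hist \<alpha>' k = hist \<alpha> k" using less by (intro hist_cong) auto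
  moreover have "hist \<beta>' k = hist \<beta> k" using less assms(3) by (intro hist_cong) auto
  ultimately show ?case using assms(1,2) unfolding play_I_def by metis
qed

lemma play_II_agree:
  assumes "play_II \<sigma> \<alpha> \<beta>" "play_II \<sigma> \<alpha>' \<beta>'" "\<And>k. k < N \<Longrightarrow> \<alpha>' k = \<alpha> k"
  shows "k < N \<Longrightarrow> \<beta>' k = \<beta> k"
proof (induction k rule: less_induct)
  case (less k)
  have "hist \<beta>' k = hist \<beta> k" using less by (intro hist_cong) auto
  moreover have "hist \<alpha>' (Suc k) = hist \<alpha> (Suc k)" using less assms(3) by (intro hist_cong) auto
  ultimately show ?case using assms(1,2) unfolding play_II_def by metis
qed

text \<open>This is openness in the product of two Baire spaces, stated through initial
  segments.\<close>

definition local_pred :: "(baire \<Rightarrow> baire \<Rightarrow> bool) \<Rightarrow> bool" where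
  "local_pred D \<longleftrightarrow> (\<forall>\<alpha> \<beta>. D \<alpha> \<beta> \<longrightarrow> (\<exists>N. \<forall>\<alpha>' \<beta>'. (\<forall>k<N. \<alpha>' k = \<alpha> k \<and> \<beta>' k = \<beta> k) \<longrightarrow> D \<alpha>' \<beta>'))"

text \<open>An open condition met by some play is met by a play in which the opponent of the strategy
  plays an eventually zero sequence, so the real quantifier reduces to a number quantifier.\<close>

lemma ex_play_I_open:
  assumes "local_pred D"
  shows "(\<exists>\<alpha> \<beta>. play_I \<sigma> \<alpha> \<beta> \<and> D \<alpha> \<beta>) \<longleftrightarrow> (\<exists>l. \<forall>\<alpha>. play_I \<sigma> \<alpha> (zero_ext l) \<longrightarrow> D \<alpha> (zero_ext l))"
proof
  assume "\<exists>\<alpha> \<beta>. play_I \<sigma> \<alpha> \<beta> \<and> D \<alpha> \<beta>"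
  then obtain \<alpha> \<beta> where p: "play_I \<sigma> \<alpha> \<beta>" and D: "D \<alpha> \<beta>" by blast
  obtain N where N: "\<And>\<alpha>' \<beta>'. (\<forall>k<N. \<alpha>' k = \<alpha> k \<and> \<beta>' k = \<beta> k) \<Longrightarrow> D \<alpha>' \<beta>'"
    using assms D unfolding local_pred_def by blast
  let ?l = "hist \<beta> N"
  have "D \<alpha>' (zero_ext ?l)" if "play_I \<sigma> \<alpha>' (zero_ext ?l)" for \<alpha>'
    using play_I_agree[OF p that, of N] by (intro N) (auto simp: zero_ext_hist)
  then show "\<exists>l. \<forall>\<alpha>. play_I \<sigma> \<alpha> (zero_ext l) \<longrightarrow> D \<alpha> (zero_ext l)" by blast
qed (use ex_play_I in blast)

lemma ex_play_II_open:
  assumes "local_pred D"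
  shows "(\<exists>\<alpha> \<beta>. play_II \<sigma> \<alpha> \<beta> \<and> D \<alpha> \<beta>) \<longleftrightarrow> (\<exists>l. \<forall>\<beta>. play_II \<sigma> (zero_ext l) \<beta> \<longrightarrow> D (zero_ext l) \<beta>)"
proof
  assume "\<exists>\<alpha> \<beta>. play_II \<sigma> \<alpha> \<beta> \<and> D \<alpha> \<beta>"
  then obtain \<alpha> \<beta> where p: "play_II \<sigma> \<alpha> \<beta>" and D: "D \<alpha> \<beta>" by blast
  obtain N where N: "\<And>\<alpha>' \<beta>'. (\<forall>k<N. \<alpha>' k = \<alpha> k \<and> \<beta>' k = \<beta> k) \<Longrightarrow> D \<alpha>' \<beta>'"
    using assms D unfolding local_pred_def by blast
  let ?l = "hist \<alpha> N"
  have "D (zero_ext ?l) \<beta>'" if "play_II \<sigma> (zero_ext ?l) \<beta>'" for \<beta>'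
    using play_II_agree[OF p that, of N] by (intro N) (auto simp: zero_ext_hist)
  then show "\<exists>l. \<forall>\<beta>. play_II \<sigma> (zero_ext l) \<beta> \<longrightarrow> D (zero_ext l) \<beta>" by blast
qed (use ex_play_II in blast)

text \<open>All arguments at which evaluation queries a function variable lie below this number,
  which is thus a modulus of continuity.\<close>

primrec tm_use :: "baire \<Rightarrow> asg \<Rightarrow> tm \<Rightarrow> nat" where
  "tm_use e F (TVar i) = 0"
| "tm_use e F TZero = 0"
| "tm_use e F (TSuc t) = tm_use e F t"
| "tm_use e F (TAdd t u) = max (tm_use e F t) (tm_use e F u)"
| "tm_use e F (TMul t u) = max (tm_use e F t) (tm_use e F u)"
| "tm_use e F (TApp i t) = max (tm_use e F t) (Suc (tval e F t))"

lemma tval_use: "(\<And>i k. k < tm_use e F t \<Longrightarrow> G i k = F i k) \<Longrightarrow> tval e G t = tval e F t"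
  by (induction t) (auto simp: less_max_iff_disj)

primrec fm_use :: "baire \<Rightarrow> asg \<Rightarrow> fm \<Rightarrow> nat" where
  "fm_use e F (Eq t u) = max (tm_use e F t) (tm_use e F u)"
| "fm_use e F (Neg \<phi>) = fm_use e F \<phi>"
| "fm_use e F (Conj \<phi> \<psi>) = max (fm_use e F \<phi>) (fm_use e F \<psi>)"
| "fm_use e F (ExN i \<phi>) = 0"
| "fm_use e F (ExF i \<phi>) = 0"

lemma sat_use:
  "qf \<phi> \<Longrightarrow> (\<And>i k. k < fm_use e F \<phi> \<Longrightarrow> G i k = F i k) \<Longrightarrow> sat e G \<phi> \<longleftrightarrow> sat e F \<phi>"
proof (induction \<phi>)
  case (Eq t u)
  then have "tval e G t = tval e F t" "tval e G u = tval e F u"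
    by (auto intro!: tval_use)
  then show ?case by simp
qed auto

lemma prewellorder_pullback:
  assumes "prewellorder P W"
  shows "prewellorder (\<lambda>x. P (f x)) (\<lambda>x y. W (f x) (f y))"
proof -
  have "\<not> (\<forall>i::nat. P (f (g i)) \<and> \<not> W (f (g i)) (f (g (Suc i))))" for g
  proof
    assume "\<forall>i::nat. P (f (g i)) \<and> \<not> W (f (g i)) (f (g (Suc i)))"
    then have "\<exists>h. \<forall>i::nat. P (h i) \<and> \<not> W (h i) (h (Suc i))" by (rule exI[of _ "\<lambda>i. f (g i)"])
    with assms show False unfolding prewellorder_def by blast
  qed
  with assms show ?thesis unfolding prewellorder_def by blast
qed

lemma continuous_split2_case_nat:
  "continuous_on UNIV (\<lambda>x :: nat \<Rightarrow> nat. split2 (case_nat (\<lambda>k. x (2 * k)) F) (case_nat (\<lambda>k. x (Suc (2 * k))) G))"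
proof (intro continuous_on_coordinatewise_then_product)
  fix i j
  show "continuous_on UNIV (\<lambda>x :: nat \<Rightarrow> nat. split2 (case_nat (\<lambda>k. x (2 * k)) F) (case_nat (\<lambda>k. x (Suc (2 * k))) G) i j)"
    by (cases "even i"; cases "i div 2") (auto simp: split2_def)
qed

text \<open>This is the common core of all odd levels. The complexity of the quantifiers over plays
  is a hypothesis because it has different reasons at level \<open>1\<close>, where \<open>B\<close>
  is open, and at higher levels, where projections are absorbed. Hypothesis \<open>le\<close> makes
  the game projective.\<close>

lemma periodicity_All:
  fixes B :: "point \<Rightarrow> bool"
  assumes pd: "projective_determinacy"
    and pw: "prewellorder B W"
    and le: "SigP (Suc m) (\<lambda>z. \<not> norm_le B W (fst z) (snd z))"
    and P: "SigP (Suc m) (\<lambda>p. \<not> P p)" "\<And>p. P p \<longleftrightarrow> (\<forall>\<alpha>. B (pcons \<alpha> p))"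
    and le': "SigP (Suc m) (\<lambda>z. \<not> (\<exists>\<alpha> \<beta>. play_I (snd z) \<alpha> \<beta> \<and>
        norm_le B W (pcons \<alpha> (fst (fst z))) (pcons \<beta> (snd (fst z)))))"
    and less': "SigP (Suc m) (\<lambda>z. \<not> (\<exists>\<alpha> \<beta>. play_II (snd z) \<alpha> \<beta> \<and>
        norm_less B W (pcons \<beta> (fst (fst z))) (pcons \<alpha> (snd (fst z)))))"
  shows "\<exists>W'. prewellorder P W' \<and> SigP (Suc m) (\<lambda>z. \<not> norm_le P W' (fst z) (snd z)) \<and>
     SigP (Suc m) (\<lambda>z. \<not> norm_less P W' (fst z) (snd z))"
proof -
  let ?B = "\<lambda>z. B (pcons (fst z) (snd z))" and ?W = "\<lambda>z w. W (pcons (fst z) (snd z)) (pcons (fst w) (snd w))"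
  have pw': "prewellorder ?B ?W" using prewellorder_pullback[OF pw, of "\<lambda>z. pcons (fst z) (snd z)"] .
  have eq: "norm_le ?B ?W (\<alpha>, x) (\<beta>, y) \<longleftrightarrow> norm_le B W (pcons \<alpha> x) (pcons \<beta> y)"
    "norm_less ?B ?W (\<alpha>, x) (\<beta>, y) \<longleftrightarrow> norm_less B W (pcons \<alpha> x) (pcons \<beta> y)" for \<alpha> \<beta> x y
    by (simp_all add: norm_le_def norm_less_def)
  have det: "(\<exists>\<sigma>. I_wins \<sigma> (\<lambda>\<alpha> \<beta>. norm_le ?B ?W (\<alpha>, x) (\<beta>, y))) \<or>
      (\<exists>\<tau>. II_wins \<tau> (\<lambda>\<alpha> \<beta>. norm_le ?B ?W (\<alpha>, x) (\<beta>, y)))" for x y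
  proof (rule determined_wins)
    let ?h = "\<lambda>u :: nat \<Rightarrow> nat. (pcons (\<lambda>k. u (2 * k)) x, pcons (\<lambda>k. u (Suc (2 * k))) y)"
    have "{u. \<not> norm_le B W (fst (?h u)) (snd (?h u))} \<in> boldface_Sigma1 (Suc m)"
      by (rule boldface_SigP[OF le])
         (simp add: code_prod_def code_point_def pcons_def continuous_split2_case_nat)
    then have "{u. \<not> norm_le ?B ?W (\<lambda>k. u (2 * k), x) (\<lambda>k. u (Suc (2 * k)), y)} \<in> boldface_Sigma1 (Suc m)"
      unfolding eq by simp
    then have "projective {u. \<not> norm_le ?B ?W (\<lambda>k. u (2 * k), x) (\<lambda>k. u (Suc (2 * k)), y)}"
      unfolding projective_def by (intro exI[of _ "Suc m"]) (simp del: boldface_Sigma1.simps)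
    with pd show "determined {u. \<not> norm_le ?B ?W (\<lambda>k. u (2 * k), x) (\<lambda>k. u (Suc (2 * k)), y)}"
      unfolding projective_determinacy_def by blast
  qed
  have "P = (\<lambda>x. \<forall>\<alpha>. B (pcons \<alpha> x))" by (rule ext) (rule P(2))
  then obtain W' where W': "prewellorder P W'"
    "\<And>x y. norm_le P W' x y \<longleftrightarrow> P x \<and> (\<forall>\<sigma>. \<exists>\<alpha> \<beta>. play_I \<sigma> \<alpha> \<beta> \<and> norm_le B W (pcons \<alpha> x) (pcons \<beta> y))"
    "\<And>x y. norm_less P W' x y \<longleftrightarrow> P x \<and> (\<forall>\<tau>. \<exists>\<alpha> \<beta>. play_II \<tau> \<alpha> \<beta> \<and> norm_less B W (pcons \<beta> x) (pcons \<alpha> y))"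
    using prewellorder_All[where B = "\<lambda>\<alpha> x. B (pcons \<alpha> x)", OF pw' det] unfolding eq by auto
  have P': "SigP (Suc m) (\<lambda>z :: point \<times> point. \<not> P (fst z))"
    by (intro SigP_subst[OF P(1)] D11f_intros)
  have "SigP (Suc m) (\<lambda>z. \<not> norm_le P W' (fst z) (snd z))"
    unfolding W'(2) de_Morgan_conj not_all by (intro SigP_disj[OF P'] SigP_exF le')
  moreover have "SigP (Suc m) (\<lambda>z. \<not> norm_less P W' (fst z) (snd z))"
    unfolding W'(3) de_Morgan_conj not_all by (intro SigP_disj[OF P'] SigP_exF less')
  ultimately show ?thesis using W'(1) by blast
qed

definition EP :: "nat \<Rightarrow> ('a :: coded \<Rightarrow> bool) \<Rightarrow> bool" where
  "EP n P \<longleftrightarrow> (if odd n then SigP n (\<lambda>x. \<not> P x) else SigP n P)"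

lemma SigP_point_Suc:
  fixes P :: "point \<Rightarrow> bool"
  assumes "SigP (Suc m) P"
  obtains Q where "SigP m Q" "\<And>p. P p \<longleftrightarrow> (\<exists>\<alpha>. \<not> Q (pcons \<alpha> p))"
proof -
  obtain P' where "Sig (Suc m) P'" and P': "\<And>p. P p \<longleftrightarrow> P' (unPt p)"
    using assms unfolding SigP_def code_point_def by blast
  then obtain Q where Q: "Sig m Q" "\<And>F. P' F \<longleftrightarrow> (\<exists>\<beta>. \<not> Q (case_nat \<beta> F))" by (auto simp: Sig.simps)
  have "SigP m (\<lambda>p. Q (unPt p))" by (rule LsI[OF Q(1)]) (simp add: code_point_def)
  then show ?thesis by (rule that) (simp add: P' Q(2) pcons_def)
qed

section \<open>The prewellordering property under projective determinacy\<close>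

text \<open>The space is \<open>point\<close> because there every assignment is a code, so that the
  outermost function quantifier of a predicate can be peeled off.\<close>

definition has_norms :: "nat \<Rightarrow> bool" where
  "has_norms n \<longleftrightarrow> (\<forall>P :: point \<Rightarrow> bool. EP n P \<longrightarrow> (\<exists>W. prewellorder P W \<and>
     EP n (\<lambda>z. norm_le P W (fst z) (snd z)) \<and> EP n (\<lambda>z. norm_less P W (fst z) (snd z))))"

text \<open>\<open>P\<close> is universal over a \<Sigma>^1 predicate \<open>B\<close> one level
  below. The existence of a suitable play remains at the level of \<open>B\<close>, and the
  universal quantifier over strategies gives the \<Pi>^1 form of the new level.\<close>

lemma has_norms_odd_step:
  assumes pd: "projective_determinacy" and n: "has_norms (Suc k)" "odd k"
  shows "has_norms (Suc (Suc k))"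
  unfolding has_norms_def
proof (intro allI impI)
  fix P :: "point \<Rightarrow> bool"
  let ?m = "Suc k"
  assume "EP (Suc ?m) P"
  with n have P: "SigP (Suc ?m) (\<lambda>p. \<not> P p)" by (simp add: EP_def)
  obtain B where B: "SigP ?m B" "\<And>p. \<not> P p \<longleftrightarrow> (\<exists>\<alpha>. \<not> B (pcons \<alpha> p))" using SigP_point_Suc[OF P] by blast
  obtain W where W: "prewellorder B W" "SigP ?m (\<lambda>z. norm_le B W (fst z) (snd z))"
    "SigP ?m (\<lambda>z. norm_less B W (fst z) (snd z))"
    using n B(1) unfolding has_norms_def EP_def by auto
  have le: "SigP ?m (\<lambda>x. norm_le B W (f x) (g x))" "SigP ?m (\<lambda>x. norm_less B W (f x) (g x))"
    if "D11f f" "D11f g" for f and g :: "'a :: coded \<Rightarrow> point"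
    using SigP_subst[OF W(2) D11f_pair[OF that]] SigP_subst[OF W(3) D11f_pair[OF that]] by simp_all
  have "\<exists>W'. prewellorder P W' \<and> SigP (Suc ?m) (\<lambda>z. \<not> norm_le P W' (fst z) (snd z)) \<and>
     SigP (Suc ?m) (\<lambda>z. \<not> norm_less P W' (fst z) (snd z))"
  proof (rule periodicity_All[OF pd W(1) SigP_not[OF W(2)] P])
    show "P p \<longleftrightarrow> (\<forall>\<alpha>. B (pcons \<alpha> p))" for p using B(2) by blast
    show "SigP (Suc ?m) (\<lambda>z. \<not> (\<exists>\<alpha> \<beta>. play_I (snd z) \<alpha> \<beta> \<and>
        norm_le B W (pcons \<alpha> (fst (fst z))) (pcons \<beta> (snd (fst z)))))"
      by (intro SigP_not SigP_exF SigP_conj le D11_Ls(1) D11_play_I D11f_pcons D11f_intros)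
    show "SigP (Suc ?m) (\<lambda>z. \<not> (\<exists>\<alpha> \<beta>. play_II (snd z) \<alpha> \<beta> \<and>
        norm_less B W (pcons \<beta> (fst (fst z))) (pcons \<alpha> (snd (fst z)))))"
      by (intro SigP_not SigP_exF SigP_conj le D11_Ls(1) D11_play_II D11f_pcons D11f_intros)
  qed
  then show "\<exists>W. prewellorder P W \<and>
     EP (Suc ?m) (\<lambda>z. norm_le P W (fst z) (snd z)) \<and> EP (Suc ?m) (\<lambda>z. norm_less P W (fst z) (snd z))"
    using n by (simp add: EP_def)
qed

text \<open>Here \<open>P\<close> is existential over a \<Pi>^1 predicate \<open>B\<close> one level
  below, so least witnesses suffice and no game is played.\<close>

lemma has_norms_even_step:
  assumes n: "has_norms (Suc k)" "even k"
  shows "has_norms (Suc (Suc k))"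
  unfolding has_norms_def
proof (intro allI impI)
  fix P :: "point \<Rightarrow> bool"
  let ?m = "Suc k"
  assume "EP (Suc ?m) P"
  with n have P: "SigP (Suc ?m) P" by (simp add: EP_def)
  obtain Q where Q: "SigP ?m Q" "\<And>p. P p \<longleftrightarrow> (\<exists>\<alpha>. \<not> Q (pcons \<alpha> p))" using SigP_point_Suc[OF P] by blast
  define B where "B p \<longleftrightarrow> \<not> Q p" for p
  have "EP ?m B" using Q(1) n by (simp add: EP_def B_def)
  then obtain W where W: "prewellorder B W" "SigP ?m (\<lambda>z. \<not> norm_le B W (fst z) (snd z))"
    "SigP ?m (\<lambda>z. \<not> norm_less B W (fst z) (snd z))"
    using n unfolding has_norms_def EP_def by auto
  have le: "SigP ?m (\<lambda>x. \<not> norm_le B W (f x) (g x))" "SigP ?m (\<lambda>x. \<not> norm_less B W (f x) (g x))"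
    if "D11f f" "D11f g" for f and g :: "'a :: coded \<Rightarrow> point"
    using SigP_subst[OF W(2) D11f_pair[OF that]] SigP_subst[OF W(3) D11f_pair[OF that]] by simp_all
  let ?B = "\<lambda>z. B (pcons (fst z) (snd z))" and ?W = "\<lambda>z w. W (pcons (fst z) (snd z)) (pcons (fst w) (snd w))"
  have pw': "prewellorder ?B ?W" using prewellorder_pullback[OF W(1), of "\<lambda>z. pcons (fst z) (snd z)"] .
  have eq: "norm_le ?B ?W (\<alpha>, x) (\<beta>, y) \<longleftrightarrow> norm_le B W (pcons \<alpha> x) (pcons \<beta> y)"
    "norm_less ?B ?W (\<alpha>, x) (\<beta>, y) \<longleftrightarrow> norm_less B W (pcons \<alpha> x) (pcons \<beta> y)" for \<alpha> \<beta> x y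
    by (simp_all add: norm_le_def norm_less_def)
  have "P = (\<lambda>x. \<exists>\<alpha>. B (pcons \<alpha> x))" by (rule ext) (simp add: Q(2) B_def)
  then obtain W' where W': "prewellorder P W'"
    "\<And>x y. norm_le P W' x y \<longleftrightarrow> (\<exists>\<alpha>. \<forall>\<beta>. norm_le B W (pcons \<alpha> x) (pcons \<beta> y))"
    "\<And>x y. norm_less P W' x y \<longleftrightarrow> (\<exists>\<alpha>. \<forall>\<beta>. norm_less B W (pcons \<alpha> x) (pcons \<beta> y))"
    using prewellorder_Ex[where P = "\<lambda>\<alpha> x. B (pcons \<alpha> x)", OF pw'] unfolding eq by auto
  have *: "(\<exists>\<alpha>. \<forall>\<beta>. R \<alpha> \<beta>) \<longleftrightarrow> (\<exists>\<alpha>. \<not> (\<exists>\<beta>. \<not> R \<alpha> \<beta>))" for R :: "baire \<Rightarrow> baire \<Rightarrow> bool"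
    by blast
  have "SigP (Suc ?m) (\<lambda>z. norm_le P W' (fst z) (snd z))"
    unfolding W'(2) * by (intro SigP_exF SigP_not le D11f_pcons D11f_intros)
  moreover have "SigP (Suc ?m) (\<lambda>z. norm_less P W' (fst z) (snd z))"
    unfolding W'(3) * by (intro SigP_exF SigP_not le D11f_pcons D11f_intros)
  ultimately show "\<exists>W. prewellorder P W \<and>
     EP (Suc ?m) (\<lambda>z. norm_le P W (fst z) (snd z)) \<and> EP (Suc ?m) (\<lambda>z. norm_less P W (fst z) (snd z))"
    using n W'(1) by (auto simp: EP_def)
qed

lemma D11_sat:
  assumes "qf \<phi>" "D11f e" "D11f p"
  shows "D11 (\<lambda>x. sat (e x) (unPt (p x)) \<phi>)"
proof -
  \<comment> \<open>In the code of a pair of a point and a number assignment, the latter is the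
    function in slot \<open>1\<close>, and the functions of the point occupy the even slots.\<close>
  let ?v = "\<lambda>i. TApp (Suc 0) (num i)" and ?h = "\<lambda>i. TApp (2 * i) (TVar 0)"
  have sat: "sat d (code z) (fsub ?v ?h \<phi>) \<longleftrightarrow> sat (snd z) (unPt (fst z)) \<phi>" for d and z :: "point \<times> baire"
    unfolding sat_fsub[OF assms(1)] by (simp add: fun_subst_def code_prod_def code_real code_point_def split2_def)
  let ?s = "\<lambda>\<psi>. fsub (\<lambda>_. TZero) (\<lambda>i. TApp i (TVar 0)) \<psi>"
  have sat0: "qf \<psi> \<Longrightarrow> sat d F (?s \<psi>) \<longleftrightarrow> sat (\<lambda>_. 0) F \<psi>" for d F \<psi>
    by (simp add: sat_fsub fun_subst_def)
  let ?\<psi> = "fsub ?v ?h \<phi>"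
  have q: "qf ?\<psi>" "qf (Neg ?\<psi>)" using assms(1) by (simp_all add: qf_fsub)
  have 1: "Sig 0 (\<lambda>F. sat (\<lambda>_. 0) F ?\<psi>)"
    by (rule Sig_0I[OF qf_fsub[OF q(1), of "\<lambda>_. TZero" "\<lambda>i. TApp i (TVar 0)"]]) (simp only: sat0[OF q(1)] simp_thms)
  have 2: "Sig 0 (\<lambda>F. sat (\<lambda>_. 0) F (Neg ?\<psi>))"
    by (rule Sig_0I[OF qf_fsub[OF q(2), of "\<lambda>_. TZero" "\<lambda>i. TApp i (TVar 0)"]]) (simp only: sat0[OF q(2)] simp_thms)
  have "D11 (\<lambda>z :: point \<times> baire. sat (snd z) (unPt (fst z)) \<phi>)"
    unfolding D11_def by (rule conjI[OF LsI[OF Sig_Suc[OF 1]] LsI[OF Sig_Suc[OF 2]]]) (simp_all add: sat)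
  from D11_subst[OF this D11f_pair[OF assms(3,2)]] show ?thesis by simp
qed

lemma D11f_inv_enc:
  fixes f :: "'a :: coded \<Rightarrow> nat"
  assumes "D11f f" shows "D11f (\<lambda>x. inv enc (f x) :: 'b :: ncoded)"
  by (rule D11f_of_enc) (simp add: assms)

text \<open>\<open>B\<close> is existential over numbers, so the least index of a witness is a norm
  whose comparisons are \<Delta>^1_1 and open. By openness the existence of a play that meets a
  comparison becomes a number quantifier over eventually zero sequences, after which the general
  periodicity argument applies.\<close>

lemma has_norms_1:
  assumes pd: "projective_determinacy"
  shows "has_norms (Suc 0)"
  unfolding has_norms_def
proof (intro allI impI)
  fix P :: "point \<Rightarrow> bool"
  assume "EP (Suc 0) P"
  then have P: "SigP (Suc 0) (\<lambda>p. \<not> P p)" by (simp add: EP_def)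
  obtain B where "SigP 0 B" and B2: "\<And>p. \<not> P p \<longleftrightarrow> (\<exists>\<alpha>. \<not> B (pcons \<alpha> p))" using SigP_point_Suc[OF P] by blast
  then obtain \<phi> where \<phi>: "qf \<phi>" "\<And>p. B p \<longleftrightarrow> (\<exists>e. sat e (unPt p) \<phi>)"
    by (auto simp: SigP_def Sig.simps code_point_def)
  \<comment> \<open>Only finitely many number variables occur in \<open>\<phi>\<close>, so the
    eventually zero assignments contain a witness whenever there is one.\<close>
  define d where "d j = zero_ext (inv enc j)" for j :: nat
  define R where "R p j \<longleftrightarrow> sat (d j) (unPt p) \<phi>" for p j
  have DR: "D11 (\<lambda>x. R (f x) (g x))" if "D11f f" "D11f g" for f and g :: "'a :: coded \<Rightarrow> nat"
    unfolding R_def d_def by (intro D11_sat \<phi> D11f_zero_ext D11f_inv_enc that)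
  have BR: "B p \<longleftrightarrow> (\<exists>j. R p j)" for p
  proof
    assume "B p"
    then obtain e where e: "sat e (unPt p) \<phi>" using \<phi>(2) by blast
    have "sat (zero_ext (hist e (fm_bound \<phi>))) (unPt p) \<phi>"
      using e by (subst sat_bound[OF \<phi>(1), of _ e]) (auto simp: zero_ext_hist)
    then show "\<exists>j. R p j" unfolding R_def d_def by (intro exI[of _ "enc (hist e (fm_bound \<phi>))"]) simp
  qed (auto simp: \<phi>(2) R_def)
  define r where "r p = (LEAST j. R p j)" for p
  have r: "R p (r p)" if "B p" for p using that unfolding BR r_def by (metis LeastI)
  have r_le: "R p j \<Longrightarrow> r p \<le> j" for p j unfolding r_def by (rule Least_le)
  let ?W = "\<lambda>p q. r p \<le> r q"
  have "prewellorder B ?W"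
  proof -
    have "\<not> (\<forall>i. \<not> r (f i) \<le> r (f (Suc i)))" for f
    proof -
      obtain k where "(r (f (Suc k)), r (f k)) \<notin> {(x, y). x < y}"
        by (rule wf_no_infinite_down_chainE[OF wf_less, of "\<lambda>i. r (f i)"])
      then have "r (f k) \<le> r (f (Suc k))" by simp
      then show ?thesis by blast
    qed
    then show ?thesis unfolding prewellorder_def by (auto intro: nat_le_linear)
  qed
  have le: "norm_le B ?W p q \<longleftrightarrow> (\<exists>j. R p j \<and> (\<forall>i. i < j \<longrightarrow> \<not> R q i))" for p q
  proof
    assume "norm_le B ?W p q"
    then have "R p (r p)" "\<forall>i. i < r p \<longrightarrow> \<not> R q i"
      using r BR r_le unfolding norm_le_def by (blast, metis not_less order_trans)
    then show "\<exists>j. R p j \<and> (\<forall>i. i < j \<longrightarrow> \<not> R q i)" by blast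
  next
    assume "\<exists>j. R p j \<and> (\<forall>i. i < j \<longrightarrow> \<not> R q i)"
    then obtain j where "R p j" "\<And>i. i < j \<Longrightarrow> \<not> R q i" by blast
    then show "norm_le B ?W p q"
      unfolding norm_le_def using BR r[of q] r_le[of p j] by (meson le_trans not_less)
  qed
  have less: "norm_less B ?W p q \<longleftrightarrow> (\<exists>j. R p j \<and> (\<forall>i. i \<le> j \<longrightarrow> \<not> R q i))" for p q
  proof
    assume "norm_less B ?W p q"
    then have "R p (r p)" "\<forall>i. i \<le> r p \<longrightarrow> \<not> R q i"
      using r BR r_le unfolding norm_less_def by (blast, metis order_trans)
    then show "\<exists>j. R p j \<and> (\<forall>i. i \<le> j \<longrightarrow> \<not> R q i)" by blast
  next
    assume "\<exists>j. R p j \<and> (\<forall>i. i \<le> j \<longrightarrow> \<not> R q i)"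
    then obtain j where "R p j" "\<And>i. i \<le> j \<Longrightarrow> \<not> R q i" by blast
    then show "norm_less B ?W p q"
      unfolding norm_less_def using BR r[of q] r_le[of p j] by (meson le_trans)
  qed
  have Dle: "D11 (\<lambda>x. norm_le B ?W (f x) (g x))" if "D11f f" "D11f g" for f and g :: "'a :: coded \<Rightarrow> point"
    unfolding le by (intro D11_intros DR D11f_intros D11f_comp[OF that(1)] D11f_comp[OF that(2)])
  have Dless: "D11 (\<lambda>x. norm_less B ?W (f x) (g x))" if "D11f f" "D11f g" for f and g :: "'a :: coded \<Rightarrow> point"
    unfolding less by (intro D11_intros DR D11f_intros D11f_comp[OF that(1)] D11f_comp[OF that(2)])
  \<comment> \<open>The truth values of \<open>R\<close> up to index \<open>j\<close> are decided by
    finitely many digits of the function in front.\<close>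
  have loc: "\<exists>N. \<forall>\<alpha>'. (\<forall>k<N. \<alpha>' k = \<alpha> k) \<longrightarrow> (\<forall>i\<le>j. R (pcons \<alpha>' p) i = R (pcons \<alpha> p) i)" for \<alpha> p j
  proof -
    let ?N = "\<Sum>i\<le>j. fm_use (d i) (unPt (pcons \<alpha> p)) \<phi>"
    have "R (pcons \<alpha>' p) i = R (pcons \<alpha> p) i" if a: "\<forall>k<?N. \<alpha>' k = \<alpha> k" "i \<le> j" for \<alpha>' i
      unfolding R_def
    proof (rule sat_use[OF \<phi>(1)])
      fix l k assume "k < fm_use (d i) (unPt (pcons \<alpha> p)) \<phi>"
      also have "\<dots> \<le> ?N" using a(2) by (intro member_le_sum) auto
      finally show "unPt (pcons \<alpha>' p) l k = unPt (pcons \<alpha> p) l k"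
        using a(1) by (cases l) (simp_all add: pcons_def)
    qed
    then show ?thesis by blast
  qed
  have l1: "local_pred (\<lambda>\<alpha> \<beta>. norm_le B ?W (pcons \<alpha> p) (pcons \<beta> q))" for p q
    unfolding local_pred_def
  proof (intro allI impI)
    fix \<alpha> \<beta> assume "norm_le B ?W (pcons \<alpha> p) (pcons \<beta> q)"
    then obtain j where j: "R (pcons \<alpha> p) j" "\<And>i. i < j \<Longrightarrow> \<not> R (pcons \<beta> q) i" unfolding le by blast
    obtain N M where N: "\<And>\<alpha>'. (\<forall>k<N. \<alpha>' k = \<alpha> k) \<Longrightarrow> (\<forall>i\<le>j. R (pcons \<alpha>' p) i = R (pcons \<alpha> p) i)"
      and M: "\<And>\<beta>'. (\<forall>k<M. \<beta>' k = \<beta> k) \<Longrightarrow> (\<forall>i\<le>j. R (pcons \<beta>' q) i = R (pcons \<beta> q) i)"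
      using loc[of \<alpha> j p] loc[of \<beta> j q] by blast
    have "norm_le B ?W (pcons \<alpha>' p) (pcons \<beta>' q)" if "\<forall>k<max N M. \<alpha>' k = \<alpha> k \<and> \<beta>' k = \<beta> k" for \<alpha>' \<beta>'
      unfolding le using N[of \<alpha>'] M[of \<beta>'] j that by (intro exI[of _ j]) auto
    then show "\<exists>N. \<forall>\<alpha>' \<beta>'. (\<forall>k<N. \<alpha>' k = \<alpha> k \<and> \<beta>' k = \<beta> k) \<longrightarrow> norm_le B ?W (pcons \<alpha>' p) (pcons \<beta>' q)"
      by blast
  qed
  have l2: "local_pred (\<lambda>\<alpha> \<beta>. norm_less B ?W (pcons \<beta> p) (pcons \<alpha> q))" for p q
    unfolding local_pred_def
  proof (intro allI impI)
    fix \<alpha> \<beta> assume "norm_less B ?W (pcons \<beta> p) (pcons \<alpha> q)"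
    then obtain j where j: "R (pcons \<beta> p) j" "\<And>i. i \<le> j \<Longrightarrow> \<not> R (pcons \<alpha> q) i" unfolding less by blast
    obtain N M where N: "\<And>\<beta>'. (\<forall>k<N. \<beta>' k = \<beta> k) \<Longrightarrow> (\<forall>i\<le>j. R (pcons \<beta>' p) i = R (pcons \<beta> p) i)"
      and M: "\<And>\<alpha>'. (\<forall>k<M. \<alpha>' k = \<alpha> k) \<Longrightarrow> (\<forall>i\<le>j. R (pcons \<alpha>' q) i = R (pcons \<alpha> q) i)"
      using loc[of \<beta> j p] loc[of \<alpha> j q] by blast
    have "norm_less B ?W (pcons \<beta>' p) (pcons \<alpha>' q)" if "\<forall>k<max N M. \<alpha>' k = \<alpha> k \<and> \<beta>' k = \<beta> k" for \<alpha>' \<beta>'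
      unfolding less using N[of \<beta>'] M[of \<alpha>'] j that by (intro exI[of _ j]) auto
    then show "\<exists>N. \<forall>\<alpha>' \<beta>'. (\<forall>k<N. \<alpha>' k = \<alpha> k \<and> \<beta>' k = \<beta> k) \<longrightarrow> norm_less B ?W (pcons \<beta>' p) (pcons \<alpha>' q)"
      by blast
  qed
  \<comment> \<open>Negation produces a universal number quantifier before a function quantifier,
    which \<open>SigP_1_allN\<close> admits.\<close>
  have *: "\<not> (\<exists>l. \<forall>\<alpha>. A l \<alpha> \<longrightarrow> C l \<alpha>) \<longleftrightarrow> (\<forall>l. \<exists>\<alpha>. A l \<alpha> \<and> \<not> C l \<alpha>)"
    for A C :: "nat list \<Rightarrow> baire \<Rightarrow> bool" by blast
  have "\<exists>W'. prewellorder P W' \<and> SigP (Suc 0) (\<lambda>z. \<not> norm_le P W' (fst z) (snd z)) \<and>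
     SigP (Suc 0) (\<lambda>z. \<not> norm_less P W' (fst z) (snd z))"
  proof (rule periodicity_All[OF pd \<open>prewellorder B ?W\<close> _ P])
    show "SigP (Suc 0) (\<lambda>z. \<not> norm_le B ?W (fst z) (snd z))"
      by (intro D11_Ls(2) Dle D11f_intros)
    show "P p \<longleftrightarrow> (\<forall>\<alpha>. B (pcons \<alpha> p))" for p using B2 by blast
    show "SigP (Suc 0) (\<lambda>z. \<not> (\<exists>\<alpha> \<beta>. play_I (snd z) \<alpha> \<beta> \<and>
        norm_le B ?W (pcons \<alpha> (fst (fst z))) (pcons \<beta> (snd (fst z)))))"
      unfolding ex_play_I_open[OF l1] *
      by (intro SigP_1_allN SigP_exF SigP_conj D11_Ls(1) D11_play_I D11_not Dle D11f_pcons D11f_zero_ext D11f_intros)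
    show "SigP (Suc 0) (\<lambda>z. \<not> (\<exists>\<alpha> \<beta>. play_II (snd z) \<alpha> \<beta> \<and>
        norm_less B ?W (pcons \<beta> (fst (fst z))) (pcons \<alpha> (snd (fst z)))))"
      unfolding ex_play_II_open[OF l2] *
      by (intro SigP_1_allN SigP_exF SigP_conj D11_Ls(1) D11_play_II D11_not Dless D11f_pcons D11f_zero_ext D11f_intros)
  qed
  then show "\<exists>W. prewellorder P W \<and>
     EP (Suc 0) (\<lambda>z. norm_le P W (fst z) (snd z)) \<and> EP (Suc 0) (\<lambda>z. norm_less P W (fst z) (snd z))"
    by (simp add: EP_def)
qed

theorem has_norms:
  assumes "projective_determinacy"
  shows "has_norms (Suc n)"
proof (induction n)
  case 0
  then show ?case by (rule has_norms_1[OF assms])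
next
  case (Suc n)
  then show ?case using has_norms_odd_step[OF assms] has_norms_even_step by blast
qed

section \<open>Closure properties of E^1_n and the reduction property\<close>

lemma EP_conj: "EP n P \<Longrightarrow> EP n Q \<Longrightarrow> EP n (\<lambda>x. P x \<and> Q x)"
  unfolding EP_def using SigP_conj[of n P Q] SigP_disj[of n "\<lambda>x. \<not> P x" "\<lambda>x. \<not> Q x"] by auto

lemma EP_disj: "EP n P \<Longrightarrow> EP n Q \<Longrightarrow> EP n (\<lambda>x. P x \<or> Q x)"
  unfolding EP_def using SigP_disj[of n P Q] SigP_conj[of n "\<lambda>x. \<not> P x" "\<lambda>x. \<not> Q x"] by auto

lemma EP_subst: "EP (Suc n) P \<Longrightarrow> D11f f \<Longrightarrow> EP (Suc n) (\<lambda>x. P (f x))"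
  unfolding EP_def using SigP_subst[of n P f] SigP_subst[of n "\<lambda>x. \<not> P x" f] by (auto split: if_splits)

lemma D11_LE: "D11 P \<Longrightarrow> EP (Suc n) P"
  unfolding EP_def using D11_Ls by auto

lemma E1_iff_EP: "A \<in> E1 (Suc n) \<longleftrightarrow> EP (Suc n) (\<lambda>k :: nat. k \<in> A)"
proof -
  have "Sig (Suc n) (\<lambda>F. F 0 0 \<in> X) \<longleftrightarrow> SigP (Suc n) (\<lambda>k :: nat. k \<in> X)" for X
  proof
    assume "Sig (Suc n) (\<lambda>F. F 0 0 \<in> X)"
    then show "SigP (Suc n) (\<lambda>k :: nat. k \<in> X)" by (rule LsI) (simp add: code_nat_def)
  next
    assume "SigP (Suc n) (\<lambda>k :: nat. k \<in> X)"
    then obtain Q where Q: "Sig (Suc n) Q" "\<And>k. k \<in> X \<longleftrightarrow> Q (\<lambda>_ _. k)"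
      unfolding SigP_def code_nat_def by blast
    have "term_map (\<lambda>F _ _. F 0 0)" by (rule term_mapI[of _ "\<lambda>_. TApp 0 TZero"]) simp
    from Sig_subst[OF Q(1) this] show "Sig (Suc n) (\<lambda>F. F 0 0 \<in> X)" by (simp add: Q(2))
  qed
  from this[of A] this[of "- A"] show ?thesis
    by (auto simp: E1_def EP_def Sigma1_iff_Sig Pi1_iff_Sig)
qed

text \<open>Each \<open>k\<close> has a copy in either summand of the disjoint sum of
  \<open>A\<close> and \<open>B\<close>, and it goes to the side whose copy has the smaller norm,
  ties going to \<open>A\<close>. Since the sets cover everything, some copy lies in the sum, so
  failure of the weak comparison is the reverse strict one.\<close>

theorem reduction_total:
  fixes A B :: "nat set"
  assumes pd: "projective_determinacy"
    and AB: "EP (Suc n) (\<lambda>k. k \<in> A)" "EP (Suc n) (\<lambda>k. k \<in> B)" "A \<union> B = UNIV"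
  shows "\<exists>H. H \<subseteq> A \<and> - H \<subseteq> B \<and> EP (Suc n) (\<lambda>k. k \<in> H) \<and> EP (Suc n) (\<lambda>k. k \<notin> H)"
proof -
  have slot: "D11f (\<lambda>p. unPt p i 0)" for i
    by (rule D11f_graph, rule D11_atom[of _ "TApp (2 * i) TZero" "TApp 1 TZero"])
      (simp add: code_prod_def code_point_def code_ncoded split2_def)
  \<comment> \<open>The first coordinate is the tag of the summand and the second the number, in the
    layout of a coded pair as used by \<open>q\<close>.\<close>
  define U where "U p \<longleftrightarrow> unPt p 0 0 = 0 \<and> unPt p 1 0 \<in> A \<or> unPt p 0 0 \<noteq> 0 \<and> unPt p 1 0 \<in> B" for p
  have "EP (Suc n) U" unfolding U_def
    by (intro EP_disj EP_conj EP_subst[OF AB(1)] EP_subst[OF AB(2)] slot D11_LE D11_eq D11_not D11f_const)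
  then obtain W where W: "EP (Suc n) (\<lambda>z. norm_le U W (fst z) (snd z))"
    "EP (Suc n) (\<lambda>z. norm_less U W (fst z) (snd z))"
    using has_norms[OF pd] unfolding has_norms_def by blast
  define q where "q i k = Pt (code (i :: nat, k :: nat))" for i k
  have q: "D11f (\<lambda>k. q i k)" for i
  proof -
    have "D11f (\<lambda>z :: nat \<times> nat. Pt (code z))" by (rule D11f_permute[of _ "\<lambda>i. i"]) (simp add: code_point_def)
    from D11f_comp[OF this D11f_pair[OF D11f_const D11f_id]] show ?thesis unfolding q_def .
  qed
  have U: "U (q 0 k) \<longleftrightarrow> k \<in> A" "U (q 1 k) \<longleftrightarrow> k \<in> B" for k
    by (simp_all add: U_def q_def code_prod_def code_nat_def split2_def)
  let ?H = "{k. norm_le U W (q 0 k) (q 1 k)}"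
  have neg: "k \<notin> ?H \<longleftrightarrow> norm_less U W (q 1 k) (q 0 k)" for k
    using AB(3) U[of k] by (auto simp: norm_le_def norm_less_def)
  have "?H \<subseteq> A" using U by (auto simp: norm_le_def)
  moreover have "- ?H \<subseteq> B" using U neg by (auto simp: norm_less_def)
  moreover have "EP (Suc n) (\<lambda>k. k \<in> ?H)"
    using EP_subst[OF W(1) D11f_pair[OF q[of 0] q[of 1]]] by simp
  moreover have "EP (Suc n) (\<lambda>k. k \<notin> ?H)"
    unfolding neg using EP_subst[OF W(2) D11f_pair[OF q[of 1] q[of 0]]] by simp
  ultimately show ?thesis by blast
qed

section \<open>Recursive functions\<close>

text \<open>The coding is onto, as \<open>ncoded\<close> demands: \<open>0\<close> and
  \<open>1\<close> are used by the two constants, and the other four constructors share the numbers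
  from \<open>2\<close> on by residues modulo 4.\<close>

primrec recf_code :: "recf \<Rightarrow> nat" where
  "recf_code RZero = 0"
| "recf_code RSucc = 1"
| "recf_code (RProj i) = 2 + 4 * i"
| "recf_code (RComp f gs) = 3 + 4 * prod_encode (recf_code f, list_encode (map recf_code gs))"
| "recf_code (RPrim f g) = 4 + 4 * prod_encode (recf_code f, recf_code g)"
| "recf_code (RMu f) = 5 + 4 * recf_code f"

lemma mod4_distinct:
  fixes a b :: nat
  shows "2 + 4 * a \<noteq> 3 + 4 * b" "2 + 4 * a \<noteq> 4 + 4 * b" "2 + 4 * a \<noteq> 5 + 4 * b"
    "3 + 4 * a \<noteq> 2 + 4 * b" "3 + 4 * a \<noteq> 4 + 4 * b" "3 + 4 * a \<noteq> 5 + 4 * b"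
    "4 + 4 * a \<noteq> 2 + 4 * b" "4 + 4 * a \<noteq> 3 + 4 * b" "4 + 4 * a \<noteq> 5 + 4 * b"
    "5 + 4 * a \<noteq> 2 + 4 * b" "5 + 4 * a \<noteq> 3 + 4 * b" "5 + 4 * a \<noteq> 4 + 4 * b"
  by presburger+

lemma map_inject_on: "map f xs = map f ys \<Longrightarrow> (\<And>x y. x \<in> set xs \<Longrightarrow> f x = f y \<Longrightarrow> x = y) \<Longrightarrow> xs = ys"
proof (induction xs arbitrary: ys)
  case (Cons x xs)
  then show ?case by (cases ys) auto
qed simp

lemma recf_code_inject: "recf_code r = recf_code s \<Longrightarrow> r = s"
proof (induction r arbitrary: s)
  case RZero then show ?case by (cases s) auto
next
  case RSucc then show ?case by (cases s) auto
next
  case (RProj i) then show ?case by (cases s) (simp_all only: recf_code.simps mod4_distinct, simp_all)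
next
  case (RComp f gs)
  from RComp.prems show ?case
  proof (cases s)
    case (RComp f' gs')
    with RComp.prems have "recf_code f = recf_code f'" "map recf_code gs = map recf_code gs'"
      by (auto dest: list_encode_eq[THEN iffD1])
    with RComp.IH have "f = f'" "gs = gs'" by (blast, blast intro: map_inject_on)
    with RComp show ?thesis by simp
  qed (simp_all only: recf_code.simps mod4_distinct)
next
  case (RPrim f g)
  then show ?case by (cases s) (simp_all only: recf_code.simps mod4_distinct, simp_all)
next
  case (RMu f)
  then show ?case by (cases s) (simp_all only: recf_code.simps mod4_distinct, simp_all)
qed

lemma list_encode_ge: "x \<in> set l \<Longrightarrow> x \<le> list_encode l"
proof (induction l)
  case (Cons y l)
  have "y \<le> prod_encode (y, list_encode l)" "list_encode l \<le> prod_encode (y, list_encode l)"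
    by (rule le_prod_encode_1, rule le_prod_encode_2)
  with Cons show ?case by auto
qed simp

lemma recf_code_surj: "\<exists>r. recf_code r = k"
proof (induction k rule: less_induct)
  case (less k)
  consider "k = 0" | "k = 1" | q where "k = 2 + 4 * q" | q where "k = 3 + 4 * q" | q where "k = 4 + 4 * q"
    | q where "k = 5 + 4 * q"
  proof -
    have "k = 0 \<or> k = 1 \<or> k = 2 + 4 * ((k - 2) div 4) \<or> k = 3 + 4 * ((k - 2) div 4) \<or>
        k = 4 + 4 * ((k - 2) div 4) \<or> k = 5 + 4 * ((k - 2) div 4)"
      by linarith
    with that show thesis by blast
  qed
  then show ?case
  proof cases
    case 1 then show ?thesis by (metis recf_code.simps(1))
  next
    case 2 then show ?thesis by (metis recf_code.simps(2))
  next
    case 3 then show ?thesis by (metis recf_code.simps(3))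
  next
    case (4 q)
    obtain a b where ab: "q = prod_encode (a, b)" by (metis prod.collapse prod_decode_inverse)
    define l where "l = list_decode b"
    have b: "b = list_encode l" by (simp add: l_def)
    have "a \<le> q" "b \<le> q" unfolding ab by (rule le_prod_encode_1, rule le_prod_encode_2)
    then obtain f where f: "recf_code f = a" using less[of a] 4 by auto
    have *: "\<exists>r. recf_code r = x" if "x \<in> set l" for x
      using less[of x] list_encode_ge[OF that] \<open>b \<le> q\<close> b 4 by auto
    have "recf_code (SOME r. recf_code r = x) = x" if "x \<in> set l" for x
      using *[OF that] by (rule someI_ex)
    then have "map recf_code (map (\<lambda>x. SOME r. recf_code r = x) l) = l"
      unfolding map_map comp_def by (rule map_idI)
    then have "recf_code (RComp f (map (\<lambda>x. SOME r. recf_code r = x) l)) = k"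
      using f 4 ab b by simp
    then show ?thesis by blast
  next
    case (5 q)
    obtain a b where ab: "q = prod_encode (a, b)" by (metis prod.collapse prod_decode_inverse)
    have "a \<le> q" "b \<le> q" unfolding ab by (rule le_prod_encode_1, rule le_prod_encode_2)
    then obtain f g where "recf_code f = a" "recf_code g = b" using less[of a] less[of b] 5 by auto
    then have "recf_code (RPrim f g) = k" using 5 ab by simp
    then show ?thesis by blast
  next
    case (6 q)
    then obtain f where "recf_code f = q" using less[of q] by auto
    then have "recf_code (RMu f) = k" using 6 by simp
    then show ?thesis by blast
  qed
qed

instantiation recf :: ncoded
begin
definition enc_recf :: "recf \<Rightarrow> nat" where "enc_recf = recf_code"
definition code_recf :: "recf \<Rightarrow> nat \<Rightarrow> nat \<Rightarrow> nat" where "code_recf x = (\<lambda>_ _. enc x)"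
instance
proof
  show "bij (enc :: recf \<Rightarrow> nat)" unfolding enc_recf_def
  proof (rule bijI)
    show "inj recf_code" by (rule injI) (rule recf_code_inject)
    show "surj recf_code" unfolding surj_def using recf_code_surj by metis
  qed
qed (simp add: code_recf_def)
end

lemma D11f_RProj: "D11f i \<Longrightarrow> D11f (\<lambda>x. RProj (i x))"
  by (rule D11f_of_enc, unfold enc_recf_def recf_code.simps, intro D11f_intros)

lemma D11f_RComp: "D11f f \<Longrightarrow> D11f gs \<Longrightarrow> D11f (\<lambda>x. RComp (f x) (gs x))"
proof (rule D11f_of_enc)
  assume f: "D11f f" "D11f gs"
  have "enc (RComp a b) = 3 + 4 * prod_encode (enc a, enc b)" for a b
    by (simp add: enc_recf_def enc_list_def)
  then show "D11f (\<lambda>x. enc (RComp (f x) (gs x)))" using f by (simp only:) (intro D11f_intros)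
qed

lemma D11f_RPrim: "D11f f \<Longrightarrow> D11f g \<Longrightarrow> D11f (\<lambda>x. RPrim (f x) (g x))"
proof (rule D11f_of_enc)
  assume f: "D11f f" "D11f g"
  have "enc (RPrim a b) = 4 + 4 * prod_encode (enc a, enc b)" for a b
    by (simp add: enc_recf_def)
  then show "D11f (\<lambda>x. enc (RPrim (f x) (g x)))" using f by (simp only:) (intro D11f_intros)
qed

lemma D11f_RMu: "D11f f \<Longrightarrow> D11f (\<lambda>x. RMu (f x))"
proof (rule D11f_of_enc)
  assume f: "D11f f"
  have "enc (RMu a) = 5 + 4 * enc a" for a
    by (simp add: enc_recf_def)
  then show "D11f (\<lambda>x. enc (RMu (f x)))" using f by (simp only:) (intro D11f_intros)
qed

lemma D11f_tl:
  fixes f :: "'a :: coded \<Rightarrow> 'b :: ncoded list"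
  assumes "D11f f"
  shows "D11f (\<lambda>x. tl (f x))"
proof -
  have "D11f (tl :: 'b list \<Rightarrow> 'b list)"
  proof (rule D11f_graph)
    have "D11 (\<lambda>z :: 'b list \<times> 'b list. fst z = [] \<and> snd z = [] \<or> (\<exists>y. fst z = y # snd z))"
      by (intro D11_intros D11f_intros)
    then show "D11 (\<lambda>z :: 'b list \<times> 'b list. tl (fst z) = snd z)"
      by (rule D11_cong) (metis list.exhaust_sel list.sel(2,3))
  qed
  then show ?thesis using assms by (rule D11f_comp)
qed

lemma D11f_drop:
  fixes f :: "'a :: coded \<Rightarrow> 'b :: ncoded list"
  assumes "D11f i" "D11f f"
  shows "D11f (\<lambda>x. drop (i x) (f x))"
proof -
  have *: "drop k l = rec_nat l (\<lambda>_ v. tl v) k" for k and l :: "'b list"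
    by (induction k) (auto simp: drop_Suc drop_tl)
  show ?thesis unfolding * by (intro D11f_rec_nat D11f_tl D11f_intros assms)
qed

text \<open>Pointwise relation of lists is expressed through \<open>drop\<close> and
  \<open>Cons\<close>, for which definability has been established.\<close>

lemma list_all2_drop:
  "list_all2 P xs ys \<longleftrightarrow> (\<forall>i. drop i xs = [] \<longleftrightarrow> drop i ys = []) \<and>
     (\<forall>i x t y u. drop i xs = x # t \<and> drop i ys = y # u \<longrightarrow> P x y)" (is "_ \<longleftrightarrow> ?R")
proof
  assume a: "list_all2 P xs ys"
  show ?R
  proof (intro conjI allI impI)
    show "drop i xs = [] \<longleftrightarrow> drop i ys = []" for i using list_all2_lengthD[OF a] by simp
    show "P x y" if "drop i xs = x # t \<and> drop i ys = y # u" for i x t y u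
      using list_all2_dropI[OF a, of i] that by simp
  qed
next
  assume R: ?R
  then show "list_all2 P xs ys"
  proof (induction xs arbitrary: ys)
    case Nil
    from Nil[THEN conjunct1, THEN spec, of 0] show ?case by simp
  next
    case (Cons x xs)
    from Cons.prems[THEN conjunct1, THEN spec, of 0] obtain y ys' where ys: "ys = y # ys'" by (cases ys) auto
    have "(\<forall>i. drop i xs = [] \<longleftrightarrow> drop i ys' = []) \<and>
     (\<forall>i x t y u. drop i xs = x # t \<and> drop i ys' = y # u \<longrightarrow> P x y)"
    proof (intro conjI allI impI)
      show "drop i xs = [] \<longleftrightarrow> drop i ys' = []" for i
        using Cons.prems[THEN conjunct1, THEN spec, of "Suc i"] ys by simp
      show "P x y" if "drop i xs = x # t \<and> drop i ys' = y # u" for i x t y u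
        using Cons.prems[THEN conjunct2, THEN spec, of "Suc i"] ys that by auto
    qed
    moreover have "P x y" using Cons.prems[THEN conjunct2, THEN spec, of 0] ys by simp
    ultimately show ?case using Cons.IH ys by simp
  qed
qed

text \<open>The recursive calls of \<open>recf_eval\<close> are delegated to \<open>X\<close>, so
  that evaluation becomes an iteration along the natural numbers, which a single function can
  tabulate. Projection is phrased with \<open>drop\<close> for the sake of definability.\<close>

inductive eval_step :: "(recf \<Rightarrow> nat list \<Rightarrow> nat \<Rightarrow> bool) \<Rightarrow> recf \<Rightarrow> nat list \<Rightarrow> nat \<Rightarrow> bool" for X where
  "eval_step X RZero xs 0"
| "eval_step X RSucc (x # xs) (Suc x)"
| "drop i xs = y # l \<Longrightarrow> eval_step X (RProj i) xs y"
| "list_all2 (\<lambda>g v. X g xs v) gs ys \<Longrightarrow> X f ys y \<Longrightarrow> eval_step X (RComp f gs) xs y"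
| "X f xs y \<Longrightarrow> eval_step X (RPrim f g) (0 # xs) y"
| "X (RPrim f g) (k # xs) v \<Longrightarrow> X g (k # v # xs) y \<Longrightarrow> eval_step X (RPrim f g) (Suc k # xs) y"
| "X f (y # xs) 0 \<Longrightarrow> (\<forall>i<y. \<exists>v. X f (i # xs) (Suc v)) \<Longrightarrow> eval_step X (RMu f) xs y"

primrec eval_stage :: "nat \<Rightarrow> recf \<Rightarrow> nat list \<Rightarrow> nat \<Rightarrow> bool" where
  "eval_stage 0 = (\<lambda>_ _ _. False)"
| "eval_stage (Suc k) = eval_step (eval_stage k)"

lemma eval_step_mono:
  assumes "\<And>r xs y. X r xs y \<Longrightarrow> Y r xs y" "eval_step X r xs y"
  shows "eval_step Y r xs y"
  using assms(2)
proof cases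
  case (4 gs ys f)
  have "list_all2 (\<lambda>g v. Y g xs v) gs ys" using 4(2) by (rule list_all2_mono) (rule assms(1))
  then show ?thesis unfolding 4(1) by (rule eval_step.intros(4)[where X = Y]) (rule assms(1)[OF 4(3)])
next
  case (7 f)
  have "\<forall>i<y. \<exists>v. Y f (i # xs) (Suc v)" using 7(3) assms(1) by blast
  then show ?thesis unfolding 7(1) by (rule eval_step.intros(7)[where X = Y, OF assms(1)[OF 7(2)]])
next
  case (6 f g k l v)
  then show ?thesis using eval_step.intros(6)[where X = Y] assms(1) by blast
qed (use assms(1) in \<open>auto intro: eval_step.intros(1,2,3,5)\<close>)

lemma eval_stage_mono: "eval_stage k r xs y \<Longrightarrow> k \<le> m \<Longrightarrow> eval_stage m r xs y"
proof (induction k arbitrary: m r xs y)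
  case (Suc k)
  obtain j where j: "m = Suc j" "k \<le> j" using Suc.prems(2) by (metis Suc_le_D Suc_le_mono)
  have "eval_step (eval_stage k) r xs y" using Suc.prems(1) by simp
  then have "eval_step (eval_stage j) r xs y"
    using eval_step_mono[of "eval_stage k" "eval_stage j" r xs y] Suc.IH[OF _ j(2)] by blast
  then show ?case using j(1) by simp
qed simp

lemma eval_step_sound:
  assumes "\<And>r xs y. X r xs y \<Longrightarrow> recf_eval r xs y" "eval_step X r xs y"
  shows "recf_eval r xs y"
  using assms(2)
proof cases
  case (3 i l)
  then have "i < length xs" by (metis drop_all list.distinct(1) not_le)
  moreover from this have "xs ! i = y" using 3 by (simp add: Cons_nth_drop_Suc[symmetric])
  ultimately show ?thesis using recf_eval.intros(3)[of i xs] 3 by simp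
next
  case (4 gs ys f)
  have "list_all2 (\<lambda>g v. recf_eval g xs v) gs ys" using 4(2) by (rule list_all2_mono) (rule assms(1))
  then show ?thesis unfolding 4(1) by (rule recf_eval.intros(4)) (rule assms(1)[OF 4(3)])
next
  case (7 f)
  have "\<forall>i<y. \<exists>v. recf_eval f (i # xs) (Suc v)" using 7(3) assms(1) by blast
  then show ?thesis unfolding 7(1) by (rule recf_eval.intros(7)[OF assms(1)[OF 7(2)]])
next
  case (6 f g k l v)
  then show ?thesis using recf_eval.intros(6) assms(1) by blast
qed (use assms(1) in \<open>auto intro: recf_eval.intros(1,2,5)\<close>)

lemma eval_stage_sound: "eval_stage k r xs y \<Longrightarrow> recf_eval r xs y"
proof (induction k arbitrary: r xs y)
  case (Suc k)
  then show ?case using eval_step_sound[of "eval_stage k" r xs y] by simp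
qed simp

text \<open>Every clause has finitely many premises for given arguments, also composition and
  minimisation, so the maximum of their stages works.\<close>

lemma eval_stage_complete: "recf_eval r xs y \<Longrightarrow> \<exists>k. eval_stage k r xs y"
proof (induction rule: recf_eval.induct)
  case (1 xs)
  have "eval_stage 1 RZero xs 0" by (auto intro: eval_step.intros)
  then show ?case by blast
next
  case (2 x xs)
  have "eval_stage 1 RSucc (x # xs) (Suc x)" by (auto intro: eval_step.intros)
  then show ?case by blast
next
  case (3 i xs)
  then have "drop i xs = xs ! i # drop (Suc i) xs" by (simp add: Cons_nth_drop_Suc)
  then have "eval_stage 1 (RProj i) xs (xs ! i)" by (auto intro: eval_step.intros)
  then show ?case by blast
next
  case (4 xs gs ys f z)
  from 4(1) have "\<exists>k. list_all2 (\<lambda>g v. eval_stage k g xs v) gs ys"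
  proof (induction rule: list_all2_induct)
    case (Cons g gs y ys)
    then obtain k j where kj: "eval_stage j g xs y" "list_all2 (\<lambda>g v. eval_stage k g xs v) gs ys" by blast
    have "list_all2 (\<lambda>g v. eval_stage (max j k) g xs v) gs ys"
      using kj(2) by (rule list_all2_mono) (auto intro: eval_stage_mono)
    moreover have "eval_stage (max j k) g xs y" using kj(1) by (rule eval_stage_mono) simp
    ultimately show ?case by auto
  qed simp
  then obtain k j where kj: "list_all2 (\<lambda>g v. eval_stage k g xs v) gs ys" "eval_stage j f ys z"
    using 4(2) by blast
  have "list_all2 (\<lambda>g v. eval_stage (max j k) g xs v) gs ys"
    using kj(1) by (rule list_all2_mono) (auto intro: eval_stage_mono)
  moreover have "eval_stage (max j k) f ys z" using kj(2) by (rule eval_stage_mono) simp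
  ultimately have "eval_stage (Suc (max j k)) (RComp f gs) xs z"
    by (auto intro: eval_step.intros)
  then show ?case by blast
next
  case (5 f xs y g)
  then obtain k where "eval_stage k f xs y" by blast
  then have "eval_stage (Suc k) (RPrim f g) (0 # xs) y" by (auto intro: eval_step.intros)
  then show ?case by blast
next
  case (6 f g k xs y z)
  then obtain a b where "eval_stage a (RPrim f g) (k # xs) y" "eval_stage b g (k # y # xs) z" by blast
  then have "eval_stage (max a b) (RPrim f g) (k # xs) y" "eval_stage (max a b) g (k # y # xs) z"
    by (auto intro: eval_stage_mono)
  then have "eval_stage (Suc (max a b)) (RPrim f g) (Suc k # xs) z" by (auto intro: eval_step.intros)
  then show ?case by blast
next
  case (7 f k xs)
  then obtain a where a: "eval_stage a f (k # xs) 0" by blast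
  have "\<forall>i<k. \<exists>y b. eval_stage b f (i # xs) (Suc y)" using 7 by blast
  then have "\<exists>b. \<forall>i<k. \<exists>y. eval_stage b f (i # xs) (Suc y)"
  proof (induction k)
    case (Suc k)
    then obtain b where b: "\<forall>i<k. \<exists>y. eval_stage b f (i # xs) (Suc y)" by auto
    obtain c y where c: "eval_stage c f (k # xs) (Suc y)" using Suc.prems by blast
    have "\<exists>y. eval_stage (max b c) f (i # xs) (Suc y)" if "i < Suc k" for i
    proof (cases "i = k")
      case True
      then show ?thesis using eval_stage_mono[OF c, of "max b c"] by auto
    next
      case False
      with that have "i < k" by simp
      with b obtain y where "eval_stage b f (i # xs) (Suc y)" by blast
      then show ?thesis using eval_stage_mono[of b f "i # xs" "Suc y" "max b c"] by auto
    qed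
    then show ?case by blast
  qed simp
  then obtain b where b: "\<And>i. i < k \<Longrightarrow> \<exists>y. eval_stage b f (i # xs) (Suc y)" by blast
  have "\<exists>y. eval_stage (max a b) f (i # xs) (Suc y)" if "i < k" for i
    using b[OF that] eval_stage_mono[of b f "i # xs" _ "max a b"] by auto
  moreover have "eval_stage (max a b) f (k # xs) 0" using a by (rule eval_stage_mono) simp
  ultimately have "eval_stage (Suc (max a b)) (RMu f) xs k" by (auto intro: eval_step.intros)
  then show ?case by blast
qed

lemma recf_eval_iff_stage: "recf_eval r xs y \<longleftrightarrow> (\<exists>k. eval_stage k r xs y)"
  using eval_stage_sound eval_stage_complete by blast

text \<open>The auxiliary function is the table of all stages; by induction on the stage, its
  clauses determine on which codes it has the value \<open>1\<close>.\<close>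

lemma D11_eval_stage: "D11 (\<lambda>z. eval_stage (fst z) (fst (snd z)) (fst (snd (snd z))) (snd (snd (snd z))))"
proof -
  define c where "c k r xs y = prod_encode (k, prod_encode (enc r, prod_encode (enc xs, y)))"
    for k :: nat and r :: recf and xs :: "nat list" and y :: nat
  have c_inj: "c k r xs y = c k' r' xs' y' \<longleftrightarrow> k = k' \<and> r = r' \<and> xs = xs' \<and> y = y'" for k r xs y k' r' xs' y'
    by (simp add: c_def prod_encode_eq)
  have dc: "D11f (\<lambda>x. c (k x) (r x) (xs x) (y x))" if "D11f k" "D11f r" "D11f xs" "D11f y" for k r xs and y :: "'a :: coded \<Rightarrow> nat"
    unfolding c_def by (intro D11f_intros that)
  let ?R = "\<lambda>(_ :: nat \<times> recf \<times> nat list \<times> nat) \<beta>.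
    (\<forall>r xs y. \<beta> (c 0 r xs y) = (0::nat)) \<and>
    (\<forall>k r xs y. (\<beta> (c (Suc k) r xs y) = 1) \<longleftrightarrow> eval_step (\<lambda>r xs y. \<beta> (c k r xs y) = 1) r xs y)"
  let ?T = "\<lambda>(z :: nat \<times> recf \<times> nat list \<times> nat) \<beta>. \<beta> (c (fst z) (fst (snd z)) (fst (snd (snd z))) (snd (snd (snd z)))) = (1::nat)"
  show ?thesis
  proof (rule D11_via)
    show "D11 (\<lambda>z. ?R (fst z) (snd z))"
      unfolding eval_step.simps list_all2_drop
      by (intro D11_intros D11_iff dc D11f_RProj D11f_RComp D11f_RPrim D11f_RMu D11f_drop D11f_intros)
    show "D11 (\<lambda>z. ?T (fst z) (snd z))"
      by (intro D11_intros dc D11f_intros)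
    show "\<exists>\<beta>. ?R z \<beta>" for z :: "nat \<times> recf \<times> nat list \<times> nat"
    proof
      define \<beta> where "\<beta> m = (if \<exists>k r xs y. m = c k r xs y \<and> eval_stage k r xs y then 1 else 0 :: nat)" for m
      have \<beta>: "\<beta> (c k r xs y) = (if eval_stage k r xs y then 1 else 0)" for k r xs y
        by (simp add: \<beta>_def c_inj)
      show "?R z \<beta>" by (simp add: \<beta>)
    qed
    fix z :: "nat \<times> recf \<times> nat list \<times> nat" and \<beta> assume R: "?R z \<beta>"
    have "(\<beta> (c k r xs y) = 1) \<longleftrightarrow> eval_stage k r xs y" for k r xs y
    proof (induction k arbitrary: r xs y)
      case 0
      then show ?case using R by simp
    next
      case (Suc k)
      then have "(\<lambda>r xs y. \<beta> (c k r xs y) = 1) = eval_stage k" by (simp add: fun_eq_iff)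
      then show ?case using R by simp
    qed
    then show "?T z \<beta> \<longleftrightarrow> eval_stage (fst z) (fst (snd z)) (fst (snd (snd z))) (snd (snd (snd z)))" by simp
  qed
qed

lemma D11_recf_eval:
  assumes "D11f r" "D11f xs" "D11f y"
  shows "D11 (\<lambda>x. recf_eval (r x) (xs x) (y x))"
proof -
  have st: "D11 (\<lambda>x. eval_stage (k x) (r x) (xs x) (y x))" if "D11f k" "D11f r" "D11f xs" "D11f y"
    for k r xs and y :: "'b :: coded \<Rightarrow> nat"
    using D11_subst[OF D11_eval_stage D11f_pair[OF that(1) D11f_pair[OF that(2) D11f_pair[OF that(3,4)]]]] by simp
  show ?thesis unfolding recf_eval_iff_stage
    by (intro D11_ex st D11f_comp[OF assms(1)] D11f_comp[OF assms(2)] D11f_comp[OF assms(3)] D11f_intros)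
qed

lemma recf_eval_deterministic: "recf_eval r xs y \<Longrightarrow> recf_eval r xs z \<Longrightarrow> y = z"
proof (induction arbitrary: z rule: recf_eval.induct)
  case (4 xs gs ys f v)
  from 4(4) obtain us where us: "list_all2 (\<lambda>g y. recf_eval g xs y) gs us" "recf_eval f us z"
    by (cases rule: recf_eval.cases) auto
  have l: "length gs = length ys" and y: "\<And>i z. i < length gs \<Longrightarrow> recf_eval (gs ! i) xs z \<Longrightarrow> ys ! i = z"
    using 4(1) unfolding list_all2_conv_all_nth by auto
  have u: "length gs = length us" "\<And>i. i < length gs \<Longrightarrow> recf_eval (gs ! i) xs (us ! i)"
    using us(1) unfolding list_all2_conv_all_nth by auto
  have "ys = us"
    by (rule nth_equalityI) (use l u y in auto)
  with us 4(2) show ?case by blast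
next
  case (7 f k xs)
  from 7(4) have z: "recf_eval f (z # xs) 0" "\<forall>i<z. \<exists>y. recf_eval f (i # xs) (Suc y)"
    by (cases rule: recf_eval.cases; simp)+
  show ?case
  proof (rule ccontr)
    assume "k \<noteq> z"
    then consider "z < k" | "k < z" by linarith
    then show False
    proof cases
      case 1
      then show False using 7(1-3) z(1) by fastforce
    next
      case 2
      then obtain y where "recf_eval f (k # xs) (Suc y)" using z(2) by blast
      then show False using 7(1-3) by fastforce
    qed
  qed
next
  case (6 f g k xs y v)
  from 6(5) obtain u where "recf_eval (RPrim f g) (k # xs) u" "recf_eval g (k # u # xs) z"
    by (cases rule: recf_eval.cases) auto
  with 6 show ?case by metis
qed (erule recf_eval.cases; auto)+

section \<open>Total programs and computable functions\<close>

definition total_prog :: "recf \<Rightarrow> bool" where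
  "total_prog r \<longleftrightarrow> (\<forall>x. \<exists>y. recf_eval r [x] y)"

definition run :: "recf \<Rightarrow> nat \<Rightarrow> nat" where
  "run r x = (LEAST y. recf_eval r [x] y)"

lemma run_eval: "total_prog r \<Longrightarrow> recf_eval r [x] (run r x)"
  unfolding total_prog_def run_def by (metis LeastI)

lemma computable_run: "total_prog r \<Longrightarrow> computable (run r)"
  unfolding computable_def using run_eval by blast

lemma computable_iff_run: "computable f \<longleftrightarrow> (\<exists>r. total_prog r \<and> run r = f)"
proof
  assume "computable f"
  then obtain r where r: "\<And>x. recf_eval r [x] (f x)" unfolding computable_def by blast
  then have "total_prog r" unfolding total_prog_def by blast
  moreover have "run r = f"
    using run_eval[OF \<open>total_prog r\<close>] r recf_eval_deterministic by (intro ext) blast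
  ultimately show "\<exists>r. total_prog r \<and> run r = f" by blast
qed (use computable_run in blast)

lemma D11_total_prog: "D11f r \<Longrightarrow> D11 (\<lambda>x. total_prog (r x))"
  unfolding total_prog_def by (rule D11_subst[of "\<lambda>r. \<forall>x. \<exists>y. recf_eval r [x] y"], intro D11_intros D11_recf_eval D11f_intros)

lemma D11f_run:
  assumes "D11f r" "D11f x"
  shows "D11f (\<lambda>z. run (r z) (x z))"
  unfolding run_def
  by (intro D11f_Least D11_recf_eval D11f_comp[OF assms(1)] D11f_comp[OF assms(2)] D11f_intros)

text \<open>A \<open>k\<close>-ary function is written as a function of an environment whose
  entries beyond the arguments are zero.\<close>

definition arg_env :: "nat list \<Rightarrow> nat \<Rightarrow> nat" where
  "arg_env xs i = (if i < length xs then xs ! i else 0)"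

lemma arg_env_Cons: "arg_env (x # xs) = case_nat x (arg_env xs)"
  by (auto simp: arg_env_def fun_eq_iff split: nat.splits)

definition comp_fn :: "nat \<Rightarrow> (baire \<Rightarrow> nat) \<Rightarrow> bool" where
  "comp_fn k f \<longleftrightarrow> (\<exists>r. \<forall>xs. length xs = k \<longrightarrow> recf_eval r xs (f (arg_env xs)))"

lemma comp_fn_const: "comp_fn k (\<lambda>_. c)"
proof (induction c)
  case 0
  then show ?case unfolding comp_fn_def using recf_eval.intros(1) by blast
next
  case (Suc c)
  then obtain r where r: "\<And>xs. length xs = k \<Longrightarrow> recf_eval r xs c" unfolding comp_fn_def by blast
  have "recf_eval (RComp RSucc [r]) xs (Suc c)" if "length xs = k" for xs
    by (rule recf_eval.intros(4)[of _ _ "[c]"]) (auto simp: r that intro: recf_eval.intros(2))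
  then show ?case unfolding comp_fn_def by blast
qed

lemma comp_fn_var: "comp_fn k (\<lambda>e. e i)"
proof (cases "i < k")
  case True
  then have "recf_eval (RProj i) xs (arg_env xs i)" if "length xs = k" for xs
    using recf_eval.intros(3)[of i xs] that by (simp add: arg_env_def)
  then show ?thesis unfolding comp_fn_def by blast
next
  case False
  then have "recf_eval RZero xs (arg_env xs i)" if "length xs = k" for xs
    using recf_eval.intros(1)[of xs] that by (simp add: arg_env_def)
  then show ?thesis unfolding comp_fn_def by blast
qed

lemma comp_fn_comp1:
  assumes "computable h" "comp_fn k f"
  shows "comp_fn k (\<lambda>e. h (f e))"
proof -
  obtain s r where s: "\<And>x. recf_eval s [x] (h x)" and r: "\<And>xs. length xs = k \<Longrightarrow> recf_eval r xs (f (arg_env xs))"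
    using assms unfolding comp_fn_def computable_def by blast
  have "recf_eval (RComp s [r]) xs (h (f (arg_env xs)))" if "length xs = k" for xs
    by (rule recf_eval.intros(4)[of _ _ "[f (arg_env xs)]"]) (auto simp: r that s)
  then show ?thesis unfolding comp_fn_def by blast
qed

lemma computable_Suc: "computable Suc"
  unfolding computable_def using recf_eval.intros(2) by blast

lemmas comp_fn_Suc = comp_fn_comp1[OF computable_Suc]

lemma computable_iff_comp_fn: "computable h \<longleftrightarrow> comp_fn (Suc 0) (\<lambda>e. h (e 0))"
proof
  assume "computable h"
  then show "comp_fn (Suc 0) (\<lambda>e. h (e 0))" by (rule comp_fn_comp1[OF _ comp_fn_var])
next
  assume "comp_fn (Suc 0) (\<lambda>e. h (e 0))"
  then obtain r where r: "\<And>xs. length xs = Suc 0 \<Longrightarrow> recf_eval r xs (h (arg_env xs 0))" unfolding comp_fn_def by blast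
  have "recf_eval r [x] (h x)" for x using r[of "[x]"] by (simp add: arg_env_def)
  then show "computable h" unfolding computable_def by blast
qed

lemma comp_fn_rec:
  assumes "comp_fn k a" "comp_fn (Suc (Suc k)) (\<lambda>e. g (e 0) (e 1) (\<lambda>i. e (Suc (Suc i))))" "comp_fn k n"
  shows "comp_fn k (\<lambda>e. rec_nat (a e) (\<lambda>i v. g i v e) (n e))"
proof -
  obtain ra rg rn where ra: "\<And>xs. length xs = k \<Longrightarrow> recf_eval ra xs (a (arg_env xs))"
    and rg: "\<And>xs. length xs = Suc (Suc k) \<Longrightarrow> recf_eval rg xs (g (arg_env xs 0) (arg_env xs 1) (\<lambda>i. arg_env xs (Suc (Suc i))))"
    and rn: "\<And>xs. length xs = k \<Longrightarrow> recf_eval rn xs (n (arg_env xs))"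
    using assms unfolding comp_fn_def by blast
  let ?r = "RComp (RPrim ra rg) (rn # map RProj [0..<k])"
  have "recf_eval ?r xs (rec_nat (a (arg_env xs)) (\<lambda>i v. g i v (arg_env xs)) (n (arg_env xs)))" if l: "length xs = k" for xs
  proof -
    let ?e = "arg_env xs"
    have prim: "recf_eval (RPrim ra rg) (m # xs) (rec_nat (a ?e) (\<lambda>i v. g i v ?e) m)" for m
    proof (induction m)
      case 0
      then show ?case using recf_eval.intros(5)[OF ra[OF l]] by simp
    next
      case (Suc m)
      let ?v = "rec_nat (a ?e) (\<lambda>i v. g i v ?e) m"
      have "recf_eval rg (m # ?v # xs) (g m ?v ?e)"
        using rg[of "m # ?v # xs"] l by (simp add: arg_env_Cons)
      from recf_eval.intros(6)[OF Suc this] show ?case by simp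
    qed
    have "list_all2 (\<lambda>g y. recf_eval g xs y) (map RProj [0..<k]) xs"
      unfolding list_all2_conv_all_nth using l recf_eval.intros(3) by simp
    then have "list_all2 (\<lambda>g y. recf_eval g xs y) (rn # map RProj [0..<k]) (n ?e # xs)"
      using rn[OF l] by simp
    then show ?thesis using prim by (rule recf_eval.intros(4))
  qed
  then show ?thesis unfolding comp_fn_def by blast
qed

text \<open>Truth is \<open>0\<close>, the value that \<open>RMu\<close> searches for and the base
  case of a recursion.\<close>

definition comp_pred :: "nat \<Rightarrow> (baire \<Rightarrow> bool) \<Rightarrow> bool" where
  "comp_pred k P \<longleftrightarrow> comp_fn k (\<lambda>e. if P e then 0 else Suc 0)"

text \<open>Branching is a recursion on the truth value, at most one step long, whose step discards
  the two extra arguments.\<close>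

lemma comp_fn_if:
  assumes "comp_pred k P" "comp_fn k f" "comp_fn k g"
  shows "comp_fn k (\<lambda>e. if P e then f e else g e)"
proof -
  have "comp_fn k (\<lambda>e. rec_nat (f e) (\<lambda>i v. g e) (if P e then 0 else Suc 0))"
  proof (rule comp_fn_rec[OF assms(2) _ assms(1)[unfolded comp_pred_def]])
    obtain r where r: "\<And>xs. length xs = k \<Longrightarrow> recf_eval r xs (g (arg_env xs))"
      using assms(3) unfolding comp_fn_def by blast
    have "recf_eval (RComp r (map (\<lambda>i. RProj (Suc (Suc i))) [0..<k])) xs (g (\<lambda>i. arg_env xs (Suc (Suc i))))" if l: "length xs = Suc (Suc k)" for xs
    proof -
      have "list_all2 (\<lambda>g y. recf_eval g xs y) (map (\<lambda>i. RProj (Suc (Suc i))) [0..<k]) (drop 2 xs)"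
        unfolding list_all2_conv_all_nth using l recf_eval.intros(3)[of _ xs] by simp
      moreover have "arg_env (drop 2 xs) = (\<lambda>i. arg_env xs (Suc (Suc i)))"
        using l by (auto simp: arg_env_def fun_eq_iff)
      ultimately show ?thesis using r[of "drop 2 xs"] l by (auto intro: recf_eval.intros(4))
    qed
    then show "comp_fn (Suc (Suc k)) (\<lambda>e. g (\<lambda>i. e (Suc (Suc i))))" unfolding comp_fn_def by blast
  qed
  moreover have "rec_nat (f e) (\<lambda>i v. g e) (if P e then 0 else Suc 0) = (if P e then f e else g e)" for e
    by simp
  ultimately show ?thesis by simp
qed

lemma comp_fn_Least:
  assumes "comp_pred (Suc k) (\<lambda>e. P (e 0) (\<lambda>i. e (Suc i)))" "\<And>e. \<exists>y. P y e"
  shows "comp_fn k (\<lambda>e. LEAST y. P y e)"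
proof -
  obtain r where r: "\<And>xs. length xs = Suc k \<Longrightarrow>
      recf_eval r xs (if P (arg_env xs 0) (\<lambda>i. arg_env xs (Suc i)) then 0 else Suc 0)"
    using assms(1) unfolding comp_fn_def comp_pred_def by blast
  have "recf_eval (RMu r) xs (LEAST y. P y (arg_env xs))" if l: "length xs = k" for xs
  proof -
    let ?e = "arg_env xs"
    have *: "recf_eval r (y # xs) (if P y ?e then 0 else Suc 0)" for y
      using r[of "y # xs"] l by (simp add: arg_env_Cons)
    have "P (LEAST y. P y ?e) ?e" using assms(2) by (metis LeastI)
    then have "recf_eval r ((LEAST y. P y ?e) # xs) 0" using *[of "LEAST y. P y ?e"] by simp
    moreover have "\<forall>i<(LEAST y. P y ?e). \<exists>y. recf_eval r (i # xs) (Suc y)"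
    proof (intro allI impI)
      fix i assume "i < (LEAST y. P y ?e)"
      then have "\<not> P i ?e" by (rule not_less_Least)
      then show "\<exists>y. recf_eval r (i # xs) (Suc y)" using *[of i] by auto
    qed
    ultimately show ?thesis by (rule recf_eval.intros(7))
  qed
  then show ?thesis unfolding comp_fn_def by blast
qed

lemma comp_fn_pred: "comp_fn k f \<Longrightarrow> comp_fn k (\<lambda>e. f e - 1)"
proof -
  assume f: "comp_fn k f"
  have "comp_fn k (\<lambda>e. rec_nat 0 (\<lambda>i v. i) (f e))" by (rule comp_fn_rec[OF comp_fn_const _ f]) (rule comp_fn_var)
  moreover have "rec_nat 0 (\<lambda>i v. i) m = m - 1" for m by (cases m) auto
  ultimately show ?thesis by simp
qed

lemma comp_fn_diff: "comp_fn k f \<Longrightarrow> comp_fn k g \<Longrightarrow> comp_fn k (\<lambda>e. f e - g e)"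
proof -
  assume fg: "comp_fn k f" "comp_fn k g"
  have "comp_fn k (\<lambda>e. rec_nat (f e) (\<lambda>i v. v - 1) (g e))" by (rule comp_fn_rec[OF fg(1) _ fg(2)]) (intro comp_fn_pred comp_fn_var)
  moreover have "rec_nat a (\<lambda>i v. v - 1) m = a - m" for a m by (induction m) auto
  ultimately show ?thesis by simp
qed

lemma comp_fn_add: "comp_fn k f \<Longrightarrow> comp_fn k g \<Longrightarrow> comp_fn k (\<lambda>e. f e + g e)"
proof -
  assume fg: "comp_fn k f" "comp_fn k g"
  have "comp_fn k (\<lambda>e. rec_nat (f e) (\<lambda>i v. Suc v) (g e))" by (rule comp_fn_rec[OF fg(1) _ fg(2)]) (intro comp_fn_Suc comp_fn_var)
  moreover have "rec_nat a (\<lambda>i v. Suc v) m = a + m" for a m by (induction m) auto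
  ultimately show ?thesis by simp
qed

lemma comp_pred_le: "comp_fn k f \<Longrightarrow> comp_fn k g \<Longrightarrow> comp_pred k (\<lambda>e. f e \<le> g e)"
proof -
  assume fg: "comp_fn k f" "comp_fn k g"
  have "comp_fn k (\<lambda>e. Suc 0 - (Suc 0 - (f e - g e)))" by (intro comp_fn_diff comp_fn_const fg)
  moreover have "Suc 0 - (Suc 0 - (a - b)) = (if a \<le> b then 0 else Suc 0)" for a b by auto
  ultimately show ?thesis unfolding comp_pred_def by simp
qed

lemma comp_pred_not: "comp_pred k P \<Longrightarrow> comp_pred k (\<lambda>e. \<not> P e)"
proof -
  assume P: "comp_pred k P"
  have "comp_fn k (\<lambda>e. if P e then Suc 0 else 0)" by (intro comp_fn_if[OF P] comp_fn_const)
  moreover have "(if P e then Suc 0 else 0) = (if \<not> P e then 0 else Suc 0)" for e by simp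
  ultimately show ?thesis unfolding comp_pred_def by simp
qed

lemma comp_pred_conj: "comp_pred k P \<Longrightarrow> comp_pred k Q \<Longrightarrow> comp_pred k (\<lambda>e. P e \<and> Q e)"
proof -
  assume PQ: "comp_pred k P" "comp_pred k Q"
  have "comp_fn k (\<lambda>e. if P e then (if Q e then 0 else Suc 0) else Suc 0)"
    using PQ(2) unfolding comp_pred_def by (intro comp_fn_if[OF PQ(1)] comp_fn_const)
  moreover have "(if P e then (if Q e then 0 else Suc 0) else Suc 0) = (if P e \<and> Q e then 0 else Suc 0)" for e by simp
  ultimately show ?thesis unfolding comp_pred_def by simp
qed

lemma comp_pred_disj: "comp_pred k P \<Longrightarrow> comp_pred k Q \<Longrightarrow> comp_pred k (\<lambda>e. P e \<or> Q e)"
  using comp_pred_not[OF comp_pred_conj[OF comp_pred_not comp_pred_not, of k P Q]] by simp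

lemma comp_pred_less: "comp_fn k f \<Longrightarrow> comp_fn k g \<Longrightarrow> comp_pred k (\<lambda>e. f e < g e)"
  unfolding not_le[symmetric] by (intro comp_pred_not comp_pred_le)

lemma comp_pred_eq: "comp_fn k f \<Longrightarrow> comp_fn k g \<Longrightarrow> comp_pred k (\<lambda>e. f e = (g e :: nat))"
  unfolding eq_iff by (intro comp_pred_conj comp_pred_le)

lemma comp_fn_half: "comp_fn k f \<Longrightarrow> comp_fn k (\<lambda>e. f e div 2)"
proof -
  assume f: "comp_fn k f"
  have "computable (\<lambda>x. x div 2)" unfolding computable_iff_comp_fn
  proof -
    have "comp_fn (Suc 0) (\<lambda>e. LEAST h. e 0 \<le> Suc (h + h))"
      by (rule comp_fn_Least[where P = "\<lambda>h e. e 0 \<le> Suc (h + h)"])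
        (intro comp_pred_le comp_fn_Suc comp_fn_add comp_fn_var, metis le_Suc_eq le_add1)
    moreover have "(LEAST h. x \<le> Suc (h + h)) = x div 2" for x :: nat
      by (rule Least_equality) auto
    ultimately show "comp_fn (Suc 0) (\<lambda>e. e 0 div 2)" by simp
  qed
  then show ?thesis using f by (rule comp_fn_comp1)
qed

lemma comp_pred_even: "comp_fn k f \<Longrightarrow> comp_pred k (\<lambda>e. even (f e))"
proof -
  assume f: "comp_fn k f"
  have "comp_pred k (\<lambda>e. f e = f e div 2 + f e div 2)" by (intro comp_pred_eq comp_fn_add comp_fn_half f)
  moreover have "(m = m div 2 + m div 2) = even m" for m :: nat by presburger
  ultimately show ?thesis by simp
qed

lemmas comp_pred_intros = comp_pred_conj comp_pred_disj comp_pred_not comp_pred_le comp_pred_less comp_pred_eq comp_pred_even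

lemma computable_almost_equal:
  assumes "computable f" "finite {x. g x \<noteq> f x}"
  shows "computable g"
proof -
  have "finite X \<Longrightarrow> {x. g x \<noteq> f x} = X \<Longrightarrow> computable g" for X g
  proof (induction X arbitrary: g rule: finite_induct)
    case empty
    then have "g = f" by auto
    with assms(1) show ?case by simp
  next
    case (insert a X)
    have "{x. (g(a := f a)) x \<noteq> f x} = X" using insert.hyps insert.prems by auto
    then have c: "computable (g(a := f a))" by (rule insert.IH)
    have "comp_fn (Suc 0) (\<lambda>e. if e 0 = a then g a else (g(a := f a)) (e 0))"
      by (intro comp_fn_if comp_pred_eq comp_fn_var comp_fn_const comp_fn_comp1[OF c])
    moreover have "(\<lambda>e. if e 0 = a then g a else (g(a := f a)) (e 0)) = (\<lambda>e. g (e (0::nat)))" by auto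
    ultimately show ?case unfolding computable_iff_comp_fn by simp
  qed
  with assms(2) show ?thesis by blast
qed

text \<open>An infinite computably enumerable set has an infinite computable subset: enumerate an
  increasing sequence of members, whose range is decidable.\<close>

lemma infinite_computable_subset:
  assumes f: "computable f" and g: "computable g" and inf: "infinite {w. g w > 0 \<and> (\<exists>t. f t = Suc (2 * w))}"
  shows "\<exists>h. computable h \<and> infinite {x. h x > 0} \<and> {x. h x > 0} \<subseteq> {w. g w > 0 \<and> (\<exists>t. f t = Suc (2 * w))}"
proof -
  let ?A = "{w. g w > 0 \<and> (\<exists>t. f t = Suc (2 * w))}"
  let ?w = "\<lambda>t. f t div 2"
  let ?Q = "\<lambda>t. odd (f t) \<and> g (?w t) > 0"
  have big: "\<exists>t. ?Q t \<and> v < ?w t" for v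
  proof -
    obtain w where w: "w > v" "w \<in> ?A" using inf unfolding infinite_nat_iff_unbounded by blast
    then obtain t where t: "f t = Suc (2 * w)" by blast
    then show ?thesis using w by (intro exI[of _ t]) auto
  qed
  \<comment> \<open>The sequence \<open>s\<close> consists of arguments \<open>t\<close> at which
    the listed number \<open>?w t\<close> exceeds the previous one.\<close>
  let ?next = "\<lambda>v. LEAST t. ?Q t \<and> ?w v < ?w t"
  define s where "s k = rec_nat (LEAST t. ?Q t) (\<lambda>_ v. ?next v) k" for k
  have s0: "?Q (s 0)" unfolding s_def using big by (simp, metis (mono_tags, lifting) LeastI_ex)
  have sSuc: "?Q (s (Suc k)) \<and> ?w (s k) < ?w (s (Suc k))" for k
    unfolding s_def using LeastI_ex[OF big] by simp
  have Qs: "?Q (s k)" for k using s0 sSuc by (cases k) blast+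
  have mono: "strict_mono (\<lambda>k. ?w (s k))" using sSuc by (simp add: strict_mono_Suc_iff)
  have ge: "k \<le> ?w (s k)" for k using mono by (rule strict_mono_imp_increasing)
  have nxt: "computable ?next" unfolding computable_iff_comp_fn
    by (rule comp_fn_Least[where P = "\<lambda>t e. ?Q t \<and> ?w (e 0) < ?w t"],
        intro comp_pred_intros comp_fn_comp1[OF f] comp_fn_comp1[OF g] comp_fn_half comp_fn_const comp_fn_var, rule big)
  have "comp_fn (Suc 0) (\<lambda>e. rec_nat (LEAST t. ?Q t) (\<lambda>i v. ?next v) (e 0))"
    by (rule comp_fn_rec[OF comp_fn_const _ comp_fn_var], rule comp_fn_comp1[OF nxt], rule comp_fn_var)
  then have s: "computable s" unfolding computable_iff_comp_fn s_def .
  \<comment> \<open>The listed numbers increase, so \<open>x\<close> is among them iff the first one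
    that is at least \<open>x\<close> equals \<open>x\<close>.\<close>
  define h where "h x = (if ?w (s (LEAST k. x \<le> ?w (s k))) = x then Suc 0 else 0)" for x
  have "comp_fn (Suc 0) (\<lambda>e. LEAST k. e 0 \<le> ?w (s k))"
    by (rule comp_fn_Least[where P = "\<lambda>k e. e 0 \<le> ?w (s k)"],
       intro comp_pred_intros comp_fn_half comp_fn_comp1[OF f] comp_fn_comp1[OF s] comp_fn_var, use ge in blast)
  then have "computable h" unfolding computable_iff_comp_fn h_def
    by (intro comp_fn_if comp_pred_intros comp_fn_half comp_fn_comp1[OF f] comp_fn_comp1[OF s] comp_fn_var comp_fn_const)
  moreover have hx: "h x > 0 \<longleftrightarrow> (\<exists>k. ?w (s k) = x)" for x
  proof
    assume "\<exists>k. ?w (s k) = x"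
    then obtain k where k: "?w (s k) = x" by blast
    have "(LEAST k. x \<le> ?w (s k)) = k"
      using k strict_mono_less_eq[OF mono] by (intro Least_equality) auto
    with k show "h x > 0" by (simp add: h_def)
  qed (auto simp: h_def split: if_splits)
  moreover have "infinite {x. h x > 0}"
    unfolding infinite_nat_iff_unbounded_le hx using ge by blast
  moreover have "{x. h x > 0} \<subseteq> ?A"
  proof
    fix x assume "x \<in> {x. h x > 0}"
    then obtain k where k: "?w (s k) = x" using hx by auto
    then have "f (s k) = Suc (2 * x)" "g x > 0" using Qs[of k] by (auto elim!: oddE)
    then show "x \<in> ?A" by blast
  qed
  ultimately show ?thesis by blast
qed

abbreviation prog :: "nat \<Rightarrow> recf" where
  "prog e \<equiv> inv enc e"

section \<open>The minimal cover\<close>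

text \<open>Programs \<open>r\<close> stand for the computable sets of all \<open>w\<close> with \<open>0 < run r w\<close>, and \<open>p\<close> for the set
  of all \<open>w\<close> such that \<open>2w + 1\<close> is a value of \<open>run p\<close>: these are the indices of the second summand of
  a join that a reduction with program \<open>p\<close> uses.\<close>

definition thinner :: "recf \<Rightarrow> recf \<Rightarrow> recf \<Rightarrow> bool" where
  "thinner p r q \<longleftrightarrow> total_prog q \<and> (\<forall>n. \<exists>w. n < w \<and> 0 < run q w) \<and>
     (\<forall>w. 0 < run q w \<longrightarrow> 0 < run r w \<and> (\<exists>t. run p t = Suc (2 * w)))"

text \<open>The program is selected by \<open>LEAST\<close> and not by arbitrary choice, which keeps
  the sequence of thinned sets \<Delta>^1_1.\<close>

definition narrow :: "recf \<Rightarrow> recf \<Rightarrow> recf" where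
  "narrow p r = (if total_prog p \<and> (\<forall>n. \<exists>w. n < w \<and> 0 < run r w \<and> (\<exists>t. run p t = Suc (2 * w)))
     then prog (LEAST j. thinner p r (prog j)) else r)"

primrec thin :: "nat \<Rightarrow> recf" where
  "thin 0 = (SOME r. total_prog r \<and> run r = (\<lambda>_. 1))"
| "thin (Suc e) = narrow (prog e) (thin e)"

text \<open>\<open>pick 0\<close> is only a starting bound; the numbers \<open>m\<^sub>e\<close> of
  the construction are \<open>pick (Suc e)\<close>.\<close>

primrec pick :: "nat \<Rightarrow> nat" where
  "pick 0 = 0"
| "pick (Suc e) = (LEAST x. pick e < x \<and> 0 < run (thin (Suc e)) x)"

text \<open>Totality, infinitude and membership in a range are number-quantifier questions about
  evaluation, hence \<Delta>^1_1, and such conditions may govern a recursion.\<close>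

lemma D11f_thin: "D11f k \<Longrightarrow> D11f (\<lambda>x. thin (k x))"
proof -
  have "D11f (\<lambda>z. narrow (fst z) (snd z))"
    unfolding narrow_def thinner_def
    by (intro D11f_if D11f_inv_enc D11f_Least D11_intros D11_total_prog D11f_run D11f_intros)
  then have n: "D11f (\<lambda>x. narrow (p x) (r x))" if "D11f p" "D11f r" for p and r :: "'b :: coded \<Rightarrow> recf"
    using D11f_comp[OF _ D11f_pair[OF that]] by fastforce
  assume k: "D11f k"
  have "thin m = rec_nat (thin 0) (\<lambda>e r. narrow (prog e) r) m" for m by (induction m) auto
  moreover have "D11f (\<lambda>x. rec_nat (thin 0) (\<lambda>e r. narrow (prog e) r) (k x))"
    by (intro D11f_rec_nat n D11f_inv_enc D11f_intros k)
  ultimately show ?thesis by simp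
qed

lemma D11f_pick: "D11f k \<Longrightarrow> D11f (\<lambda>x. pick (k x))"
proof -
  assume k: "D11f k"
  have "pick m = rec_nat 0 (\<lambda>e v. LEAST x. v < x \<and> 0 < run (thin (Suc e)) x) m" for m by (induction m) auto
  moreover have "D11f (\<lambda>x. rec_nat 0 (\<lambda>e v. LEAST x. v < x \<and> 0 < run (thin (Suc e)) x) (k x))"
    by (intro D11f_rec_nat D11f_Least D11_intros D11f_run D11f_thin D11f_intros k)
  ultimately show ?thesis by simp
qed

lemma infinite_run_iff: "infinite {w. P w} \<longleftrightarrow> (\<forall>n. \<exists>w. n < w \<and> P w)" for P :: "nat \<Rightarrow> bool"
  unfolding infinite_nat_iff_unbounded by simp

lemma thinner_narrow:
  assumes "total_prog r" "total_prog p" "\<forall>n. \<exists>w. n < w \<and> 0 < run r w \<and> (\<exists>t. run p t = Suc (2 * w))"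
  shows "thinner p r (narrow p r)"
proof -
  have "infinite {w. 0 < run r w \<and> (\<exists>t. run p t = Suc (2 * w))}"
    unfolding infinite_run_iff by (rule assms(3))
  from infinite_computable_subset[OF computable_run[OF assms(2)] computable_run[OF assms(1)] this]
  obtain h where h: "computable h" "infinite {x. h x > 0}"
    "{x. h x > 0} \<subseteq> {w. 0 < run r w \<and> (\<exists>t. run p t = Suc (2 * w))}" by blast
  obtain q where q: "total_prog q" "run q = h" using h(1) unfolding computable_iff_run by blast
  have "thinner p r q" unfolding thinner_def using q h by (auto simp: infinite_run_iff)
  then have "thinner p r (prog (enc q))" by simp
  then have "thinner p r (prog (LEAST j. thinner p r (prog j)))" by (rule LeastI)
  then show ?thesis using assms unfolding narrow_def by simp
qed

lemma thin_0: "total_prog (thin 0)" "run (thin 0) = (\<lambda>_. 1)"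
proof -
  have "computable (\<lambda>_. 1)" unfolding computable_iff_comp_fn by (rule comp_fn_const)
  then have "\<exists>r. total_prog r \<and> run r = (\<lambda>_. 1)" unfolding computable_iff_run .
  from someI_ex[OF this] show "total_prog (thin 0)" "run (thin 0) = (\<lambda>_. 1)" by simp_all
qed

lemma thin_total_infinite: "total_prog (thin e) \<and> (\<forall>n. \<exists>w. n < w \<and> 0 < run (thin e) w)"
proof (induction e)
  case 0
  then show ?case using thin_0 by (auto simp del: thin.simps)
next
  case (Suc e)
  show ?case
  proof (cases "total_prog (prog e) \<and> (\<forall>n. \<exists>w. n < w \<and> 0 < run (thin e) w \<and> (\<exists>t. run (prog e) t = Suc (2 * w)))")
    case True
    then show ?thesis using thinner_narrow[of "thin e" "prog e"] Suc by (simp add: thinner_def)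
  next
    case False
    then have "thin (Suc e) = thin e" unfolding thin.simps narrow_def by (simp only: if_False)
    with Suc show ?thesis by simp
  qed
qed

lemma thin_Suc_subset: "0 < run (thin (Suc e)) w \<Longrightarrow> 0 < run (thin e) w"
proof (cases "total_prog (prog e) \<and> (\<forall>n. \<exists>w. n < w \<and> 0 < run (thin e) w \<and> (\<exists>t. run (prog e) t = Suc (2 * w)))")
  case True
  assume "0 < run (thin (Suc e)) w"
  then show ?thesis using True thinner_narrow[of "thin e" "prog e"] thin_total_infinite[of e] by (simp add: thinner_def)
next
  case False
  assume "0 < run (thin (Suc e)) w"
  moreover have "thin (Suc e) = thin e" using False unfolding thin.simps narrow_def by (simp only: if_False)
  ultimately show ?thesis by simp
qed

lemma thin_antimono: "d \<le> e \<Longrightarrow> 0 < run (thin e) w \<Longrightarrow> 0 < run (thin d) w"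
proof (induction e)
  case (Suc e)
  then show ?case using thin_Suc_subset[of e w] by (auto simp: le_Suc_eq simp del: thin.simps)
qed simp

lemma pick_Suc: "pick e < pick (Suc e)" "0 < run (thin (Suc e)) (pick (Suc e))"
proof -
  have "\<exists>x. pick e < x \<and> 0 < run (thin (Suc e)) x" using thin_total_infinite[of "Suc e"] by blast
  from LeastI_ex[OF this] show "pick e < pick (Suc e)" "0 < run (thin (Suc e)) (pick (Suc e))"
    by (simp_all del: thin.simps)
qed

declare thin.simps [simp del] pick.simps [simp del]

text \<open>Let \<open>d\<close> be an index of \<open>f\<close>. From \<open>e = d\<close> on,
  \<open>m e\<close> lies in \<open>thin (Suc d)\<close>. If stage \<open>d\<close> thinned inside
  the range, this set provides \<open>h\<close>; otherwise the range meets \<open>thin d\<close> in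
  a finite set only, and injectivity of \<open>m\<close> leaves finitely many
  \<open>e\<close>.\<close>

theorem cohesive_sequence:
  obtains m :: "nat \<Rightarrow> nat" where "D11f m" "inj m"
    "\<And>f. computable f \<Longrightarrow> finite {e. \<exists>t. f t = Suc (2 * m e)} \<or>
       (\<exists>h. computable h \<and> (\<forall>w. 0 < h w \<longrightarrow> (\<exists>t. f t = Suc (2 * w))) \<and> finite {e. h (m e) = 0})"
proof (rule that)
  let ?m = "\<lambda>e. pick (Suc e)"
  show "D11f ?m" by (intro D11f_pick D11f_intros)
  have "strict_mono ?m" using pick_Suc(1) by (simp add: strict_mono_Suc_iff)
  then show "inj ?m" by (rule strict_mono_imp_inj_on)
  fix f assume "computable f"
  then obtain p where p: "total_prog p" "run p = f" unfolding computable_iff_run by blast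
  define d where "d = enc p"
  have d: "prog d = p" by (simp add: d_def)
  have late: "0 < run (thin (Suc d)) (?m e)" if "d \<le> e" for e
    using pick_Suc(2)[of e] that by (intro thin_antimono[of "Suc d" "Suc e"]) auto
  show "finite {e. \<exists>t. f t = Suc (2 * ?m e)} \<or>
       (\<exists>h. computable h \<and> (\<forall>w. 0 < h w \<longrightarrow> (\<exists>t. f t = Suc (2 * w))) \<and> finite {e. h (?m e) = 0})"
  proof (cases "\<forall>n. \<exists>w. n < w \<and> 0 < run (thin d) w \<and> (\<exists>t. run p t = Suc (2 * w))")
    case True
    then have th: "thinner p (thin d) (thin (Suc d))"
      using thinner_narrow[of "thin d" p] thin_total_infinite[of d] p d by (simp add: thin.simps)
    have "{e. run (thin (Suc d)) (?m e) = 0} \<subseteq> {..<d}"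
    proof
      fix e assume "e \<in> {e. run (thin (Suc d)) (?m e) = 0}"
      then have "\<not> d \<le> e" using late[of e] by auto
      then show "e \<in> {..<d}" by simp
    qed
    then have "finite {e. run (thin (Suc d)) (?m e) = 0}" by (rule finite_subset) simp
    moreover have "computable (run (thin (Suc d)))" using thin_total_infinite computable_run by blast
    moreover have "\<forall>w. 0 < run (thin (Suc d)) w \<longrightarrow> (\<exists>t. f t = Suc (2 * w))"
      using th p(2) unfolding thinner_def by blast
    ultimately show ?thesis by blast
  next
    case False
    then have fin: "finite {w. 0 < run (thin d) w \<and> (\<exists>t. f t = Suc (2 * w))}"
      using infinite_run_iff[of "\<lambda>w. 0 < run (thin d) w \<and> (\<exists>t. f t = Suc (2 * w))"] p(2) by blast
    have "{e. \<exists>t. f t = Suc (2 * ?m e)} \<subseteq> {..<d} \<union> ?m -` {w. 0 < run (thin d) w \<and> (\<exists>t. f t = Suc (2 * w))}"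
    proof
      fix e assume e: "e \<in> {e. \<exists>t. f t = Suc (2 * ?m e)}"
      show "e \<in> {..<d} \<union> ?m -` {w. 0 < run (thin d) w \<and> (\<exists>t. f t = Suc (2 * w))}"
      proof (cases "e < d")
        case False
        then have "0 < run (thin d) (?m e)" using late[of e] thin_Suc_subset by simp
        with e show ?thesis by simp
      qed simp
    qed
    moreover have "finite (?m -` {w. 0 < run (thin d) w \<and> (\<exists>t. f t = Suc (2 * w))})"
      using fin \<open>inj ?m\<close> by (rule finite_vimageI)
    ultimately have "finite {e. \<exists>t. f t = Suc (2 * ?m e)}" by (auto intro: finite_subset)
    then show ?thesis by blast
  qed
qed

section \<open>Numberings, joins and finite families\<close>

lemma EP_cong: "EP n P \<Longrightarrow> (\<And>x. P x \<longleftrightarrow> Q x) \<Longrightarrow> EP n Q"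
  unfolding EP_def SigP_def by (auto split: if_splits)

lemma EP_finite_ex:
  assumes "finite D" "\<And>a. a \<in> D \<Longrightarrow> EP (Suc n) (P a)"
  shows "EP (Suc n) (\<lambda>x. \<exists>a\<in>D. P a x)"
  using assms
proof (induction D rule: finite_induct)
  case empty
  show ?case using D11_LE[OF D11_const[of False]] by simp
next
  case (insert a D)
  then show ?case using EP_disj[of "Suc n" "P a" "\<lambda>x. \<exists>a\<in>D. P a x"] by simp
qed

lemma D11f_prod_decode:
  fixes f :: "'a :: coded \<Rightarrow> nat"
  assumes "D11f f"
  shows "D11f (\<lambda>x. fst (prod_decode (f x)))" "D11f (\<lambda>x. snd (prod_decode (f x)))"
proof -
  have "D11f (\<lambda>k. fst (prod_decode k))"
  proof (rule D11f_graph)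
    have "D11 (\<lambda>z. \<exists>u. prod_encode (snd z, u) = fst z)" by (intro D11_intros D11f_intros)
    then show "D11 (\<lambda>z. fst (prod_decode (fst z)) = snd z)"
      by (rule D11_cong) (metis fst_conv prod.collapse prod_decode_inverse prod_encode_inverse)
  qed
  then show "D11f (\<lambda>x. fst (prod_decode (f x)))" using assms by (rule D11f_comp)
  have "D11f (\<lambda>k. snd (prod_decode k))"
  proof (rule D11f_graph)
    have "D11 (\<lambda>z. \<exists>u. prod_encode (u, snd z) = fst z)" by (intro D11_intros D11f_intros)
    then show "D11 (\<lambda>z. snd (prod_decode (fst z)) = snd z)"
      by (rule D11_cong) (metis snd_conv prod.collapse prod_decode_inverse prod_encode_inverse)
  qed
  then show "D11f (\<lambda>x. snd (prod_decode (f x)))" using assms by (rule D11f_comp)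
qed

lemma E1_graph_iff_EP:
  "{prod_encode (k, x) | k x. x \<in> \<nu> k} \<in> E1 (Suc n) \<longleftrightarrow> EP (Suc n) (\<lambda>z. snd z \<in> \<nu> (fst z))"
proof -
  let ?G = "{prod_encode (k, x) | k x. x \<in> \<nu> k}"
  have mem: "prod_encode (k, x) \<in> ?G \<longleftrightarrow> x \<in> \<nu> k" for k x by auto
  show ?thesis unfolding E1_iff_EP
  proof
    assume "EP (Suc n) (\<lambda>k. k \<in> ?G)"
    then have "EP (Suc n) (\<lambda>z. prod_encode (fst z, snd z) \<in> ?G)" by (rule EP_subst) (intro D11f_intros)
    then show "EP (Suc n) (\<lambda>z. snd z \<in> \<nu> (fst z))" unfolding mem .
  next
    assume "EP (Suc n) (\<lambda>z. snd z \<in> \<nu> (fst z))"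
    then have "EP (Suc n) (\<lambda>k. snd (fst (prod_decode k), snd (prod_decode k)) \<in> \<nu> (fst (fst (prod_decode k), snd (prod_decode k))))"
      by (rule EP_subst) (intro D11f_pair D11f_prod_decode D11f_id)
    then show "EP (Suc n) (\<lambda>k. k \<in> ?G)"
    proof (rule EP_cong)
      show "snd (fst (prod_decode k), snd (prod_decode k)) \<in> \<nu> (fst (fst (prod_decode k), snd (prod_decode k))) \<longleftrightarrow> k \<in> ?G" for k
        using mem[of "fst (prod_decode k)" "snd (prod_decode k)"] by simp
    qed
  qed
qed

definition numbering_join :: "(nat \<Rightarrow> nat set) \<Rightarrow> (nat \<Rightarrow> nat set) \<Rightarrow> nat \<Rightarrow> nat set" where
  "numbering_join \<nu> \<mu> = split2 \<nu> \<mu>"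

lemma EP_numbering_join:
  assumes "EP (Suc n) (\<lambda>z. snd z \<in> \<nu> (fst z))" "EP (Suc n) (\<lambda>z. snd z \<in> \<mu> (fst z))"
  shows "EP (Suc n) (\<lambda>z. snd z \<in> numbering_join \<nu> \<mu> (fst z))"
proof -
  have half: "D11f (\<lambda>k :: nat. k div 2)"
  proof (rule D11f_graph)
    have "D11 (\<lambda>z :: nat \<times> nat. fst z = snd z + snd z \<or> fst z = Suc (snd z + snd z))" by (intro D11_intros D11f_intros)
    then show "D11 (\<lambda>z :: nat \<times> nat. fst z div 2 = snd z)" by (rule D11_cong) presburger
  qed
  have ev: "D11 (\<lambda>z :: nat \<times> nat. even (fst z))"
  proof -
    have "D11 (\<lambda>z :: nat \<times> nat. \<exists>v. fst z = v + v)" by (intro D11_intros D11f_intros)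
    then show ?thesis by (rule D11_cong) presburger
  qed
  have "EP (Suc n) (\<lambda>z. snd (fst z div 2, snd z) \<in> \<nu> (fst (fst z div 2, snd z)))"
    by (rule EP_subst[OF assms(1)]) (intro D11f_pair D11f_comp[OF half] D11f_intros)
  moreover have "EP (Suc n) (\<lambda>z. snd (fst z div 2, snd z) \<in> \<mu> (fst (fst z div 2, snd z)))"
    by (rule EP_subst[OF assms(2)]) (intro D11f_pair D11f_comp[OF half] D11f_intros)
  ultimately have "EP (Suc n) (\<lambda>z. even (fst z) \<and> snd (fst z div 2, snd z) \<in> \<nu> (fst (fst z div 2, snd z)) \<or>
      \<not> even (fst z) \<and> snd (fst z div 2, snd z) \<in> \<mu> (fst (fst z div 2, snd z)))"
    by (intro EP_disj EP_conj D11_LE[OF ev] D11_LE[OF D11_not[OF ev]])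
  then show ?thesis by (rule EP_cong) (auto simp: numbering_join_def split2_def)
qed

lemma reducible_numbering_join: "reducible \<nu> (numbering_join \<nu> \<mu>)" "reducible \<mu> (numbering_join \<nu> \<mu>)"
proof -
  have "comp_fn (Suc 0) (\<lambda>e. e 0 + e 0)" "comp_fn (Suc 0) (\<lambda>e. Suc (e 0 + e 0))" by (intro comp_fn_add comp_fn_Suc comp_fn_var)+
  then have "computable (\<lambda>x. x + x)" "computable (\<lambda>x. Suc (x + x))" unfolding computable_iff_comp_fn .
  moreover have "\<nu> = numbering_join \<nu> \<mu> \<circ> (\<lambda>x. x + x)" "\<mu> = numbering_join \<nu> \<mu> \<circ> (\<lambda>x. Suc (x + x))"
    by (auto simp: numbering_join_def fun_eq_iff mult_2[symmetric])
  ultimately show "reducible \<nu> (numbering_join \<nu> \<mu>)" "reducible \<mu> (numbering_join \<nu> \<mu>)"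
    unfolding reducible_def by blast+
qed

lemma Rogers_less_class_iff:
  assumes "\<nu> \<in> computable_numberings n S" "\<mu> \<in> computable_numberings n S"
  shows "numbering_equiv n S `` {\<nu>} \<sqsubset>\<^bsub>Rogers n S\<^esub> numbering_equiv n S `` {\<mu>} \<longleftrightarrow>
    reducible \<nu> \<mu> \<and> \<not> reducible \<mu> \<nu>"
proof -
  have "numbering_equiv n S `` {\<nu>} = numbering_equiv n S `` {\<mu>} \<longleftrightarrow> (\<nu>, \<mu>) \<in> numbering_equiv n S"
    using assms by (intro eq_equiv_class_iff[OF equiv_numbering_equiv])
  also have "\<dots> \<longleftrightarrow> reducible \<nu> \<mu> \<and> reducible \<mu> \<nu>" using assms by (simp add: numbering_equiv_def)
  finally have eq: "numbering_equiv n S `` {\<nu>} = numbering_equiv n S `` {\<mu>} \<longleftrightarrow> reducible \<nu> \<mu> \<and> reducible \<mu> \<nu>" .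
  have "eq (Rogers n S) = (=)" by (simp add: Rogers_def)
  then show ?thesis unfolding lless_def using Rogers_le_class_iff[OF assms] eq by auto
qed

text \<open>The second element is found below a member \<open>X\<close> that does not include the
  first, which keeps them different.\<close>

lemma two_minimal_elements:
  fixes S :: "nat set set"
  assumes "finite S" "S \<noteq> {}" "\<not> (\<exists>A\<in>S. \<forall>B\<in>S. A \<subseteq> B)"
  obtains A B where "A \<in> S" "B \<in> S" "A \<noteq> B"
    "\<And>C. C \<in> S \<Longrightarrow> C \<subseteq> A \<Longrightarrow> C = A" "\<And>C. C \<in> S \<Longrightarrow> C \<subseteq> B \<Longrightarrow> C = B"
proof -
  obtain A where A: "A \<in> S" "\<And>C. C \<in> S \<Longrightarrow> C \<subseteq> A \<Longrightarrow> C = A"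
    using finite_has_minimal[OF assms(1,2)] by metis
  obtain X where X: "X \<in> S" "\<not> A \<subseteq> X" using assms(3) A(1) by blast
  obtain B where B: "B \<in> S" "B \<subseteq> X" "\<And>C. C \<in> S \<Longrightarrow> C \<subseteq> B \<Longrightarrow> C = B"
    using finite_has_minimal2[OF assms(1) X(1)] by metis
  have "A \<noteq> B" using X B by blast
  with A B that show ?thesis by blast
qed

text \<open>One element of \<open>A - B\<close> is chosen for each \<open>A\<close> that has one.
  All chosen elements avoid \<open>B\<close>, so none belongs to a subset of \<open>B\<close>, and
  non-inclusion becomes a finite positive condition.\<close>

lemma finite_witnesses:
  fixes S :: "nat set set"
  assumes "finite S"
  obtains D where "finite D" "\<And>A. A \<in> S \<Longrightarrow> \<not> A \<subseteq> B \<longleftrightarrow> (\<exists>a\<in>D. a \<in> A)"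
proof -
  define d where "d A = (SOME a. a \<in> A \<and> a \<notin> B)" for A
  have d: "d A \<in> A \<and> d A \<notin> B" if "\<not> A \<subseteq> B" for A
    unfolding d_def by (rule someI_ex) (use that in blast)
  show ?thesis
  proof (rule that)
    show "finite (d ` {A \<in> S. \<not> A \<subseteq> B})" using assms by simp
    show "\<not> A \<subseteq> B \<longleftrightarrow> (\<exists>a \<in> d ` {A \<in> S. \<not> A \<subseteq> B}. a \<in> A)" if "A \<in> S" for A
      using d that by blast
  qed
qed

theorem minimal_cover_exists:
  fixes n :: nat and S :: "nat set set"
  assumes pd: "projective_determinacy"
    and S: "finite S" "S \<subseteq> E1 (Suc n)" "\<not> (\<exists>A\<in>S. \<forall>B\<in>S. A \<subseteq> B)"
    and \<nu>: "\<nu> \<in> computable_numberings (Suc n) S"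
  obtains \<kappa> where "\<kappa> \<in> computable_numberings (Suc n) S" "reducible \<nu> \<kappa>" "\<not> reducible \<kappa> \<nu>"
    "\<And>\<chi>. range \<chi> = S \<Longrightarrow> reducible \<nu> \<chi> \<Longrightarrow> reducible \<chi> \<kappa> \<Longrightarrow> reducible \<chi> \<nu> \<or> reducible \<kappa> \<chi>"
proof -
  have ran: "range \<nu> = S" and EP\<nu>: "EP (Suc n) (\<lambda>z. snd z \<in> \<nu> (fst z))"
    using \<nu> unfolding computable_numberings_def E1_graph_iff_EP by auto
  then have "S \<noteq> {}" by auto
  then obtain B0 B1 where B: "B0 \<in> S" "B1 \<in> S" "B0 \<noteq> B1"
    and min: "\<And>C. C \<in> S \<Longrightarrow> C \<subseteq> B0 \<Longrightarrow> C = B0" "\<And>C. C \<in> S \<Longrightarrow> C \<subseteq> B1 \<Longrightarrow> C = B1"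
    using two_minimal_elements[OF S(1) _ S(3)] by metis
  have LEP: "EP (Suc n) (\<lambda>k. k \<in> {k. \<not> \<nu> k \<subseteq> C})" for C
  proof -
    obtain D where D: "finite D" "\<And>A. A \<in> S \<Longrightarrow> \<not> A \<subseteq> C \<longleftrightarrow> (\<exists>a\<in>D. a \<in> A)"
      using finite_witnesses[OF S(1), of C] by metis
    have "EP (Suc n) (\<lambda>k. a \<in> \<nu> k)" for a
      using EP_subst[OF EP\<nu>, of "\<lambda>k. (k, a)"] D11f_pair[OF D11f_id D11f_const[of a]] by simp
    then have "EP (Suc n) (\<lambda>k. \<exists>a\<in>D. a \<in> \<nu> k)" by (intro EP_finite_ex[OF D(1)])
    then show ?thesis by (rule EP_cong) (use D(2) ran in auto)
  qed
  \<comment> \<open>By minimality such a \<open>\<nu> k\<close> would be equal to both sets.\<close>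
  have "\<not> (\<nu> k \<subseteq> B0 \<and> \<nu> k \<subseteq> B1)" for k
    using min[of "\<nu> k"] B(3) ran by blast
  then have "{k. \<not> \<nu> k \<subseteq> B0} \<union> {k. \<not> \<nu> k \<subseteq> B1} = UNIV" by blast
  from reduction_total[OF pd LEP LEP this] obtain H where H: "H \<subseteq> {k. \<not> \<nu> k \<subseteq> B0}" "- H \<subseteq> {k. \<not> \<nu> k \<subseteq> B1}"
    and LEH: "EP (Suc n) (\<lambda>k. k \<in> H)" "EP (Suc n) (\<lambda>k. k \<notin> H)" by blast
  obtain m :: "nat \<Rightarrow> nat" where m: "D11f m" "inj m" and coh: "\<And>f. computable f \<Longrightarrow> finite {e. \<exists>t. f t = Suc (2 * m e)} \<or>
       (\<exists>h. computable h \<and> (\<forall>w. 0 < h w \<longrightarrow> (\<exists>t. f t = Suc (2 * w))) \<and> finite {e. h (m e) = 0})"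
    by (rule cohesive_sequence, rule that, assumption, assumption, blast)
  \<comment> \<open>On \<open>T\<close> the diagonal value is \<open>B1\<close>: there
    \<open>run (prog e) x\<close> is outside \<open>H\<close>, so its \<open>\<nu>\<close> value is
    not included in \<open>B1\<close>. Inside \<open>H\<close> the value \<open>B0\<close> is safe
    for the same reason.\<close>
  define T where "T = {x. \<exists>e. x = m e \<and> total_prog (prog e) \<and> run (prog e) x \<notin> H}"
  define \<mu> where "\<mu> x = (if x \<in> T then B1 else B0)" for x
  let ?i = "\<lambda>x. LEAST e. x = m e"
  \<comment> \<open>The inverse \<open>?i\<close> of \<open>m\<close> supplies \<open>e\<close> by a
    \<Delta>^1_1 function instead of a quantifier. Membership in \<open>T\<close> and its negation
    are then conditions on \<open>H\<close> and its complement at one substituted point.\<close>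
  have T: "x \<in> T \<longleftrightarrow> (\<exists>e. x = m e) \<and> total_prog (prog (?i x)) \<and> run (prog (?i x)) x \<notin> H" for x
  proof (cases "\<exists>e. x = m e")
    case True
    then obtain e where e: "x = m e" by blast
    then have "?i x = e" using m(2) by (intro Least_equality) (auto dest: injD)
    moreover have "x \<in> T \<longleftrightarrow> total_prog (prog e) \<and> run (prog e) x \<notin> H"
      using e m(2) unfolding T_def by (auto dest: injD)
    ultimately show ?thesis using True by simp
  qed (auto simp: T_def)
  have i: "D11f ?i" by (intro D11f_Least D11_intros D11f_comp[OF m(1)] D11f_intros)
  have C: "D11 (\<lambda>x. \<exists>e. x = m e)" by (intro D11_intros D11f_comp[OF m(1)] D11f_intros)
  have P: "D11 (\<lambda>x. total_prog (prog (?i x)))" by (intro D11_total_prog D11f_inv_enc i)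
  have r: "D11f (\<lambda>x. run (prog (?i x)) x)" by (intro D11f_run D11f_inv_enc i D11f_id)
  have "EP (Suc n) (\<lambda>x. (\<exists>e. x = m e) \<and> total_prog (prog (?i x)) \<and> run (prog (?i x)) x \<notin> H)"
    by (intro EP_conj D11_LE[OF C] D11_LE[OF P] EP_subst[OF LEH(2) r])
  then have LET: "EP (Suc n) (\<lambda>x. x \<in> T)" by (rule EP_cong) (rule T[symmetric])
  have "EP (Suc n) (\<lambda>x. \<not> (\<exists>e. x = m e) \<or> \<not> total_prog (prog (?i x)) \<or> run (prog (?i x)) x \<in> H)"
    by (intro EP_disj D11_LE[OF D11_not[OF C]] D11_LE[OF D11_not[OF P]] EP_subst[OF LEH(1) r])
  then have LET': "EP (Suc n) (\<lambda>x. x \<notin> T)" by (rule EP_cong) (unfold T, blast)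
  have LEB: "EP (Suc n) (\<lambda>k. k \<in> B0)" "EP (Suc n) (\<lambda>k. k \<in> B1)" using B S(2) E1_iff_EP by blast+
  have LEf: "EP (Suc n) (\<lambda>z :: nat \<times> nat. Q (fst z))" "EP (Suc n) (\<lambda>z :: nat \<times> nat. Q (snd z))"
    if "EP (Suc n) Q" for Q :: "nat \<Rightarrow> bool"
    using EP_subst[OF that D11f_fst[OF D11f_id]] EP_subst[OF that D11f_snd[OF D11f_id]] by auto
  \<comment> \<open>Both \<open>T\<close> and its complement occur positively, which is why both
    \<open>H\<close> and its complement had to be in the class.\<close>
  have "EP (Suc n) (\<lambda>z. fst z \<in> T \<and> snd z \<in> B1 \<or> fst z \<notin> T \<and> snd z \<in> B0)"
    by (intro EP_disj EP_conj LEf(1)[OF LET] LEf(1)[OF LET'] LEf(2)[OF LEB(1)] LEf(2)[OF LEB(2)])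
  then have EP\<mu>: "EP (Suc n) (\<lambda>z. snd z \<in> \<mu> (fst z))" by (rule EP_cong) (auto simp: \<mu>_def)
  define \<kappa> where "\<kappa> = numbering_join \<nu> \<mu>"
  have \<kappa>: "\<kappa> (2 * x) = \<nu> x" "\<kappa> (Suc (2 * x)) = \<mu> x" for x by (simp_all add: \<kappa>_def numbering_join_def)
  have "range \<kappa> = S"
  proof
    show "range \<kappa> \<subseteq> S"
      using B ran unfolding \<kappa>_def numbering_join_def split2_def \<mu>_def by auto
    show "S \<subseteq> range \<kappa>" using \<kappa>(1) unfolding ran[symmetric] by (metis image_subsetI rangeI)
  qed
  moreover have "{prod_encode (k, x) | k x. x \<in> \<kappa> k} \<in> E1 (Suc n)"
    unfolding E1_graph_iff_EP \<kappa>_def by (rule EP_numbering_join[OF EP\<nu> EP\<mu>])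
  ultimately have \<kappa>_comp: "\<kappa> \<in> computable_numberings (Suc n) S" unfolding computable_numberings_def by blast
  have red: "reducible \<nu> \<kappa>" "reducible \<mu> \<kappa>" unfolding \<kappa>_def by (rule reducible_numbering_join)+
  have "\<not> reducible \<mu> \<nu>"
  proof
    assume "reducible \<mu> \<nu>"
    then obtain f where f: "computable f" "\<mu> = \<nu> \<circ> f" unfolding reducible_def by blast
    obtain p where p: "total_prog p" "run p = f" using f(1) unfolding computable_iff_run by blast
    define e where "e = enc p"
    have e: "prog e = p" by (simp add: e_def)
    \<comment> \<open>The point \<open>m e\<close> is reserved for the program computing
      \<open>f\<close>, and there \<open>\<mu>\<close> was given a value different from that of
      \<open>\<nu>\<close> at \<open>f (m e)\<close>.\<close>
    have "m e \<in> T \<longleftrightarrow> f (m e) \<notin> H" using e p m(2) unfolding T_def by (auto dest: injD)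
    moreover have "\<mu> (m e) = \<nu> (f (m e))" using f(2) by simp
    ultimately show False using H unfolding \<mu>_def by (auto split: if_splits)
  qed
  then have "\<not> reducible \<kappa> \<nu>" using red(2) reducible_trans by blast
  moreover have "reducible \<chi> \<nu> \<or> reducible \<kappa> \<chi>" if \<chi>: "range \<chi> = S" "reducible \<nu> \<chi>" "reducible \<chi> \<kappa>" for \<chi>
  proof -
    obtain f where f: "computable f" "\<chi> = \<kappa> \<circ> f" using \<chi>(3) unfolding reducible_def by blast
    have notT: "w \<notin> T" if "\<And>e. w \<noteq> m e" for w using that unfolding T_def by blast
    from coh[OF f(1)] show ?thesis
    proof
      assume fin: "finite {e. \<exists>t. f t = Suc (2 * m e)}"
      obtain i0 i1 where i: "\<nu> i0 = B0" "\<nu> i1 = B1" using B ran by (metis imageE)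
      \<comment> \<open>Off \<open>T\<close> the value of \<open>\<mu>\<close> is \<open>B0\<close>.
        Among the indices that \<open>f\<close> uses, the value is therefore constant except on the
        finite set \<open>X\<close>, and \<open>g\<close> has to be correct only at these
        indices.\<close>
      define X where "X = {w \<in> T. \<exists>t. f t = Suc (2 * w)}"
      have "X \<subseteq> m ` {e. \<exists>t. f t = Suc (2 * m e)}" unfolding X_def T_def by blast
      with fin have "finite X" by (meson finite_imageI finite_subset)
      define g where "g w = (if w \<in> X then i1 else i0)" for w
      have "computable (\<lambda>_. i0)" unfolding computable_iff_comp_fn by (rule comp_fn_const)
      moreover have "finite {x. g x \<noteq> i0}" by (rule finite_subset[OF _ \<open>finite X\<close>]) (auto simp: g_def)
      ultimately have g: "computable g" by (rule computable_almost_equal)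
      let ?h = "\<lambda>x. if even (f x) then f x div 2 else g (f x div 2)"
      have "computable ?h" unfolding computable_iff_comp_fn
        by (intro comp_fn_if comp_pred_even comp_fn_half comp_fn_comp1[OF f(1)] comp_fn_comp1[OF g] comp_fn_var)
      moreover have "\<chi> = \<nu> \<circ> ?h"
      proof
        fix x
        show "\<chi> x = (\<nu> \<circ> ?h) x"
        proof (cases "even (f x)")
          case True
          then show ?thesis using \<kappa>(1)[of "f x div 2"] f(2) by simp
        next
          case False
          then have fx: "f x = Suc (2 * (f x div 2))" by simp
          then have "\<chi> x = \<mu> (f x div 2)" using f(2) \<kappa>(2)[of "f x div 2"] by simp
          also have "\<dots> = \<nu> (g (f x div 2))"
            using fx i unfolding \<mu>_def g_def X_def by auto
          finally show ?thesis using False by simp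
        qed
      qed
      ultimately show ?thesis unfolding reducible_def by blast
    next
      assume "\<exists>h. computable h \<and> (\<forall>w. 0 < h w \<longrightarrow> (\<exists>t. f t = Suc (2 * w))) \<and> finite {e. h (m e) = 0}"
      then obtain h where h: "computable h" "\<And>w. 0 < h w \<Longrightarrow> \<exists>t. f t = Suc (2 * w)" and fin: "finite {e. h (m e) = 0}"
        by blast
      obtain j0 j1 where j: "\<chi> j0 = B0" "\<chi> j1 = B1" using B \<chi>(1) by (metis imageE)
      obtain p where p: "computable p" "\<nu> = \<chi> \<circ> p" using \<chi>(2) unfolding reducible_def by blast
      \<comment> \<open>The disjunct \<open>h w \<le> 0\<close> stops the search where no suitable
        \<open>t\<close> need exist.\<close>
      let ?s = "\<lambda>w. LEAST t. h w \<le> 0 \<or> f t = Suc (w + w)"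
      have "comp_fn (Suc 0) (\<lambda>e. LEAST t. h (e 0) \<le> 0 \<or> f t = Suc (e 0 + e 0))"
      proof (rule comp_fn_Least[where P = "\<lambda>t e. h (e 0) \<le> 0 \<or> f t = Suc (e 0 + e 0)"])
        show "comp_pred (Suc (Suc 0)) (\<lambda>e. h (e (Suc 0)) \<le> 0 \<or> f (e 0) = Suc (e (Suc 0) + e (Suc 0)))"
          by (intro comp_pred_disj comp_pred_le comp_pred_eq comp_fn_Suc comp_fn_add comp_fn_comp1[OF h(1)] comp_fn_comp1[OF f(1)] comp_fn_const comp_fn_var)
        show "\<exists>t. h (e 0) \<le> 0 \<or> f t = Suc (e 0 + e 0)" for e :: "nat \<Rightarrow> nat"
          using h(2)[of "e 0"] by (auto simp: mult_2)
      qed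
      then have s: "computable ?s" unfolding computable_iff_comp_fn .
      have fs: "f (?s w) = Suc (2 * w)" if "0 < h w" for w
      proof -
        have "\<exists>t. h w \<le> 0 \<or> f t = Suc (w + w)" using h(2)[OF that] by (auto simp: mult_2)
        from LeastI_ex[OF this] that show ?thesis by (simp add: mult_2)
      qed
      let ?g0 = "\<lambda>w. if h w \<le> 0 then j0 else ?s w"
      have g0: "computable ?g0" unfolding computable_iff_comp_fn
        by (intro comp_fn_if comp_pred_le comp_fn_comp1[OF h(1)] comp_fn_comp1[OF s] comp_fn_const comp_fn_var)
      \<comment> \<open>Where \<open>h\<close> vanishes, \<open>\<mu>\<close> can differ from
        \<open>B0\<close> only at the finitely many points of \<open>X\<close>, whose values are
        tabulated.\<close>
      define X where "X = m ` {e. h (m e) = 0}"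
      have "finite X" using fin by (simp add: X_def)
      define g where "g w = (if w \<in> X then if w \<in> T then j1 else j0 else ?g0 w)" for w
      have "finite {x. g x \<noteq> ?g0 x}" by (rule finite_subset[OF _ \<open>finite X\<close>]) (auto simp: g_def)
      with g0 have g: "computable g" by (rule computable_almost_equal)
      have \<chi>g: "\<chi> (g w) = \<mu> w" for w
      proof -
        consider "w \<in> X" | "w \<notin> X" "h w = 0" | "w \<notin> X" "0 < h w" by blast
        then show ?thesis
        proof cases
          case 1
          then show ?thesis using j by (simp add: g_def \<mu>_def)
        next
          case 2
          then have "w \<notin> T" by (intro notT) (auto simp: X_def)
          with 2 show ?thesis using j by (simp add: g_def \<mu>_def)
        next
          case 3
          then have "g w = ?s w" by (simp add: g_def)
          then show ?thesis using fs[OF 3(2)] f(2) \<kappa>(2)[of w] by simp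
        qed
      qed
      let ?h = "\<lambda>x. if even x then p (x div 2) else g (x div 2)"
      have "computable ?h" unfolding computable_iff_comp_fn
        by (intro comp_fn_if comp_pred_even comp_fn_half comp_fn_comp1[OF p(1)] comp_fn_comp1[OF g] comp_fn_var)
      moreover have "\<kappa> = \<chi> \<circ> ?h"
      proof
        fix x
        show "\<kappa> x = (\<chi> \<circ> ?h) x"
        proof (cases "even x")
          case True
          then show ?thesis using \<kappa>(1)[of "x div 2"] p(2) by simp
        next
          case False
          then have "x = Suc (2 * (x div 2))" by simp
          then show ?thesis using \<kappa>(2)[of "x div 2"] False \<chi>g[of "x div 2"] by simp
        qed
      qed
      ultimately show ?thesis unfolding reducible_def by blast
    qed
  qed
  ultimately show ?thesis using that \<kappa>_comp red(1) by blast
qed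

theorem theorem4p7:
  fixes n :: nat and S :: "nat set set"
  assumes "projective_determinacy"
    and "n \<ge> 1"
    and "finite S"
    and "S \<subseteq> E1 n"
    and "\<not> (\<exists>A\<in>S. \<forall>B\<in>S. A \<subseteq> B)"
  shows "(\<forall>a\<in>carrier (Rogers n S). \<exists>b\<in>carrier (Rogers n S). minimal_cover (Rogers n S) a b) \<and>
         (\<forall>a\<in>carrier (Rogers n S). \<exists>b\<in>carrier (Rogers n S). a \<sqsubset>\<^bsub>Rogers n S\<^esub> b)"
proof -
  obtain k where n: "n = Suc k" using assms(2) by (cases n) auto
  let ?N = "computable_numberings n S" and ?R = "numbering_equiv n S"
  have carrier: "carrier (Rogers n S) = ?N // ?R" by (simp add: Rogers_def)
  have "\<exists>b\<in>carrier (Rogers n S). minimal_cover (Rogers n S) a b" if a: "a \<in> carrier (Rogers n S)" for a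
  proof -
    obtain \<nu> where \<nu>: "\<nu> \<in> ?N" "a = ?R `` {\<nu>}" using a unfolding carrier by (rule quotientE)
    obtain \<kappa> where \<kappa>: "\<kappa> \<in> ?N" "reducible \<nu> \<kappa>" "\<not> reducible \<kappa> \<nu>"
      "\<And>\<chi>. range \<chi> = S \<Longrightarrow> reducible \<nu> \<chi> \<Longrightarrow> reducible \<chi> \<kappa> \<Longrightarrow> reducible \<chi> \<nu> \<or> reducible \<kappa> \<chi>"
      using minimal_cover_exists[OF assms(1,3) _ assms(5), of k \<nu>] assms(4) \<nu>(1) unfolding n by metis
    let ?b = "?R `` {\<kappa>}"
    have b: "?b \<in> carrier (Rogers n S)" unfolding carrier using \<kappa>(1) by (rule quotientI)
    have "a \<sqsubset>\<^bsub>Rogers n S\<^esub> ?b" unfolding \<nu>(2) using \<nu>(1) \<kappa> by (simp add: Rogers_less_class_iff)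
    \<comment> \<open>The dichotomy for \<open>\<kappa>\<close> identifies every class in between
      with one of the ends.\<close>
    moreover have "\<not> (a \<sqsubset>\<^bsub>Rogers n S\<^esub> c \<and> c \<sqsubset>\<^bsub>Rogers n S\<^esub> ?b)" if c: "c \<in> carrier (Rogers n S)" for c
    proof -
      obtain \<chi> where \<chi>: "\<chi> \<in> ?N" "c = ?R `` {\<chi>}" using c unfolding carrier by (rule quotientE)
      have "range \<chi> = S" using \<chi>(1) by (simp add: computable_numberings_def)
      with \<kappa>(4)[of \<chi>] show ?thesis
        unfolding \<nu>(2) \<chi>(2) Rogers_less_class_iff[OF \<nu>(1) \<chi>(1)] Rogers_less_class_iff[OF \<chi>(1) \<kappa>(1)] by blast
    qed
    ultimately show ?thesis unfolding minimal_cover_def using a b by blast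
  qed
  then show ?thesis unfolding minimal_cover_def by blast
qed

end
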